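(* Let $\xi$ be a nonnegative random variable with a nondegenerate distribution, and let $\hat N(t)$ be the associated decoupled renewal process. Let $b\in(0,1)$. Assume that $\mathbb{P}\{\xi\leq x\}<1$ for all $x\geq 0$ and $\mathbb{E}[\mathrm{e}^{s\xi}]<\infty$ for some $s>0$. Then $$\lim_{t\to\infty}\frac{-\log\mathbb{P}\{\hat N(t)=\lfloor b\mu^{-1}t\rfloor\}}{t^2}=\int_{b\mu^{-1}}^{\mu^{-1}}yI(1/y)\,\mathrm{d}y<\infty,$$ where $\mu=\mathbb{E}[\xi]<\infty$. Under the additional assumptions that the distribution of $\xi$ is nonlattice and $\mu/b<A_0$, $$-\log\mathbb{P}\{\hat N(t)=\lfloor b\mu^{-1}t\rfloor\}=t^2\cdot\int_{b\mu^{-1}}^{\mu^{-1}}yI(1/y)\,\mathrm{d}y+\frac{1-b}{2\mu}t\log t+O(t),\quad t\to\infty.$$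
   Context: Decoupled renewal process: let $\xi_1,\xi_2,\ldots$ be independent copies of $\xi$ and $S_n=\xi_1+\ldots+\xi_n$, $n\ge 1$. Let $\hat S_1,\hat S_2,\ldots$ be independent random variables such that, for each $n\geq 1$, $\hat S_n$ has the same distribution as $S_n$. Put $\hat N(t):=\sum_{n\geq 1}\mathbf{1}_{\{\hat S_n\leq t\}}$ for $t\geq 0$. Let $\Lambda(s)=\mathbb{E}[\mathrm{e}^{s\xi}]$, $s\in\mathbb{R}$, be the moment generating function of $\xi$, and $D:=\{s\geq 0:\Lambda(s)<\infty\}$, $B:=\sup D$. The function $I$ is the Legendre transform of $s\mapsto\log\Lambda(s)$, which for $x\geq\mu$ satisfies $$I(x)=\sup_{s\geq 0}(sx-\log\Lambda(s))=\sup_{s\in D}(sx-\log\Lambda(s)).$$ Put $m(s)=\Lambda'(s)/\Lambda(s)$ for $s\in(0,B)$; this function is strictly increasing and continuous on $(0,B)$. Put $A_0:=\lim_{s\to B-}m(s)$, which may be infinite. The distribution of $\xi$ is called nonlattice if it is not concentrated on any lattice $(s_1k+s_2)_{k\geq 0}$ with $s_1>0$ and $s_2\geq 0$. *)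

theory Defs
  imports "HOL-Probability.Probability" "HOL-Library.Landau_Symbols"
begin

definition mgf :: "'a measure \<Rightarrow> ('a \<Rightarrow> real) \<Rightarrow> real \<Rightarrow> ennreal" where
  "mgf M \<xi> s = (\<integral>\<^sup>+ \<omega>. ennreal (exp (s * \<xi> \<omega>)) \<partial>M)"

definition extended_ln :: "ennreal \<Rightarrow> ereal" where
  "extended_ln x = (if x = 0 then -\<infinity> else if x = \<infinity> then \<infinity> else ereal (ln (enn2real x)))"

definition legendre :: "(real \<Rightarrow> ereal) \<Rightarrow> real \<Rightarrow> ereal" where
  "legendre f x = (SUP s. ereal (s * x) - f s)"

definition rate_fun :: "'a measure \<Rightarrow> ('a \<Rightarrow> real) \<Rightarrow> real \<Rightarrow> ereal" where
  "rate_fun M \<xi> = legendre (\<lambda>s. extended_ln (mgf M \<xi> s))"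

definition mgf_domain :: "'a measure \<Rightarrow> ('a \<Rightarrow> real) \<Rightarrow> real set" where
  "mgf_domain M \<xi> = {s. s \<ge> 0 \<and> mgf M \<xi> s < \<infinity>}"

definition mgf_bound :: "'a measure \<Rightarrow> ('a \<Rightarrow> real) \<Rightarrow> ereal" where
  "mgf_bound M \<xi> = (SUP s \<in> mgf_domain M \<xi>. ereal s)"

definition tilted_mean :: "'a measure \<Rightarrow> ('a \<Rightarrow> real) \<Rightarrow> real \<Rightarrow> real" where
  "tilted_mean M \<xi> s = deriv (\<lambda>u. enn2real (mgf M \<xi> u)) s / enn2real (mgf M \<xi> s)"

(* The filter is the left-sided approach s -> B-, covering B = \<infinity> as well (there it is at_top).
   The limit exists in the extended reals because the function is increasing on (0,B). *)
definition tilted_mean_sup :: "'a measure \<Rightarrow> ('a \<Rightarrow> real) \<Rightarrow> ereal" where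
  "tilted_mean_sup M \<xi> =
     Lim (filtercomap ereal (at_left (mgf_bound M \<xi>))) (\<lambda>s. ereal (tilted_mean M \<xi> s))"

definition nonlattice :: "'a measure \<Rightarrow> ('a \<Rightarrow> real) \<Rightarrow> bool" where
  "nonlattice M \<xi> \<longleftrightarrow>
     \<not> (\<exists>s1 > 0. \<exists>s2 \<ge> 0. AE \<omega> in M. \<exists>k::nat. \<xi> \<omega> = s1 * real k + s2)"

(* Sequences are indexed from 1; the value at index 0 is never used. *)
definition counting_process :: "(nat \<Rightarrow> 'a \<Rightarrow> real) \<Rightarrow> real \<Rightarrow> 'a \<Rightarrow> ennreal" where
  "counting_process S t \<omega> = (\<Sum>n. indicator {\<omega>. S (Suc n) \<omega> \<le> t} \<omega>)"

(* Sh is the decoupled walk: the Sh n are independent of each other, and only their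
   one-dimensional laws are those of the partial sums of i.i.d. copies X i of \<xi>. *)
definition decoupled_walk ::
    "'a measure \<Rightarrow> ('a \<Rightarrow> real) \<Rightarrow> (nat \<Rightarrow> 'a \<Rightarrow> real) \<Rightarrow> (nat \<Rightarrow> 'a \<Rightarrow> real) \<Rightarrow> bool" where
  "decoupled_walk M \<xi> X Sh \<longleftrightarrow>
     prob_space.indep_vars M (\<lambda>_. borel) X {1..} \<and>
     (\<forall>i\<ge>1. distr M borel (X i) = distr M borel \<xi>) \<and>
     prob_space.indep_vars M (\<lambda>_. borel) Sh {1..} \<and>
     (\<forall>n\<ge>1. distr M borel (Sh n) = distr M borel (\<lambda>\<omega>. \<Sum>i=1..n. X i \<omega>))"

(* On the range of integration 1/y is at least the mean of \<xi>. The rate function is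
   nonnegative (take s = 0 in the supremum), so e2ennreal truncates nothing. *)
definition rate_integral :: "'a measure \<Rightarrow> ('a \<Rightarrow> real) \<Rightarrow> real \<Rightarrow> real \<Rightarrow> ennreal" where
  "rate_integral M \<xi> u v =
     (\<integral>\<^sup>+ y \<in> {u..v}. (ennreal y * e2ennreal (rate_fun M \<xi> (1 / y))) \<partial>lborel)"

end

theory Submission
  imports Defs "HOL-Real_Asymp.Real_Asymp"
begin

text \<open>
  Write \<open>q n t = P(S\<^sub>n > t)\<close>, \<open>k = \<lfloor>b t / \<mu>\<rfloor>\<close> and \<open>T = \<lfloor>t / \<mu>\<rfloor>\<close>. As \<open>q\<close> increases in \<open>n\<close>, summing over the
  at most \<open>2\<^sup>T\<close> possible sets of indices \<open>n \<le> T\<close> that are counted gives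
  \<open>P(N(t) = k) \<le> 2\<^sup>T \<Prod>\<^bsub>k<n\<le>T\<^esub> q n t\<close>; counting exactly the indices \<open>n \<le> k\<close> gives the reverse bound up to
  a factor \<open>exp (- O(t))\<close>. So everything reduces to sums of \<open>- ln (q n t)\<close> over \<open>k < n \<le> T\<close>, whose main
  parts \<open>n I(t/n)\<close> are Riemann sums of the decreasing function \<open>rate y = y I(1/y)\<close>.

  Up to constants \<open>q n t\<close> is \<open>exp (- n I(t/n)) / sqrt n\<close>. After exponential tilting this is a two-sided
  local estimate \<open>1 / sqrt n\<close> for random walks. It is proved without Fourier analysis: the step law
  is a fair mixture of the laws of \<open>Y0 \<le> Y1\<close>, obtained from the minimum and the maximum of two independent
  copies, so the \<open>n\<close>-step law is a binomial mixture, and expectations telescope when the steps are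
  switched from \<open>Y0\<close> to \<open>Y1\<close> one at a time. Constants are uniform in the tilt because \<open>\<xi> \<ge> 0\<close>.
  Without the condition on the tilted means, the lower bound for \<open>q\<close> is applied to \<open>min \<xi> L\<close> and \<open>L\<close>
  tends to infinity.
\<close>

section \<open>Translation operators and binomial mixtures\<close>

text \<open>The logarithm of the probability is a sum of order \<open>t\<close> terms
  \<open>- ln (q n t)\<close>, so a multiplicative constant in the estimate of \<open>q n t\<close>
  costs only \<open>O(t)\<close> if it is uniform in \<open>n\<close>; hence order-of-magnitude
  local estimates suffice. The factor \<open>1 / sqrt n\<close> cannot be absorbed in this way: it
  contributes half the sum of \<open>ln n\<close> over \<open>k < n \<le> T\<close>, about
  \<open>(1 - b) / (2 * \<mu>) * t * ln t\<close>, the second term of the expansion. Uniformity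
  fails in one place: for \<open>n\<close> near \<open>t / \<mu>\<close> the tilt \<open>s\<close>
  tends to 0, and the upper bound carries a factor \<open>1 / s\<close>. It is of order at most
  \<open>T / (T - n)\<close>, and the product of these ratios over \<open>n < T\<close> is at most
  \<open>exp T\<close>.

  Random walks enter as powers of the operator that sends \<open>f\<close> to the expectation of
  \<open>f (x + \<xi>)\<close>. The binomial mixture is then the binomial theorem for two commuting
  operators, and no space carrying \<open>n\<close> coupled steps has to be built. Functions take
  values in \<open>ennreal\<close>, so integrability conditions do not arise for the
  operators.\<close>

definition shift_op :: "'b measure \<Rightarrow> ('b \<Rightarrow> real) \<Rightarrow> (real \<Rightarrow> ennreal) \<Rightarrow> real \<Rightarrow> ennreal" where
  "shift_op Q Y f x = (\<integral>\<^sup>+ \<omega>. f (x + Y \<omega>) \<partial>Q)"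

text \<open>The properties of a Markov operator that the telescoping uses. They are demanded on
  Borel functions only, since Fubini and additivity of the integral need measurability.\<close>

definition pos_lin :: "((real \<Rightarrow> ennreal) \<Rightarrow> real \<Rightarrow> ennreal) \<Rightarrow> bool" where
  "pos_lin A \<longleftrightarrow>
     (\<forall>f \<in> borel_measurable borel. A f \<in> borel_measurable borel) \<and>
     (\<forall>f \<in> borel_measurable borel. \<forall>g \<in> borel_measurable borel. A (\<lambda>x. f x + g x) = (\<lambda>x. A f x + A g x)) \<and>
     (\<forall>c. \<forall>f \<in> borel_measurable borel. A (\<lambda>x. c * f x) = (\<lambda>x. c * A f x)) \<and>
     (\<forall>f \<in> borel_measurable borel. \<forall>g \<in> borel_measurable borel. (\<forall>x. f x \<le> g x) \<longrightarrow> (\<forall>x. A f x \<le> A g x)) \<and>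
     A (\<lambda>_. 1) = (\<lambda>_. 1)"

lemma
  assumes "pos_lin A"
  shows pos_lin_meas: "f \<in> borel_measurable borel \<Longrightarrow> A f \<in> borel_measurable borel"
    and pos_lin_add: "f \<in> borel_measurable borel \<Longrightarrow> g \<in> borel_measurable borel \<Longrightarrow>
           A (\<lambda>x. f x + g x) = (\<lambda>x. A f x + A g x)"
    and pos_lin_cmult: "f \<in> borel_measurable borel \<Longrightarrow> A (\<lambda>x. c * f x) = (\<lambda>x. c * A f x)"
    and pos_lin_mono: "f \<in> borel_measurable borel \<Longrightarrow> g \<in> borel_measurable borel \<Longrightarrow>
           (\<And>x. f x \<le> g x) \<Longrightarrow> A f x \<le> A g x"
    and pos_lin_one: "A (\<lambda>_. 1) = (\<lambda>_. 1)"
  using assms unfolding pos_lin_def by blast+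

lemma pos_lin_const: "pos_lin A \<Longrightarrow> A (\<lambda>_. c) = (\<lambda>_. c)"
  using pos_lin_cmult[of A "\<lambda>_. 1" c] pos_lin_one[of A] by simp

lemma pos_lin_comp:
  assumes "pos_lin A" "pos_lin B"
  shows "pos_lin (\<lambda>f. A (B f))"
  unfolding pos_lin_def
proof (intro conjI ballI allI impI)
  fix f g :: "real \<Rightarrow> ennreal" and x :: real
  assume "f \<in> borel_measurable borel" "g \<in> borel_measurable borel" "\<forall>x. f x \<le> g x"
  then show "A (B f) x \<le> A (B g) x"
    by (intro pos_lin_mono[OF assms(1)] pos_lin_mono[OF assms(2)] pos_lin_meas[OF assms(2)]) auto
qed (simp_all add: pos_lin_meas assms pos_lin_add pos_lin_cmult pos_lin_one)

lemma pos_lin_funpow: "pos_lin A \<Longrightarrow> pos_lin (A ^^ n)"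
proof (induction n)
  case 0
  then show ?case by (simp add: pos_lin_def)
next
  case (Suc n)
  then show ?case using pos_lin_comp[of A "A ^^ n"] by (simp add: o_def)
qed

lemma pos_lin_sum:
  assumes "pos_lin A" "\<And>i. i \<in> I \<Longrightarrow> f i \<in> borel_measurable borel"
  shows "A (\<lambda>x. \<Sum>i\<in>I. f i x) = (\<lambda>x. \<Sum>i\<in>I. A (f i) x)"
proof (cases "finite I")
  case True
  then show ?thesis using assms(2)
    by (induction I) (simp_all add: pos_lin_const[OF assms(1)] pos_lin_add[OF assms(1)])
next
  case False
  then show ?thesis by (simp add: pos_lin_const[OF assms(1)])
qed

lemma shift_op_measurable:
  assumes "sigma_finite_measure Q" and [measurable]: "Y \<in> borel_measurable Q" "f \<in> borel_measurable borel"
  shows "shift_op Q Y f \<in> borel_measurable borel"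
proof -
  interpret sigma_finite_measure Q by fact
  show ?thesis unfolding shift_op_def by measurable
qed

lemma pos_lin_shift_op:
  assumes "prob_space Q" and [measurable]: "Y \<in> borel_measurable Q"
  shows "pos_lin (shift_op Q Y)"
proof -
  interpret prob_space Q by fact
  show ?thesis unfolding pos_lin_def
  proof (intro conjI ballI allI impI)
    show "shift_op Q Y f \<in> borel_measurable borel" if "f \<in> borel_measurable borel" for f
      by (rule shift_op_measurable[OF sigma_finite_measure_axioms assms(2) that])
  qed (auto simp: shift_op_def fun_eq_iff nn_integral_add nn_integral_cmult emeasure_space_1 intro!: nn_integral_mono)
qed

text \<open>Fubini on the product of the two spaces. Commutation makes the order of the steps
  irrelevant, so a mixed walk is described by the number of its \<open>Y1\<close>-steps.\<close>

lemma shift_op_commute: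
  assumes "prob_space Q" "prob_space R" and [measurable]: "Y \<in> borel_measurable Q" "Z \<in> borel_measurable R"
    "f \<in> borel_measurable borel"
  shows "shift_op Q Y (shift_op R Z f) = shift_op R Z (shift_op Q Y f)"
proof
  fix x
  interpret Q: prob_space Q by fact
  interpret R: prob_space R by fact
  interpret pair_sigma_finite Q R ..
  have "shift_op Q Y (shift_op R Z f) x = (\<integral>\<^sup>+ \<omega>. \<integral>\<^sup>+ \<omega>'. f (x + Y \<omega> + Z \<omega>') \<partial>R \<partial>Q)"
    by (simp add: shift_op_def)
  also have "\<dots> = (\<integral>\<^sup>+ \<omega>'. \<integral>\<^sup>+ \<omega>. f (x + Y \<omega> + Z \<omega>') \<partial>Q \<partial>R)"
    by (rule Fubini'[symmetric]) measurable
  also have "\<dots> = shift_op R Z (shift_op Q Y f) x"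
    by (simp add: shift_op_def algebra_simps)
  finally show "shift_op Q Y (shift_op R Z f) x = shift_op R Z (shift_op Q Y f) x" .
qed

lemma funpow_commute_on:
  assumes "pos_lin A" "pos_lin B"
    and comm: "\<And>f. f \<in> borel_measurable borel \<Longrightarrow> A (B f) = B (A f)"
    and f: "f \<in> borel_measurable borel"
  shows "A ((B ^^ n) f) = (B ^^ n) (A f)"
proof (induction n)
  case (Suc n)
  then show ?case
    using comm[OF pos_lin_meas[OF pos_lin_funpow[OF assms(2)] f]] by simp
qed simp

text \<open>The binomial theorem for commuting operators, by Pascal's rule. Scaling by
  \<open>2 ^ n\<close> keeps division in \<open>ennreal\<close> out of the induction.\<close>

lemma half_sum_funpow_scaled:
  assumes A0: "pos_lin A0" and A1: "pos_lin A1" and A: "pos_lin A"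
    and comm: "\<And>f. f \<in> borel_measurable borel \<Longrightarrow> A0 (A1 f) = A1 (A0 f)"
    and half: "\<And>f x. f \<in> borel_measurable borel \<Longrightarrow> 2 * A f x = A0 f x + A1 f x"
    and f: "f \<in> borel_measurable borel"
  shows "2 ^ n * (A ^^ n) f x = (\<Sum>k\<le>n. of_nat (n choose k) * (A1 ^^ k) ((A0 ^^ (n - k)) f) x)"
proof (induction n arbitrary: x)
  case (Suc n)
  define W where "W k l = (A1 ^^ k) ((A0 ^^ l) f)" for k l
  have Wm [measurable]: "W k l \<in> borel_measurable borel" for k l
    unfolding W_def by (intro pos_lin_meas[OF pos_lin_funpow[OF A1]] pos_lin_meas[OF pos_lin_funpow[OF A0]] f)
  have W1: "A1 (W k l) = W (Suc k) l" for k l by (simp add: W_def)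
  have W0: "A0 (W k l) = W k (Suc l)" for k l
    unfolding W_def
    by (subst funpow_commute_on[OF A0 A1 comm]) (auto intro: pos_lin_meas[OF pos_lin_funpow[OF A0] f])
  have Am: "(A ^^ n) f \<in> borel_measurable borel"
    by (intro pos_lin_meas[OF pos_lin_funpow[OF A]] f)
  have IH: "(\<lambda>x. 2 ^ n * (A ^^ n) f x) = (\<lambda>x. \<Sum>k\<le>n. of_nat (n choose k) * W k (n - k) x)"
    using Suc.IH by (simp add: W_def)
  have lin: "B (\<lambda>x. \<Sum>k\<le>n. of_nat (n choose k) * W k (n - k) x) x
     = (\<Sum>k\<le>n. of_nat (n choose k) * B (W k (n - k)) x)" if "pos_lin B" for B x
    by (simp add: pos_lin_sum[OF that] pos_lin_cmult[OF that])
  have "2 ^ Suc n * (A ^^ Suc n) f x = 2 * A (\<lambda>x. 2 ^ n * (A ^^ n) f x) x"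
    by (simp add: pos_lin_cmult[OF A Am] mult.assoc)
  also have "\<dots> = A0 (\<lambda>x. 2 ^ n * (A ^^ n) f x) x + A1 (\<lambda>x. 2 ^ n * (A ^^ n) f x) x"
    by (rule half) (use Am in measurable)
  also have "\<dots> = (\<Sum>k\<le>n. of_nat (n choose k) * W k (Suc (n - k)) x)
       + (\<Sum>k\<le>n. of_nat (n choose k) * W (Suc k) (n - k) x)"
    unfolding IH lin[OF A0] lin[OF A1] W0 W1 ..
  also have "\<dots> = (\<Sum>k\<le>Suc n. of_nat (Suc n choose k) * W k (Suc n - k) x)"
  proof -
    have 1: "(\<Sum>k\<le>n. of_nat (n choose k) * W k (Suc (n - k)) x) = (\<Sum>k\<le>Suc n. of_nat (n choose k) * W k (Suc n - k) x)"
      by (simp add: Suc_diff_le)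
    also have "\<dots> = W 0 (Suc n) x + (\<Sum>k\<le>n. of_nat (n choose Suc k) * W (Suc k) (n - k) x)"
      by (subst sum.atMost_Suc_shift) simp
    finally have 1: "(\<Sum>k\<le>n. of_nat (n choose k) * W k (Suc (n - k)) x) = \<dots>" .
    have 2: "(\<Sum>k\<le>Suc n. of_nat (Suc n choose k) * W k (Suc n - k) x) =
       W 0 (Suc n) x + (\<Sum>k\<le>n. of_nat (Suc n choose Suc k) * W (Suc k) (n - k) x)"
      by (subst sum.atMost_Suc_shift) simp
    show ?thesis unfolding 1 2 by (simp add: algebra_simps sum.distrib)
  qed
  finally show ?case by (simp add: W_def)
qed simp

lemma half_sum_funpow:
  assumes "pos_lin A0" "pos_lin A1" "pos_lin A"
    and "\<And>f. f \<in> borel_measurable borel \<Longrightarrow> A0 (A1 f) = A1 (A0 f)"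
    and "\<And>f x. f \<in> borel_measurable borel \<Longrightarrow> 2 * A f x = A0 f x + A1 f x"
    and "f \<in> borel_measurable borel"
  shows "(A ^^ n) f x = (\<Sum>k\<le>n. ennreal (real (n choose k) / 2 ^ n) * (A1 ^^ k) ((A0 ^^ (n - k)) f) x)"
proof -
  have "ennreal (1 / 2 ^ n) * 2 ^ n = ennreal (1 / 2 ^ n * 2 ^ n)"
    by (subst ennreal_mult) (auto simp: ennreal_power[symmetric])
  hence one: "ennreal (1 / 2 ^ n) * 2 ^ n = 1" by simp
  have "(A ^^ n) f x = ennreal (1 / 2 ^ n) * (2 ^ n * (A ^^ n) f x)"
    by (simp add: mult.assoc[symmetric] one)
  also have "\<dots> = (\<Sum>k\<le>n. ennreal (1 / 2 ^ n) * of_nat (n choose k) * (A1 ^^ k) ((A0 ^^ (n - k)) f) x)"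
    by (simp only: half_sum_funpow_scaled[OF assms] sum_distrib_left mult.assoc)
  also have "\<dots> = (\<Sum>k\<le>n. ennreal (real (n choose k) / 2 ^ n) * (A1 ^^ k) ((A0 ^^ (n - k)) f) x)"
    by (simp add: ennreal_of_nat_eq_real_of_nat flip: ennreal_mult)
  finally show ?thesis .
qed

section \<open>Binomial coefficients near the centre\<close>

lemma central_binomial_Suc:
  "real (Suc m) * real ((2 * Suc m) choose Suc m) = 2 * (2 * real m + 1) * real ((2 * m) choose m)"
proof -
  have a: "Suc m * ((2 * Suc m) choose Suc m) = (2 * Suc m) * ((2*m+1) choose m)"
    using Suc_times_binomial_eq[of "2*m+1" m] by (simp add: mult.commute)
  have b: "Suc m * ((2*m+1) choose m) = (2*m+1) * ((2*m) choose m)"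
    using binomial_absorb_comp[of "2*m+1" m] by (simp add: mult.commute)
  show ?thesis
    using arg_cong[OF a, of real] arg_cong[OF b, of real] by (simp add: algebra_simps)
qed

text \<open>Consecutive central coefficients have ratio \<open>2 * (2 * m + 1) / (m + 1)\<close>.
  Squaring keeps everything rational, and the induction step becomes
  \<open>(2 * m + 1) * (2 * m + 3) \<le> 4 * (m + 1)^2\<close>.\<close>

lemma central_binomial_sq_upper: "real ((2 * m) choose m) ^ 2 * (2 * real m + 1) \<le> 16 ^ m"
proof (induction m)
  case (Suc m)
  note e = central_binomial_Suc[of m]
  define c where "c = real ((2 * m) choose m)"
  define d where "d = real ((2 * Suc m) choose Suc m)"
  have d: "d = 2 * (2 * real m + 1) * c / (real m + 1)"
    using e by (simp add: c_def d_def field_simps)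
  have "d\<^sup>2 * (2 * real (Suc m) + 1) = (c\<^sup>2 * (2 * real m + 1)) * (4 * (2 * real m + 1) * (2 * real m + 3) / (real m + 1)\<^sup>2)"
    unfolding d by (simp add: power2_eq_square divide_simps) (simp add: algebra_simps)
  also have "\<dots> \<le> 16 ^ m * 16"
  proof (rule mult_mono)
    show "c\<^sup>2 * (2 * real m + 1) \<le> 16 ^ m" using Suc by (simp add: c_def)
    show "4 * (2 * real m + 1) * (2 * real m + 3) / (real m + 1)\<^sup>2 \<le> 16"
      by (simp add: divide_simps) (simp add: algebra_simps power2_eq_square)
  qed auto
  finally show ?case by (simp add: d_def)
qed simp

text \<open>The same recursion, now with \<open>4 * m * (m + 1) \<le> (2 * m + 1)^2\<close>. The
  factor \<open>4 * m\<close> makes \<open>m = 1\<close> a case of equality.\<close>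

lemma central_binomial_sq_lower: "m \<ge> 1 \<Longrightarrow> 16 ^ m \<le> real ((2 * m) choose m) ^ 2 * (4 * real m)"
proof (induction m rule: dec_induct)
  case base
  then show ?case by simp
next
  case (step m)
  note e = central_binomial_Suc[of m]
  define c where "c = real ((2 * m) choose m)"
  define d where "d = real ((2 * Suc m) choose Suc m)"
  have d: "d = 2 * (2 * real m + 1) * c / (real m + 1)"
    using e by (simp add: c_def d_def field_simps)
  have "16 ^ m * 16 \<le> (c\<^sup>2 * (4 * real m)) * (4 * (2 * real m + 1)\<^sup>2 / (real m * (real m + 1)))"
  proof (rule mult_mono)
    show "16 ^ m \<le> c\<^sup>2 * (4 * real m)" using step by (simp add: c_def)
    show "16 \<le> 4 * (2 * real m + 1)\<^sup>2 / (real m * (real m + 1))"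
      using step by (simp add: divide_simps) (simp add: algebra_simps power2_eq_square)
  qed auto
  also have "\<dots> = d\<^sup>2 * (4 * real (Suc m))" unfolding d using step(1)
    by (simp add: power2_eq_square divide_simps) (simp add: algebra_simps)
  finally show ?case by (simp add: d_def)
qed

text \<open>The middle coefficient is the largest. Odd \<open>n\<close> costs nothing: the
  coefficient at most doubles compared with \<open>2 * m\<close>, and so does
  \<open>2 ^ n\<close>.\<close>

lemma binomial_upper:
  assumes "n \<ge> 1"
  shows "real (n choose k) / 2 ^ n \<le> 1 / sqrt n"
proof -
  define m where "m = n div 2"
  have n: "n = 2 * m \<or> n = 2 * m + 1" unfolding m_def by presburger
  have le: "real (n choose k) \<le> real (n choose m)"
    using binomial_maximum[of n k] by (simp add: m_def)
  have c: "real ((2*m) choose m) / 4 ^ m \<le> 1 / sqrt n"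
  proof (rule power2_le_imp_le)
    have "(real ((2*m) choose m) / 4 ^ m)\<^sup>2 = real ((2*m) choose m) ^ 2 / 16 ^ m"
      by (simp add: power_divide power_mult[symmetric] mult.commute[of m] power_mult)
    also have "\<dots> \<le> 1 / (2 * real m + 1)"
      using central_binomial_sq_upper[of m] by (simp add: field_simps)
    also have "\<dots> \<le> 1 / real n" using n assms by (intro divide_left_mono) auto
    finally show "(real ((2*m) choose m) / 4 ^ m)\<^sup>2 \<le> (1 / sqrt n)\<^sup>2" by (simp add: power_divide)
  qed auto
  have "real (n choose m) / 2 ^ n \<le> real ((2*m) choose m) / 4 ^ m"
  proof (cases "n = 2 * m")
    case True
    then show ?thesis by (simp add: power_mult)
  next
    case False
    with n have n': "n = 2 * m + 1" by simp
    have "n choose m \<le> 2 * ((2*m) choose m)"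
      using binomial_maximum[of "2*m" "m-1"] n' by (cases m) auto
    hence "real (n choose m) \<le> real (2 * ((2*m) choose m))" by (rule of_nat_mono)
    thus ?thesis by (simp add: n' power_mult divide_simps)
  qed
  thus ?thesis using le c by (smt (verit) divide_right_mono zero_le_power)
qed

text \<open>Moving one place outwards multiplies the coefficient by
  \<open>(m - j) / (m + j + 1)\<close>, which is at least \<open>((m - j - 1) / m)^2\<close> because
  \<open>(m - j - 1) * (m + j + 1) \<le> m^2\<close>. Replacing the earlier factors by the current,
  smaller one gives the exponent \<open>2 * j\<close>.\<close>

lemma binomial_offcentre_lower:
  assumes "j \<le> m"
  shows "real ((2*m) choose m) * ((real m - j) / m) ^ (2 * j) \<le> real ((2*m) choose (m+j))"
  using assms
proof (induction j)
  case (Suc j)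
  have pos: "m > 0" using Suc.prems by simp
  have e: "real ((2*m) choose (m + Suc j)) = real ((2*m) choose (m+j)) * ((real m - j) / (real m + j + 1))"
  proof -
    have "Suc (m+j) * ((2*m) choose Suc (m+j)) = (2*m - (m+j)) * ((2*m) choose (m+j))"
      by (simp only: binomial_absorption binomial_absorb_comp)
    hence "real (Suc (m+j)) * real ((2*m) choose Suc (m+j)) = real (2*m - (m+j)) * real ((2*m) choose (m+j))"
      by (metis of_nat_mult)
    moreover have "real (2*m - (m+j)) = real m - j" using Suc.prems by (simp add: of_nat_diff)
    ultimately show ?thesis by (simp add: eq_divide_eq) (simp add: algebra_simps)
  qed
  have a: "((real m - Suc j) / m)\<^sup>2 \<le> (real m - j) / (real m + j + 1)"
  proof -
    have "(real m - Suc j)\<^sup>2 * (real m + j + 1) \<le> (real m - j) * m\<^sup>2"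
    proof -
      have 1: "(real m - Suc j) * (real m + j + 1) \<le> (real m)\<^sup>2"
        by (simp add: algebra_simps power2_eq_square)
      have "(real m - Suc j)\<^sup>2 * (real m + j + 1) = (real m - Suc j) * ((real m - Suc j) * (real m + j + 1))"
        by (simp add: power2_eq_square)
      also have "\<dots> \<le> (real m - j) * (real m)\<^sup>2"
        using Suc.prems 1 by (intro mult_mono) auto
      finally show ?thesis by simp
    qed
    thus ?thesis using pos by (simp add: power_divide divide_simps add_pos_nonneg algebra_simps)
  qed
  have "((real m - Suc j) / m) ^ (2 * Suc j) = ((real m - Suc j) / m) ^ (2 * j) * ((real m - Suc j) / m)\<^sup>2"
    by (simp add: power_add[symmetric])
  also have "\<dots> \<le> ((real m - j) / m) ^ (2 * j) * ((real m - j) / (real m + j + 1))"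
    using a Suc.prems by (intro mult_mono power_mono divide_right_mono) auto
  finally have "real ((2*m) choose m) * ((real m - Suc j) / m) ^ (2 * Suc j)
      \<le> real ((2*m) choose m) * (((real m - j) / m) ^ (2 * j) * ((real m - j) / (real m + j + 1)))"
    by (intro mult_left_mono) auto
  also have "\<dots> \<le> real ((2*m) choose (m+j)) * ((real m - j) / (real m + j + 1))"
    unfolding mult.assoc[symmetric] using Suc by (intro mult_right_mono) auto
  finally show ?case unfolding e .
qed simp

text \<open>A Gaussian lower bound: at distance \<open>j \<le> R * sqrt n\<close> from the centre
  the loss \<open>(1 - j / m) ^ (2 * j)\<close> is at least \<open>exp (- 4 * j^2 / m)\<close>,
  hence at least a constant depending only on \<open>R\<close>.\<close>

lemma binomial_lower:
  assumes R: "R \<ge> 1"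
  shows "\<exists>c>0. \<exists>n0. \<forall>n\<ge>n0. \<forall>k. \<bar>real k - real (n div 2)\<bar> \<le> R * sqrt n \<longrightarrow> c / sqrt n \<le> real (n choose k) / 2 ^ n"
proof -
  define c where "c = exp (- (16 * R\<^sup>2)) / 4"
  \<comment> \<open>Beyond \<open>64 * R^2\<close> the offset \<open>j\<close> is at most
    \<open>m / 2\<close>, the range in which \<open>1 - x \<ge> exp (- 2 * x)\<close> is
    applied.\<close>
  define n0 where "n0 = nat \<lceil>64 * R\<^sup>2\<rceil> + 2"
  have "c / sqrt n \<le> real (n choose k) / 2 ^ n"
    if n: "n \<ge> n0" and k: "\<bar>real k - real (n div 2)\<bar> \<le> R * sqrt n" for n k
  proof -
    define m where "m = n div 2"
    have nm: "n = 2 * m \<or> n = 2 * m + 1" unfolding m_def by presburger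
    have n64: "real n \<ge> 64 * R\<^sup>2 + 2" using n unfolding n0_def by linarith
    have n2: "n \<ge> 2" using n unfolding n0_def by linarith
    have m1: "m \<ge> 1" using n2 nm by linarith
    have mn: "4 * real m \<ge> real n" "2 * real m \<le> n" using nm m1 by auto
    define j where "j = (if k \<ge> m then k - m else m - k)"
    have jk: "real j = \<bar>real k - real m\<bar>" unfolding j_def by auto
    have jr: "real j \<le> R * sqrt n" using k jk m_def by simp
    have sq: "R * sqrt n \<le> real n / 8"
    proof (rule power2_le_imp_le)
      have "64 * R\<^sup>2 * real n \<le> real n * real n" using n64 by (intro mult_right_mono) auto
      thus "(R * sqrt (real n))\<^sup>2 \<le> (real n / 8)\<^sup>2"
        by (simp add: power_mult_distrib power_divide) (simp add: power2_eq_square)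
    qed auto
    have j2: "2 * real j \<le> m" using jr sq mn by linarith
    hence jm: "j \<le> m" by linarith
    have "((2*m) choose k) = ((2*m) choose (m+j))"
    proof (cases "k \<ge> m")
      case False
      hence "k = 2 * m - (m + j)" "m + j \<le> 2 * m" unfolding j_def by auto
      thus ?thesis using binomial_symmetric by metis
    qed (simp add: j_def)
    have u: "exp (- 2 * (real j / m)) \<le> 1 - real j / m"
    proof -
      have "0 \<le> real j / m" "real j / m \<le> 1/2" using j2 m1 by (auto simp: field_simps)
      moreover from this have "2 * (real j / m)\<^sup>2 \<le> real j / m"
        using mult_right_mono[of "real j / m" "1/2" "real j / m"] by (simp add: power2_eq_square)
      ultimately have "- 2 * (real j / m) \<le> ln (1 - real j / m)"
        using ln_one_minus_pos_lower_bound[of "real j / m"] by linarith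
      moreover have "0 < 1 - real j / m" using \<open>real j / m \<le> 1/2\<close> by linarith
      ultimately show ?thesis using ln_ge_iff by blast
    qed
    have "exp (- (16 * R\<^sup>2)) \<le> exp (- 2 * (real j / m)) ^ (2 * j)"
    proof -
      have "4 * (real j)\<^sup>2 \<le> 4 * (R * sqrt n)\<^sup>2" using jr by (intro mult_left_mono power_mono) auto
      also have "\<dots> = 4 * R\<^sup>2 * n" by (simp add: power_mult_distrib)
      also have "\<dots> \<le> 4 * R\<^sup>2 * (4 * m)" using mn by (intro mult_left_mono) auto
      finally have "4 * (real j)\<^sup>2 / m \<le> 16 * R\<^sup>2" using m1 by (simp add: field_simps)
      thus ?thesis by (simp add: exp_of_nat_mult[symmetric] power2_eq_square)
    qed
    also have "\<dots> \<le> (1 - real j / m) ^ (2 * j)" using u by (intro power_mono) auto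
    also have "1 - real j / m = (real m - j) / m" using m1 by (simp add: field_simps)
    finally have e: "exp (- (16 * R\<^sup>2)) \<le> ((real m - j) / m) ^ (2 * j)" .
    have cb: "4 ^ m / (2 * sqrt m) \<le> real ((2*m) choose m)"
    proof (rule power2_le_imp_le)
      have "(4 ^ m / (2 * sqrt m))\<^sup>2 = 16 ^ m / (4 * m)"
        by (simp add: power_divide power_mult_distrib power_mult[symmetric] mult.commute[of m] power_mult)
      also have "\<dots> \<le> real ((2*m) choose m) ^ 2"
        using central_binomial_sq_lower[OF m1] m1 by (simp add: field_simps)
      finally show "(4 ^ m / (2 * sqrt m))\<^sup>2 \<le> real ((2*m) choose m) ^ 2" .
    qed auto
    have "2 * c * 4 ^ m / sqrt n \<le> exp (- (16 * R\<^sup>2)) * (4 ^ m / (2 * sqrt m))"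
    proof -
      have "1 / sqrt n \<le> 1 / sqrt m" using mn m1 by (intro divide_left_mono) auto
      hence "exp (- (16 * R\<^sup>2)) * 4 ^ m / 2 * (1 / sqrt n) \<le> exp (- (16 * R\<^sup>2)) * 4 ^ m / 2 * (1 / sqrt m)"
        by (intro mult_left_mono) auto
      thus ?thesis by (simp add: c_def)
    qed
    also have "\<dots> \<le> ((real m - j) / m) ^ (2 * j) * real ((2*m) choose m)"
      using e cb by (intro mult_mono) auto
    also have "\<dots> \<le> real ((2*m) choose k)"
      using binomial_offcentre_lower[OF jm] \<open>((2*m) choose k) = _\<close> by (simp add: mult.commute)
    finally have 1: "2 * c * 4 ^ m / sqrt n \<le> real ((2*m) choose k)" .
    show ?thesis
    proof (cases "n = 2 * m")
      case True
      have "c * 4 ^ m / sqrt n \<le> 2 * c * 4 ^ m / sqrt n"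
        unfolding c_def by (intro divide_right_mono) auto
      with 1 have "c * 4 ^ m / sqrt n \<le> real (n choose k)" using True by simp
      moreover have "(2::real) ^ n = 4 ^ m" by (simp add: True power_mult)
      ultimately show ?thesis by (simp add: field_simps)
    next
      case False
      with nm have n': "n = Suc (2 * m)" by simp
      have "((2*m) choose k) \<le> (n choose k)" unfolding n' by (cases k) auto
      hence "2 * c * 4 ^ m / sqrt n \<le> real (n choose k)" using 1 by (meson of_nat_mono order_trans)
      moreover have "(2::real) ^ n = 2 * 4 ^ m" by (simp add: n' power_mult)
      ultimately show ?thesis by (simp add: field_simps)
    qed
  qed
  moreover have "c > 0" by (simp add: c_def)
  ultimately show ?thesis by blast
qed

section \<open>Local estimates from a monotone coupling\<close>

text \<open>Turning one \<open>A0\<close>-step into an \<open>A1\<close>-step raises the expectation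
  of \<open>G\<close> by at least that of \<open>h\<close> over the other \<open>n\<close> steps,
  and the gains telescope. \<open>G\<close> sees \<open>n + 1\<close> steps and \<open>h\<close>
  only \<open>n\<close>, since the changed step is not applied to \<open>h\<close>.\<close>

lemma telescope_lower:
  assumes A0: "pos_lin A0" and A1: "pos_lin A1"
    and comm: "\<And>f. f \<in> borel_measurable borel \<Longrightarrow> A0 (A1 f) = A1 (A0 f)"
    and [measurable]: "h \<in> borel_measurable borel" "G \<in> borel_measurable borel"
    and step: "\<And>x. h x + A0 G x \<le> A1 G x"
  shows "b \<le> Suc n \<Longrightarrow> (\<Sum>k<b. (A1 ^^ k) ((A0 ^^ (n - k)) h) x) + (A0 ^^ Suc n) G x \<le> (A1 ^^ b) ((A0 ^^ (Suc n - b)) G) x"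
proof (induction b)
  case (Suc b)
  note P0 = pos_lin_funpow[OF A0] and P1 = pos_lin_funpow[OF A1]
  note [measurable] = pos_lin_meas[OF A0] pos_lin_meas[OF A1] pos_lin_meas[OF P0] pos_lin_meas[OF P1]
  define B where "B = (\<lambda>f. (A1 ^^ b) ((A0 ^^ (n - b)) f))"
  have B: "pos_lin B" unfolding B_def by (rule pos_lin_comp[OF P1 P0])
  have b: "Suc n - b = Suc (n - b)" using Suc.prems by simp
  have 1: "B (A0 G) = (A1 ^^ b) ((A0 ^^ (Suc n - b)) G)"
    unfolding B_def b by (simp add: funpow_swap1)
  have "(A0 ^^ (n - b)) (A1 G) = A1 ((A0 ^^ (n - b)) G)"
    by (rule funpow_commute_on[OF A1 A0, symmetric]) (simp_all add: comm)
  hence 2: "B (A1 G) = (A1 ^^ Suc b) ((A0 ^^ (n - b)) G)"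
    unfolding B_def by (simp add: funpow_swap1)
  have "B h x + B (A0 G) x \<le> B (A1 G) x"
    using pos_lin_mono[OF B, of "\<lambda>x. h x + A0 G x" "A1 G" x] step pos_lin_add[OF B, of h "A0 G"] by simp
  hence "B h x + (A1 ^^ b) ((A0 ^^ (Suc n - b)) G) x \<le> (A1 ^^ Suc b) ((A0 ^^ (n - b)) G) x"
    by (simp only: 1 2)
  moreover have "B h x + ((\<Sum>k<b. (A1 ^^ k) ((A0 ^^ (n - k)) h) x) + (A0 ^^ Suc n) G x)
     \<le> B h x + (A1 ^^ b) ((A0 ^^ (Suc n - b)) G) x"
    using Suc.IH Suc.prems by (intro add_left_mono) simp
  ultimately have "B h x + ((\<Sum>k<b. (A1 ^^ k) ((A0 ^^ (n - k)) h) x) + (A0 ^^ Suc n) G x)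
     \<le> (A1 ^^ Suc b) ((A0 ^^ (n - b)) G) x"
    by (rule order_trans[rotated])
  thus ?case by (simp add: B_def add_ac)
qed simp

text \<open>Here \<open>h\<close> is evaluated after the changed step, which is already of type
  \<open>A1\<close>. So all expectations are over \<open>n\<close> steps, and \<open>k\<close>
  starts at \<open>a + 1\<close>.\<close>

lemma telescope_upper:
  assumes A0: "pos_lin A0" and A1: "pos_lin A1"
    and comm: "\<And>f. f \<in> borel_measurable borel \<Longrightarrow> A0 (A1 f) = A1 (A0 f)"
    and [measurable]: "h \<in> borel_measurable borel" "g \<in> borel_measurable borel"
    and step: "\<And>x. A1 g x \<le> A1 h x + A0 g x"
  shows "a \<le> b \<Longrightarrow> b \<le> n \<Longrightarrow> (A1 ^^ b) ((A0 ^^ (n - b)) g) x \<le>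
     (\<Sum>k\<in>{a<..b}. (A1 ^^ k) ((A0 ^^ (n - k)) h) x) + (A1 ^^ a) ((A0 ^^ (n - a)) g) x"
proof (induction b rule: dec_induct)
  case (step b)
  note P0 = pos_lin_funpow[OF A0] and P1 = pos_lin_funpow[OF A1]
  note [measurable] = pos_lin_meas[OF A0] pos_lin_meas[OF A1] pos_lin_meas[OF P0] pos_lin_meas[OF P1]
  define B where "B = (\<lambda>f. (A1 ^^ b) ((A0 ^^ (n - Suc b)) f))"
  have B: "pos_lin B" unfolding B_def by (rule pos_lin_comp[OF P1 P0])
  have b: "n - b = Suc (n - Suc b)" using step.prems by simp
  have 1: "B (A0 g) = (A1 ^^ b) ((A0 ^^ (n - b)) g)"
    unfolding B_def b by (simp add: funpow_swap1)
  have 2: "B (A1 f) = (A1 ^^ Suc b) ((A0 ^^ (n - Suc b)) f)" if [measurable]: "f \<in> borel_measurable borel" for f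
  proof -
    have "(A0 ^^ (n - Suc b)) (A1 f) = A1 ((A0 ^^ (n - Suc b)) f)"
      by (rule funpow_commute_on[OF A1 A0, symmetric]) (simp_all add: comm)
    thus ?thesis unfolding B_def by (simp add: funpow_swap1)
  qed
  have "B (A1 g) x \<le> B (\<lambda>x. A1 h x + A0 g x) x"
    by (rule pos_lin_mono[OF B]) (use assms(6) in auto)
  also have "\<dots> = B (A1 h) x + B (A0 g) x" by (subst pos_lin_add[OF B]) auto
  finally have "(A1 ^^ Suc b) ((A0 ^^ (n - Suc b)) g) x
     \<le> (A1 ^^ Suc b) ((A0 ^^ (n - Suc b)) h) x + (A1 ^^ b) ((A0 ^^ (n - b)) g) x"
    by (simp only: 1 2 assms)
  also have "\<dots> \<le> (A1 ^^ Suc b) ((A0 ^^ (n - Suc b)) h) x +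
      ((\<Sum>k\<in>{a<..b}. (A1 ^^ k) ((A0 ^^ (n - k)) h) x) + (A1 ^^ a) ((A0 ^^ (n - a)) g) x)"
    using step.IH step.prems by (intro add_left_mono) auto
  also have "\<dots> = (\<Sum>k\<in>{a<..Suc b}. (A1 ^^ k) ((A0 ^^ (n - k)) h) x) + (A1 ^^ a) ((A0 ^^ (n - a)) g) x"
  proof -
    have "{a<..Suc b} = insert (Suc b) {a<..b}" using step.hyps by auto
    thus ?thesis by (simp add: add_ac)
  qed
  finally show ?case .
qed simp

text \<open>The step law of a random walk is written as a fair mixture of the laws of two ordered
  variables \<open>Y0 \<le> Y1\<close> with a bounded gap. The \<open>n\<close>-step law is then a binomial mixture over the
  number of \<open>Y1\<close>-steps, and changing one step from \<open>Y0\<close> to \<open>Y1\<close> moves the walk by at most \<open>D\<close>.\<close>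

locale coupled = prob_space Q for Q :: "'b measure" +
  fixes Y0 Y1 :: "'b \<Rightarrow> real" and D V \<delta> :: real and A :: "(real \<Rightarrow> ennreal) \<Rightarrow> real \<Rightarrow> ennreal"
  assumes Y0_meas [measurable]: "Y0 \<in> borel_measurable Q" and Y1_meas [measurable]: "Y1 \<in> borel_measurable Q"
    and Y_AE: "AE \<omega> in Q. 0 \<le> Y0 \<omega> \<and> Y0 \<omega> \<le> Y1 \<omega> \<and> (Y0 \<omega> < Y1 \<omega> \<longrightarrow> Y1 \<omega> \<le> D)"
    and D: "D \<ge> 0"
    and int0: "integrable Q (\<lambda>\<omega>. (Y0 \<omega>)\<^sup>2)" and int1: "integrable Q (\<lambda>\<omega>. (Y1 \<omega>)\<^sup>2)"
    and V0: "(\<integral>\<omega>. (Y0 \<omega>)\<^sup>2 \<partial>Q) \<le> V" and V1: "(\<integral>\<omega>. (Y1 \<omega>)\<^sup>2 \<partial>Q) \<le> V"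
    and \<delta>: "\<delta> > 0" "\<delta> \<le> (\<integral>\<omega>. Y1 \<omega> \<partial>Q) - (\<integral>\<omega>. Y0 \<omega> \<partial>Q)"
    and A: "pos_lin A"
    and half: "\<And>f x. f \<in> borel_measurable borel \<Longrightarrow> 2 * A f x = shift_op Q Y0 f x + shift_op Q Y1 f x"
begin

abbreviation "A0 \<equiv> shift_op Q Y0"
abbreviation "A1 \<equiv> shift_op Q Y1"

lemma A0: "pos_lin A0" and A1: "pos_lin A1"
  by (auto intro!: pos_lin_shift_op prob_space_axioms)

lemma comm: "f \<in> borel_measurable borel \<Longrightarrow> A0 (A1 f) = A1 (A0 f)"
  by (intro shift_op_commute prob_space_axioms) auto

lemma binom:
  assumes "f \<in> borel_measurable borel"
  shows "(A ^^ n) f x = (\<Sum>k\<le>n. ennreal (real (n choose k) / 2 ^ n) * (A1 ^^ k) ((A0 ^^ (n - k)) f) x)"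
  by (intro half_sum_funpow A0 A1 A comm half assms)

lemma W_pos: "pos_lin (\<lambda>f. (A1 ^^ k) ((A0 ^^ l) f))"
  by (rule pos_lin_comp[OF pos_lin_funpow[OF A1] pos_lin_funpow[OF A0]])

lemma int_Y: "integrable Q Y0" "integrable Q Y1"
  by (rule square_integrable_imp_integrable[OF Y0_meas int0], rule square_integrable_imp_integrable[OF Y1_meas int1])

text \<open>\<open>G\<close> is at most \<open>1 / s\<close>, so the gains from switching all steps
  sum to at most \<open>1 / s\<close>, while each gain is at least \<open>\<kappa>\<close> times an
  expectation of \<open>h\<close>. The sum over \<open>k\<close> is therefore bounded independently
  of \<open>n\<close>, and the binomial weights supply the factor \<open>1 / sqrt n\<close>.\<close>

lemma upper_bound:
  assumes s: "s > 0" and n: "n \<ge> 1"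
  shows "(A ^^ n) (\<lambda>y. ennreal (indicator {t<..} y * exp (- s * (y - t)))) 0
     \<le> ennreal (exp (s * D) / \<delta> / (s * sqrt n))"
proof -
  define h where "h = (\<lambda>y. ennreal (indicator {t<..} y * exp (- s * (y - t))))"
  \<comment> \<open>\<open>G\<close> is the antiderivative of \<open>h\<close> that vanishes up to
    \<open>t\<close>.\<close>
  define G where "G = (\<lambda>y. ennreal (if y \<le> t then 0 else (1 - exp (- s * (y - t))) / s))"
  have hm [measurable]: "h \<in> borel_measurable borel" unfolding h_def by measurable
  have [measurable]: "G \<in> borel_measurable borel" unfolding G_def by measurable
  have Gmono: "G x \<le> G y" if "x \<le> y" for x y
    using s that unfolding G_def by (auto intro!: ennreal_leI divide_right_mono)
  \<comment> \<open>\<open>\<delta>\<close> bounds the mean gap from below, and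
    \<open>exp (- s * D)\<close> is the most that \<open>h\<close> can lose between \<open>x\<close>
    and the far end of a gap, as \<open>Y1 \<le> D\<close> whenever the gap is positive.\<close>
  define \<kappa> where "\<kappa> = \<delta> * exp (- s * D)"
  have \<kappa>: "\<kappa> > 0" using \<delta> by (simp add: \<kappa>_def)
  have step: "ennreal \<kappa> * h x + A0 G x \<le> A1 G x" for x
  proof (cases "x \<le> t")
    case True
    thus ?thesis using Y_AE unfolding shift_op_def h_def
      by (auto intro!: nn_integral_mono_AE Gmono)
  next
    case False
    have "ennreal (exp (- s * D) * exp (- s * (x - t))) * ennreal \<delta> + A0 G x
       \<le> ennreal (exp (- s * D) * exp (- s * (x - t))) * (\<integral>\<^sup>+\<omega>. ennreal (Y1 \<omega> - Y0 \<omega>) \<partial>Q) + A0 G x"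
    proof (intro add_right_mono mult_left_mono)
      have "(\<integral>\<^sup>+\<omega>. ennreal (Y1 \<omega> - Y0 \<omega>) \<partial>Q) = ennreal (\<integral>\<omega>. Y1 \<omega> - Y0 \<omega> \<partial>Q)"
        using Y_AE by (intro nn_integral_eq_integral) (auto intro: int_Y)
      thus "ennreal \<delta> \<le> (\<integral>\<^sup>+\<omega>. ennreal (Y1 \<omega> - Y0 \<omega>) \<partial>Q)"
        using \<delta> int_Y by (auto intro!: ennreal_leI)
    qed simp
    also have "\<dots> = (\<integral>\<^sup>+\<omega>. ennreal (exp (- s * D) * exp (- s * (x - t))) * ennreal (Y1 \<omega> - Y0 \<omega>) + G (x + Y0 \<omega>) \<partial>Q)"
      by (simp add: shift_op_def nn_integral_add nn_integral_cmult)
    also have "\<dots> \<le> A1 G x" unfolding shift_op_def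
      using Y_AE
    proof (intro nn_integral_mono_AE, eventually_elim)
      case (elim \<omega>)
      define u v where "u = x + Y0 \<omega> - t" and "v = x + Y1 \<omega> - t"
      have uv: "0 < u" "u \<le> v" "v - u = Y1 \<omega> - Y0 \<omega>" using elim False unfolding u_def v_def by auto
      show ?case
      proof (cases "Y0 \<omega> < Y1 \<omega>")
        case True
        hence "Y1 \<omega> \<le> D" using elim by auto
        have "exp (- s * D) * exp (- s * (x - t)) \<le> exp (- s * v)"
          using mult_left_mono[OF \<open>Y1 \<omega> \<le> D\<close>, of s] s
          by (simp add: v_def algebra_simps flip: exp_add)
        hence "exp (- s * D) * exp (- s * (x - t)) * (v - u) \<le> exp (- s * v) * (v - u)"
          using uv by (intro mult_right_mono) auto
        also have "\<dots> \<le> (exp (- s * u) - exp (- s * v)) / s"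
        proof -
          have "exp (- s * v) * (1 + s * (v - u)) \<le> exp (- s * v) * exp (s * (v - u))"
            by (intro mult_left_mono exp_ge_add_one_self) auto
          also have "\<dots> = exp (- s * u)" by (simp add: algebra_simps flip: exp_add)
          finally show ?thesis using s by (simp add: field_simps)
        qed
        finally have "exp (- s * D) * exp (- s * (x - t)) * (v - u) + (1 - exp (- s * u)) / s
            \<le> (1 - exp (- s * v)) / s"
          by (simp add: diff_divide_distrib)
        hence "ennreal (exp (- s * D) * exp (- s * (x - t)) * (v - u) + (1 - exp (- s * u)) / s)
            \<le> ennreal ((1 - exp (- s * v)) / s)" by (rule ennreal_leI)
        moreover have "G (x + Y0 \<omega>) = ennreal ((1 - exp (- s * u)) / s)" "G (x + Y1 \<omega>) = ennreal ((1 - exp (- s * v)) / s)"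
          using uv unfolding G_def u_def v_def by auto
        ultimately show ?thesis using uv s by (simp add: ennreal_plus ennreal_mult)
      next
        case False
        hence "Y0 \<omega> = Y1 \<omega>" using elim by auto
        thus ?thesis by simp
      qed
    qed
    finally show ?thesis using False \<delta> by (simp add: h_def \<kappa>_def ennreal_mult mult_ac)
  qed
  have tel: "(\<Sum>k<Suc n. (A1 ^^ k) ((A0 ^^ (n - k)) (\<lambda>x. ennreal \<kappa> * h x)) 0) \<le> ennreal (1 / s)"
  proof -
    have "(\<Sum>k<Suc n. (A1 ^^ k) ((A0 ^^ (n - k)) (\<lambda>x. ennreal \<kappa> * h x)) 0) \<le>
       (\<Sum>k<Suc n. (A1 ^^ k) ((A0 ^^ (n - k)) (\<lambda>x. ennreal \<kappa> * h x)) 0) + (A0 ^^ Suc n) G 0"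
      by simp
    also have "\<dots> \<le> (A1 ^^ Suc n) ((A0 ^^ (Suc n - Suc n)) G) 0"
      by (rule telescope_lower[OF A0 A1 comm _ _ step]) auto
    also have "\<dots> = (A1 ^^ Suc n) G 0" by simp
    also have "\<dots> \<le> (A1 ^^ Suc n) (\<lambda>_. ennreal (1 / s)) 0"
      by (rule pos_lin_mono[OF pos_lin_funpow[OF A1]])
         (use s in \<open>auto simp: G_def intro!: ennreal_leI divide_right_mono\<close>)
    also have "\<dots> = ennreal (1 / s)" by (simp add: pos_lin_const[OF pos_lin_funpow[OF A1]] del: funpow.simps)
    finally show ?thesis .
  qed
  have "ennreal \<kappa> * (A ^^ n) h 0 = (\<Sum>k\<le>n. ennreal (real (n choose k) / 2 ^ n) * (ennreal \<kappa> * (A1 ^^ k) ((A0 ^^ (n - k)) h) 0))"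
    unfolding binom[OF hm] by (simp add: sum_distrib_left mult_ac)
  also have "\<dots> \<le> (\<Sum>k\<le>n. ennreal (1 / sqrt n) * (ennreal \<kappa> * (A1 ^^ k) ((A0 ^^ (n - k)) h) 0))"
    by (intro sum_mono mult_right_mono ennreal_leI binomial_upper n) auto
  also have "\<dots> = ennreal (1 / sqrt n) * (\<Sum>k<Suc n. (A1 ^^ k) ((A0 ^^ (n - k)) (\<lambda>x. ennreal \<kappa> * h x)) 0)"
    by (simp only: pos_lin_cmult[OF W_pos hm] sum_distrib_left lessThan_Suc_atMost)
  also have "\<dots> \<le> ennreal (1 / sqrt n) * ennreal (1 / s)"
    by (intro mult_left_mono tel) auto
  finally have "ennreal (1/\<kappa>) * (ennreal \<kappa> * (A ^^ n) h 0) \<le> ennreal (1/\<kappa>) * (ennreal (1 / sqrt n) * ennreal (1 / s))"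
    by (intro mult_left_mono) auto
  moreover have "ennreal (1/\<kappa>) * (ennreal \<kappa> * (A ^^ n) h 0) = (A ^^ n) h 0"
    using \<kappa> by (simp add: mult.assoc[symmetric] flip: ennreal_mult)
  moreover have "ennreal (1/\<kappa>) * (ennreal (1 / sqrt n) * ennreal (1 / s)) = ennreal (1/\<kappa> * (1 / sqrt n * (1 / s)))"
    using \<kappa> s by (simp flip: ennreal_mult)
  moreover have "1/\<kappa> * (1 / sqrt n * (1 / s)) = exp (s * D) / \<delta> / (s * sqrt n)"
    by (simp add: \<kappa>_def exp_minus field_simps)
  ultimately show ?thesis by (simp add: h_def)
qed

definition "M0 = (\<integral>\<omega>. Y0 \<omega> \<partial>Q)"
definition "M1 = (\<integral>\<omega>. Y1 \<omega> \<partial>Q)"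

text \<open>\<open>V\<close> bounds the raw second moment rather than the variance: adding the
  nonnegative \<open>m^2\<close> completes the square, and the errors of successive steps simply add
  up.\<close>

lemma shift_op_square:
  assumes [measurable]: "Y \<in> borel_measurable Q" and "integrable Q (\<lambda>\<omega>. (Y \<omega>)\<^sup>2)"
    and m: "m = (\<integral>\<omega>. Y \<omega> \<partial>Q)" and v: "(\<integral>\<omega>. (Y \<omega>)\<^sup>2 \<partial>Q) \<le> V" and w: "w \<ge> 0"
  shows "shift_op Q Y (\<lambda>y. ennreal ((y - c)\<^sup>2 + w)) x \<le> ennreal ((x + m - c)\<^sup>2 + (w + V))"
proof -
  have int: "integrable Q Y" by (rule square_integrable_imp_integrable[OF assms(1,2)])
  have e: "(x + Y \<omega> - c)\<^sup>2 + w = (Y \<omega>)\<^sup>2 + 2 * (x - c) * Y \<omega> + ((x - c)\<^sup>2 + w)" for \<omega>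
    by (simp add: power2_eq_square algebra_simps)
  have "shift_op Q Y (\<lambda>y. ennreal ((y - c)\<^sup>2 + w)) x = ennreal (\<integral>\<omega>. (x + Y \<omega> - c)\<^sup>2 + w \<partial>Q)"
    unfolding shift_op_def
    by (intro nn_integral_eq_integral, simp add: e int assms) (use w in simp)
  also have "(\<integral>\<omega>. (x + Y \<omega> - c)\<^sup>2 + w \<partial>Q) = (\<integral>\<omega>. (Y \<omega>)\<^sup>2 \<partial>Q) + 2 * (x - c) * m + ((x - c)\<^sup>2 + w)"
    unfolding e by (simp add: int assms prob_space)
  also have "\<dots> \<le> V + 2 * (x - c) * m + m\<^sup>2 + ((x - c)\<^sup>2 + w)" using v zero_le_power2[of m] by linarith
  also have "\<dots> = (x + m - c)\<^sup>2 + (w + V)" by (simp add: power2_eq_square algebra_simps)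
  finally show ?thesis by (simp add: ennreal_leI)
qed

lemma V_nonneg: "V \<ge> 0" using V0 by (rule order_trans[rotated]) simp

lemma funpow_square:
  assumes [measurable]: "Y \<in> borel_measurable Q" and "integrable Q (\<lambda>\<omega>. (Y \<omega>)\<^sup>2)"
    and m: "m = (\<integral>\<omega>. Y \<omega> \<partial>Q)" and v: "(\<integral>\<omega>. (Y \<omega>)\<^sup>2 \<partial>Q) \<le> V" and w: "w \<ge> 0"
  shows "(shift_op Q Y ^^ k) (\<lambda>y. ennreal ((y - c)\<^sup>2 + w)) x \<le> ennreal ((x + k * m - c)\<^sup>2 + (w + k * V))"
proof (induction k arbitrary: x)
  case (Suc k)
  have P: "pos_lin (shift_op Q Y)" by (intro pos_lin_shift_op prob_space_axioms) auto
  note [measurable] = pos_lin_meas[OF pos_lin_funpow[OF P]]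
  have "(shift_op Q Y ^^ Suc k) (\<lambda>y. ennreal ((y - c)\<^sup>2 + w)) x
     \<le> shift_op Q Y (\<lambda>y. ennreal ((y - (c - k * m))\<^sup>2 + (w + k * V))) x"
    unfolding funpow.simps o_def
  proof (rule pos_lin_mono[OF P])
    fix y
    have "(y + k * m - c)\<^sup>2 + (w + k * V) = (y - (c - k * m))\<^sup>2 + (w + k * V)" by (simp add: algebra_simps)
    with Suc[of y] show "(shift_op Q Y ^^ k) (\<lambda>y. ennreal ((y - c)\<^sup>2 + w)) y \<le> ennreal ((y - (c - k * m))\<^sup>2 + (w + k * V))"
      by simp
  qed auto
  also have "\<dots> \<le> ennreal ((x + m - (c - k * m))\<^sup>2 + (w + k * V + V))"
    by (intro shift_op_square assms) (use w V_nonneg in auto)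
  finally show ?case by (simp add: algebra_simps)
qed simp

text \<open>The centre is the mean of a walk with \<open>k\<close> steps \<open>Y1\<close> and
  \<open>l\<close> steps \<open>Y0\<close>; this is the input for both Chebyshev bounds
  below.\<close>

lemma W_square:
  "(A1 ^^ k) ((A0 ^^ l) (\<lambda>y. ennreal ((y - (k * M1 + l * M0))\<^sup>2))) 0 \<le> ennreal ((real k + real l) * V)"
proof -
  let ?c = "k * M1 + l * M0"
  note [measurable] = pos_lin_meas[OF pos_lin_funpow[OF A0]]
  have 1: "(A0 ^^ l) (\<lambda>y. ennreal ((y - ?c)\<^sup>2)) x \<le> ennreal ((x + l * M0 - ?c)\<^sup>2 + l * V)" for x
    using funpow_square[OF Y0_meas int0 refl V0 order_refl, of l ?c x] by (simp add: M0_def)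
  have "(A1 ^^ k) ((A0 ^^ l) (\<lambda>y. ennreal ((y - ?c)\<^sup>2))) 0 \<le> (A1 ^^ k) (\<lambda>x. ennreal ((x - k * M1)\<^sup>2 + l * V)) 0"
    by (rule pos_lin_mono[OF pos_lin_funpow[OF A1]]) (auto intro!: order_trans[OF 1])
  also have "\<dots> \<le> ennreal ((0 + k * M1 - k * M1)\<^sup>2 + (l * V + k * V))"
    unfolding M1_def by (rule funpow_square[OF Y1_meas int1 refl V1]) (simp add: V_nonneg)
  finally show ?thesis by (simp add: algebra_simps)
qed

lemma W_tail_upper:
  assumes d: "d > 0" and t: "k * M1 + l * M0 + d \<le> t"
  shows "(A1 ^^ k) ((A0 ^^ l) (indicator {t<..})) 0 \<le> ennreal ((real k + real l) * V / d\<^sup>2)"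
proof -
  let ?c = "k * M1 + l * M0"
  have "(A1 ^^ k) ((A0 ^^ l) (indicator {t<..})) 0 \<le>
     (A1 ^^ k) ((A0 ^^ l) (\<lambda>y. ennreal (1 / d\<^sup>2) * ennreal ((y - ?c)\<^sup>2))) 0"
  proof (rule pos_lin_mono[OF W_pos])
    fix y
    have "d\<^sup>2 \<le> (y - ?c)\<^sup>2" if "y > t" using that t d by (intro power_mono) auto
    thus "indicator {t<..} y \<le> ennreal (1 / d\<^sup>2) * ennreal ((y - ?c)\<^sup>2)"
      using d by (auto simp: indicator_def simp flip: ennreal_mult)
  qed auto
  also have "\<dots> = ennreal (1 / d\<^sup>2) * (A1 ^^ k) ((A0 ^^ l) (\<lambda>y. ennreal ((y - ?c)\<^sup>2))) 0"
    by (subst pos_lin_cmult[OF W_pos]) auto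
  also have "\<dots> \<le> ennreal (1 / d\<^sup>2) * ennreal ((real k + real l) * V)"
    by (intro mult_left_mono W_square) auto
  also have "\<dots> = ennreal ((real k + real l) * V / d\<^sup>2)" by (simp add: V_nonneg flip: ennreal_mult)
  finally show ?thesis .
qed

text \<open>Chebyshev in additive form: 1 is split over the two events, which avoids subtraction in
  \<open>ennreal\<close>.\<close>

lemma W_tail_lower:
  assumes d: "d > 0" and t: "t \<le> k * M1 + l * M0 - d" and V: "(real k + real l) * V / d\<^sup>2 \<le> 1/4"
  shows "ennreal (3/4) \<le> (A1 ^^ k) ((A0 ^^ l) (indicator {t<..})) 0"
proof -
  let ?c = "k * M1 + l * M0"
  have "1 = (A1 ^^ k) ((A0 ^^ l) (\<lambda>_. 1)) 0"
    by (simp add: pos_lin_one[OF W_pos])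
  also have "\<dots> \<le> (A1 ^^ k) ((A0 ^^ l) (\<lambda>y. indicator {t<..} y + ennreal (1 / d\<^sup>2) * ennreal ((y - ?c)\<^sup>2))) 0"
  proof (rule pos_lin_mono[OF W_pos])
    fix y
    have "d\<^sup>2 \<le> (?c - y)\<^sup>2" if "y \<le> t" using that t d by (intro power_mono) auto
    thus "1 \<le> indicator {t<..} y + ennreal (1 / d\<^sup>2) * ennreal ((y - ?c)\<^sup>2)"
      using d by (auto simp: indicator_def power2_commute simp flip: ennreal_mult)
  qed auto
  also have "\<dots> = (A1 ^^ k) ((A0 ^^ l) (indicator {t<..})) 0 + ennreal (1 / d\<^sup>2) * (A1 ^^ k) ((A0 ^^ l) (\<lambda>y. ennreal ((y - ?c)\<^sup>2))) 0"
    by (subst pos_lin_add[OF W_pos], simp, simp, subst pos_lin_cmult[OF W_pos]) auto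
  also have "\<dots> \<le> (A1 ^^ k) ((A0 ^^ l) (indicator {t<..})) 0 + ennreal (1 / d\<^sup>2) * ennreal ((real k + real l) * V)"
    by (intro add_left_mono mult_left_mono W_square) auto
  also have "ennreal (1 / d\<^sup>2) * ennreal ((real k + real l) * V) = ennreal ((real k + real l) * V / d\<^sup>2)"
    by (simp add: V_nonneg flip: ennreal_mult)
  also have "\<dots> \<le> ennreal (1/4)" by (intro ennreal_leI V)
  finally have 1: "ennreal (3/4) + ennreal (1/4) \<le> (A1 ^^ k) ((A0 ^^ l) (indicator {t<..})) 0 + ennreal (1/4)"
    by (simp flip: ennreal_plus)
  thus ?thesis by (simp add: add.commute[of _ "ennreal (1/4)"] ennreal_add_left_cancel_le del: ennreal_plus)
qed

text \<open>\<open>t\<close> is the mean of the \<open>n\<close>-step walk. With about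
  \<open>R * sqrt n\<close> more (fewer) than \<open>n / 2\<close> steps of type \<open>Y1\<close>,
  Chebyshev puts most of the mass above (below) \<open>t\<close>. The switches in between must carry
  it across, so their probabilities of the window \<open>{t<..t+D}\<close> sum to at least 1/2, and
  all binomial weights there are of order \<open>1 / sqrt n\<close>.\<close>

lemma local_lower_bounds:
  assumes R: "R \<ge> 1" "16 * V \<le> R\<^sup>2 * \<delta>\<^sup>2"
    and c: "c > 0" and n: "real n \<ge> 64 * R\<^sup>2"
    and bin: "\<And>k. \<bar>real k - real (n div 2)\<bar> \<le> 4 * R * sqrt n \<Longrightarrow> c / sqrt n \<le> real (n choose k) / 2 ^ n"
    and t: "2 * t = n * (M0 + M1)"
  shows "ennreal (c / (2 * sqrt n)) \<le> (A ^^ n) (indicator {t<..t+D}) 0"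
    and "ennreal (c / 2) \<le> (A ^^ n) (indicator {t<..}) 0"
proof -
  define m where "m = n div 2"
  have nm: "n = 2 * m \<or> n = 2 * m + 1" unfolding m_def by presburger
  have mn: "real n \<le> 2 * real m + 1" "2 * real m \<le> real n" using nm by auto
  define r where "r = nat \<lceil>R * sqrt n\<rceil>"
  have R2: "1 \<le> R\<^sup>2" using R by simp
  have n64: "real n \<ge> 64" using n R2 by linarith
  have r: "R * sqrt n \<le> r" "r \<le> R * sqrt n + 1" 
  proof -
    have "0 \<le> R * sqrt n" using R by simp
    thus "R * sqrt n \<le> r" "r \<le> R * sqrt n + 1" unfolding r_def by linarith+
  qed
  have sq8: "8 \<le> sqrt n" using n64 by (intro real_le_rsqrt) auto
  have Rs: "8 \<le> R * sqrt n" using R sq8 mult_mono[of 1 R 8 "sqrt n"] by simp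
  have Rn: "8 * (R * sqrt n) \<le> n"
  proof -
    have "8 * R \<le> sqrt n" using n R by (intro real_le_rsqrt) (simp add: power_mult_distrib)
    hence "8 * R * sqrt n \<le> sqrt n * sqrt n" by (intro mult_right_mono) auto
    thus ?thesis by simp
  qed
  have "2 * real r \<le> m" using Rn r mn n64 by linarith
  hence rm: "2 * r \<le> m" by linarith
  have r1: "real r \<ge> 1" using r Rs by linarith
  define a b where "a = m - r" and "b = m + r"
  have ab: "a \<le> b" "b + r \<le> n" using rm nm unfolding a_def b_def by auto
  define g :: "real \<Rightarrow> ennreal" where "g = indicator {t<..}"
  define h :: "real \<Rightarrow> ennreal" where "h = indicator {t<..t+D}"
  have gm [measurable]: "g \<in> borel_measurable borel" and hm [measurable]: "h \<in> borel_measurable borel"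
    unfolding g_def h_def by auto
  define W where "W f k = (A1 ^^ k) ((A0 ^^ (n - k)) f) 0" for f k
  have \<Delta>: "\<delta> \<le> M1 - M0" using \<delta> by (simp add: M0_def M1_def)
  \<comment> \<open>The condition \<open>16 * V \<le> R^2 * \<delta>^2\<close> is made for this
    Chebyshev bound at distance \<open>r * \<delta> / 2\<close>.\<close>
  have rV: "real n * V / (real r * \<delta> / 2)\<^sup>2 \<le> 1/4"
  proof -
    have "16 * V * n \<le> (R * sqrt n)\<^sup>2 * \<delta>\<^sup>2"
      using mult_right_mono[OF R(2), of n] by (simp add: power_mult_distrib mult_ac)
    also have "\<dots> \<le> (real r)\<^sup>2 * \<delta>\<^sup>2" using r R by (intro mult_right_mono power_mono) auto
    finally show ?thesis using r1 \<delta> by (simp add: power_mult_distrib power_divide field_simps)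
  qed
  have mean: "real k * M1 + real (n - k) * M0 = t + (real k - n / 2) * (M1 - M0)" if "k \<le> n" for k
    using t that by (simp add: of_nat_diff field_simps)
  have Wb: "ennreal (3/4) \<le> W g k" if "b \<le> k" "k \<le> n" for k
    unfolding W_def g_def
  proof (rule W_tail_lower[where d = "real r * \<delta> / 2"])
    have "real r / 2 \<le> real k - n/2" using that mn r1 unfolding b_def by linarith
    hence "(real r / 2) * \<delta> \<le> (real k - n/2) * (M1 - M0)"
      using \<Delta> \<delta> r1 by (intro mult_mono) auto
    thus "t \<le> real k * M1 + real (n - k) * M0 - real r * \<delta> / 2" using mean[of k] that by simp
  qed (use r1 \<delta> rV that in \<open>auto simp: of_nat_diff\<close>)
  have Wa: "W g a \<le> ennreal (1/4)"
  proof -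
    have "(n/2 - real a) * (M1 - M0) \<ge> real r * \<delta>"
      using \<Delta> \<delta> r1 mn rm unfolding a_def by (intro mult_mono) (auto simp: of_nat_diff)
    hence t': "a * M1 + (n - a) * M0 + r * \<delta> \<le> t" using mean[of a] ab by (simp add: algebra_simps)
    have "W g a \<le> ennreal ((real a + real (n - a)) * V / (r * \<delta>)\<^sup>2)"
      unfolding W_def g_def by (rule W_tail_upper[OF _ t']) (use r1 \<delta> in auto)
    also have "\<dots> \<le> ennreal (1/4)"
    proof (rule ennreal_leI)
      have "(real a + real (n - a)) * V / (r * \<delta>)\<^sup>2 = real n * V / (real r * \<delta>)\<^sup>2" using ab by (simp add: of_nat_diff)
      also have "\<dots> \<le> real n * V / (real r * \<delta> / 2)\<^sup>2"
        using r1 \<delta> V_nonneg by (intro divide_left_mono power_mono mult_nonneg_nonneg mult_pos_pos) auto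
      also have "\<dots> \<le> 1/4" by (rule rV)
      finally show "(real a + real (n - a)) * V / (r * \<delta>)\<^sup>2 \<le> 1/4" .
    qed
    finally show ?thesis .
  qed
  \<comment> \<open>A switch that carries the walk over \<open>t\<close> lands in the window:
    \<open>x \<le> x + Y0 \<le> t\<close> because \<open>Y0 \<ge> 0\<close>, and
    \<open>Y1 \<le> D\<close> because \<open>Y0 < Y1\<close>.\<close>
  have step: "A1 g x \<le> A1 h x + A0 g x" for x
  proof -
    have "A1 g x \<le> (\<integral>\<^sup>+\<omega>. h (x + Y1 \<omega>) + g (x + Y0 \<omega>) \<partial>Q)"
      unfolding shift_op_def using Y_AE
      by (intro nn_integral_mono_AE, eventually_elim) (auto simp: g_def h_def indicator_def)
    also have "\<dots> = A1 h x + A0 g x" by (simp add: shift_op_def nn_integral_add)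
    finally show ?thesis .
  qed
  have "W g b \<le> (\<Sum>k\<in>{a<..b}. W h k) + W g a"
    unfolding W_def by (rule telescope_upper[OF A0 A1 comm hm gm step]) (use ab in auto)
  also have "\<dots> \<le> (\<Sum>k\<in>{a<..b}. W h k) + ennreal (1/4)" by (intro add_left_mono Wa)
  finally have "ennreal (3/4) \<le> (\<Sum>k\<in>{a<..b}. W h k) + ennreal (1/4)"
    using Wb[of b] ab by auto
  moreover have "ennreal (3/4) = ennreal (1/4) + ennreal (1/2)" by (subst ennreal_plus[symmetric]) auto
  ultimately have sum: "ennreal (1/2) \<le> (\<Sum>k\<in>{a<..b}. W h k)"
    using ennreal_add_left_cancel_le[of "ennreal (1/4)" "ennreal (1/2)"] by (simp only: add.commute[of _ "ennreal (1/4)"]) simp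
  \<comment> \<open>The factor 4 in the hypothesis on binomial weights covers offsets up to
    \<open>2 * r\<close>, with \<open>r \<le> R * sqrt n + 1\<close>.\<close>
  have bin': "c / sqrt n \<le> real (n choose k) / 2 ^ n" if "k \<in> {a..b+r}" for k
  proof (rule bin)
    have "m \<le> k + r" "k \<le> m + 2 * r" using that rm unfolding a_def b_def by auto
    hence "real m \<le> real k + real r" "real k \<le> real m + 2 * real r" by linarith+
    hence "\<bar>real k - real m\<bar> \<le> 4 * (R * sqrt n)" using r Rs by linarith
    thus "\<bar>real k - real (n div 2)\<bar> \<le> 4 * R * sqrt n" by (simp add: m_def)
  qed
  have "ennreal (c / (2 * sqrt n)) = ennreal (c / sqrt n) * ennreal (1/2)"
    by (subst ennreal_mult[symmetric]) (use c in auto)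
  also have "\<dots> \<le> ennreal (c / sqrt n) * (\<Sum>k\<in>{a<..b}. W h k)" by (intro mult_left_mono sum) auto
  also have "\<dots> = (\<Sum>k\<in>{a<..b}. ennreal (c / sqrt n) * W h k)" by (simp add: sum_distrib_left)
  also have "\<dots> \<le> (\<Sum>k\<in>{a<..b}. ennreal (real (n choose k) / 2 ^ n) * W h k)"
    by (intro sum_mono mult_right_mono ennreal_leI bin') auto
  also have "\<dots> \<le> (\<Sum>k\<le>n. ennreal (real (n choose k) / 2 ^ n) * W h k)"
    using ab by (intro sum_mono2) auto
  also have "\<dots> = (A ^^ n) h 0" unfolding binom[OF hm] W_def ..
  finally show "ennreal (c / (2 * sqrt n)) \<le> (A ^^ n) (indicator {t<..t+D}) 0" by (simp add: h_def)
  \<comment> \<open>The block \<open>{b..b+r}\<close> has at least \<open>sqrt n\<close> elements,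
    each with weight at least \<open>c / sqrt n\<close> and tail probability at least 3/4.\<close>
  have "c / 2 \<le> real (card {b..b+r}) * (c / sqrt n * (3/4))"
  proof -
    have "1 \<le> real (card {b..b+r}) / sqrt n"
    proof -
      have "sqrt n \<le> R * sqrt n" using R mult_mono[of 1 R "sqrt n" "sqrt n"] by simp
      hence "sqrt n \<le> real (card {b..b+r})" using r by simp
      thus ?thesis using sq8 n64 by (simp add: le_divide_eq)
    qed
    hence "(3/4 * c) * 1 \<le> (3/4 * c) * (real (card {b..b+r}) / sqrt n)" using c by (intro mult_left_mono) auto
    thus ?thesis using c by simp
  qed
  hence "ennreal (c / 2) \<le> ennreal (real (card {b..b+r}) * (c / sqrt n * (3/4)))" by (rule ennreal_leI)
  also have "\<dots> = (\<Sum>k\<in>{b..b+r}. ennreal (c / sqrt n) * ennreal (3/4))"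
    unfolding sum_constant ennreal_of_nat_eq_real_of_nat
    using c by (subst ennreal_mult, simp, simp, subst ennreal_mult) (simp_all del: card_atLeastAtMost)
  also have "\<dots> \<le> (\<Sum>k\<in>{b..b+r}. ennreal (real (n choose k) / 2 ^ n) * W g k)"
    using ab by (intro sum_mono mult_mono ennreal_leI bin' Wb) auto
  also have "\<dots> \<le> (\<Sum>k\<le>n. ennreal (real (n choose k) / 2 ^ n) * W g k)"
    using ab by (intro sum_mono2) auto
  also have "\<dots> = (A ^^ n) g 0" unfolding binom[OF gm] W_def ..
  finally show "ennreal (c / 2) \<le> (A ^^ n) (indicator {t<..}) 0" by (simp add: g_def)
qed

end

section \<open>Exponential tilting\<close>

lemma abs_integral_le_AE:
  fixes f g :: "'a \<Rightarrow> real"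
  assumes "integrable M f" "integrable M g" "AE x in M. \<bar>f x\<bar> \<le> g x"
  shows "\<bar>\<integral>x. f x \<partial>M\<bar> \<le> (\<integral>x. g x \<partial>M)"
  using assms by (intro order_trans[OF integral_abs_bound integral_mono_AE]) auto

locale nonneg_rv = prob_space M for M :: "'a measure" +
  fixes \<xi> :: "'a \<Rightarrow> real"
  assumes \<xi>_meas [measurable]: "\<xi> \<in> borel_measurable M" and \<xi>_nonneg: "AE \<omega> in M. 0 \<le> \<xi> \<omega>"
begin

definition Lam :: "real \<Rightarrow> real" where "Lam s = (\<integral>\<omega>. exp (s * \<xi> \<omega>) \<partial>M)"
text \<open>Negative exponents are included: \<open>- 1\<close> serves later to bound the
  probability of small sums.\<close>

definition dom :: "real set" where "dom = {s. integrable M (\<lambda>\<omega>. exp (s * \<xi> \<omega>))}"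
definition tail :: "nat \<Rightarrow> real \<Rightarrow> ennreal" where "tail n t = (shift_op M \<xi> ^^ n) (indicator {t<..}) 0"
definition tilt :: "real \<Rightarrow> 'a measure" where "tilt s = density M (\<lambda>\<omega>. ennreal (exp (s * \<xi> \<omega>) / Lam s))"
text \<open>The mean of \<open>\<xi>\<close> under \<open>tilt s\<close>, formally the derivative of
  \<open>ln Lam\<close>. As an explicit integral it can be estimated without
  differentiating.\<close>

definition mean :: "real \<Rightarrow> real" where "mean s = (\<integral>\<omega>. \<xi> \<omega> * exp (s * \<xi> \<omega>) \<partial>M) / Lam s"

lemma T_pos_lin: "pos_lin (shift_op M \<xi>)"
  by (intro pos_lin_shift_op prob_space_axioms) auto

lemma Lam_pos:
  assumes "s \<in> dom"
  shows "Lam s > 0"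
proof -
  have "(\<integral>\<omega>. 0 \<partial>M) < (\<integral>\<omega>. exp (s * \<xi> \<omega>) \<partial>M)"
    by (rule integral_less_AE_space) (use assms in \<open>auto simp: emeasure_space_1 dom_def\<close>)
  thus ?thesis by (simp add: Lam_def)
qed

lemma Lam_nn: "s \<in> dom \<Longrightarrow> (\<integral>\<^sup>+\<omega>. ennreal (exp (s * \<xi> \<omega>)) \<partial>M) = ennreal (Lam s)"
  unfolding Lam_def dom_def by (intro nn_integral_eq_integral) auto

lemma Lam_mono: "s \<in> dom \<Longrightarrow> u \<in> dom \<Longrightarrow> s \<le> u \<Longrightarrow> Lam s \<le> Lam u"
  unfolding Lam_def dom_def using \<xi>_nonneg
  by (intro integral_mono_AE) (auto elim!: eventually_mono intro: mult_right_mono)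

lemma zero_dom: "0 \<in> dom" and Lam_0: "Lam 0 = 1"
  by (auto simp: dom_def Lam_def prob_space)

lemma Lam_ge_1: "s \<in> dom \<Longrightarrow> s \<ge> 0 \<Longrightarrow> Lam s \<ge> 1"
  using Lam_mono[OF zero_dom] Lam_0 by simp

lemma dom_mono: "s \<in> dom \<Longrightarrow> u \<le> s \<Longrightarrow> u \<in> dom"
  unfolding dom_def mem_Collect_eq
  by (rule Bochner_Integration.integrable_bound, assumption)
     (use \<xi>_nonneg in \<open>auto elim!: eventually_mono intro: mult_right_mono\<close>)

lemma prob_space_tilt: "s \<in> dom \<Longrightarrow> prob_space (tilt s)"
proof
  assume s: "s \<in> dom"
  have "emeasure (tilt s) (space (tilt s)) = (\<integral>\<^sup>+\<omega>. ennreal (exp (s * \<xi> \<omega>) / Lam s) \<partial>M)"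
    unfolding tilt_def by (subst emeasure_density) (auto intro!: nn_integral_cong)
  also have "\<dots> = (\<integral>\<^sup>+\<omega>. ennreal (1 / Lam s) * ennreal (exp (s * \<xi> \<omega>)) \<partial>M)"
    using Lam_pos[OF s] by (intro nn_integral_cong) (simp flip: ennreal_mult)
  also have "\<dots> = ennreal (1 / Lam s) * ennreal (Lam s)"
    by (simp add: nn_integral_cmult Lam_nn s)
  also have "\<dots> = 1" using Lam_pos[OF s] by (simp flip: ennreal_mult)
  finally show "emeasure (tilt s) (space (tilt s)) = 1" .
qed

lemma sets_tilt [measurable_cong, simp]: "sets (tilt s) = sets M"
  and space_tilt [simp]: "space (tilt s) = space M"
  by (auto simp: tilt_def)

lemma nn_integral_tilt:
  assumes [measurable]: "f \<in> borel_measurable M"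
  shows "(\<integral>\<^sup>+\<omega>. f \<omega> \<partial>tilt s) = (\<integral>\<^sup>+\<omega>. ennreal (exp (s * \<xi> \<omega>) / Lam s) * f \<omega> \<partial>M)"
  unfolding tilt_def by (subst nn_integral_density) auto

lemma AE_tilt: "AE \<omega> in M. P \<omega> \<Longrightarrow> AE \<omega> in tilt s. P \<omega>"
  unfolding tilt_def by (subst AE_density) auto

lemma tilt_pos_lin: "s \<in> dom \<Longrightarrow> pos_lin (shift_op (tilt s) \<xi>)"
  by (intro pos_lin_shift_op prob_space_tilt) auto

text \<open>Change of measure along a path: the densities \<open>exp (s * \<xi>) / Lam s\<close> of
  the single steps multiply to \<open>exp (s * (y - x)) / Lam s ^ n\<close>, where \<open>y\<close>
  is the end point.\<close>

lemma funpow_tilt: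
  assumes s: "s \<in> dom" and f [measurable]: "f \<in> borel_measurable borel"
  shows "(shift_op M \<xi> ^^ n) (\<lambda>y. ennreal (exp (s * y)) * f y) x
     = ennreal (Lam s ^ n * exp (s * x)) * (shift_op (tilt s) \<xi> ^^ n) f x"
proof (induction n arbitrary: x)
  case (Suc n)
  note [measurable] = pos_lin_meas[OF pos_lin_funpow[OF tilt_pos_lin[OF s]] f]
  define F where "F = (shift_op (tilt s) \<xi> ^^ n) f"
  have [measurable]: "F \<in> borel_measurable borel" unfolding F_def by measurable
  have L: "Lam s > 0" by (rule Lam_pos[OF s])
  have "(shift_op M \<xi> ^^ Suc n) (\<lambda>y. ennreal (exp (s * y)) * f y) x
     = (\<integral>\<^sup>+\<omega>. ennreal (Lam s ^ n * exp (s * (x + \<xi> \<omega>))) * F (x + \<xi> \<omega>) \<partial>M)"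
    unfolding funpow.simps o_def by (simp add: Suc F_def shift_op_def[of M])
  also have "\<dots> = (\<integral>\<^sup>+\<omega>. ennreal (Lam s ^ Suc n * exp (s * x)) * (ennreal (exp (s * \<xi> \<omega>) / Lam s) * F (x + \<xi> \<omega>)) \<partial>M)"
  proof (intro nn_integral_cong)
    fix \<omega>
    have "Lam s ^ n * exp (s * (x + \<xi> \<omega>)) = (Lam s ^ Suc n * exp (s * x)) * (exp (s * \<xi> \<omega>) / Lam s)"
      using L by (simp add: distrib_left exp_add)
    also have "ennreal \<dots> = ennreal (Lam s ^ Suc n * exp (s * x)) * ennreal (exp (s * \<xi> \<omega>) / Lam s)"
      using L by (intro ennreal_mult) auto
    finally show "ennreal (Lam s ^ n * exp (s * (x + \<xi> \<omega>))) * F (x + \<xi> \<omega>) =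
        ennreal (Lam s ^ Suc n * exp (s * x)) * (ennreal (exp (s * \<xi> \<omega>) / Lam s) * F (x + \<xi> \<omega>))"
      by (simp add: mult.assoc)
  qed
  also have "\<dots> = ennreal (Lam s ^ Suc n * exp (s * x)) * shift_op (tilt s) \<xi> F x"
    unfolding shift_op_def by (subst nn_integral_cmult) (auto simp: nn_integral_tilt)
  finally show ?case by (simp add: F_def)
qed simp

lemma funpow_exp:
  assumes s: "s \<in> dom"
  shows "(shift_op M \<xi> ^^ n) (\<lambda>y. ennreal (exp (s * y))) x = ennreal (Lam s ^ n * exp (s * x))"
  using funpow_tilt[OF s, of "\<lambda>_. 1" n x] by (simp add: pos_lin_one[OF pos_lin_funpow[OF tilt_pos_lin[OF s]]])

lemma chernoff:
  assumes s: "s \<in> dom" "s \<ge> 0"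
  shows "tail n t \<le> ennreal (Lam s ^ n * exp (- s * t))"
proof -
  have "tail n t \<le> (shift_op M \<xi> ^^ n) (\<lambda>y. ennreal (exp (- s * t)) * ennreal (exp (s * y))) 0"
    unfolding tail_def
  proof (rule pos_lin_mono[OF pos_lin_funpow[OF T_pos_lin]])
    fix y
    have "ennreal (exp (- s * t)) * ennreal (exp (s * y)) = ennreal (exp (s * (y - t)))"
      by (simp add: algebra_simps flip: ennreal_mult exp_add)
    thus "indicator {t<..} y \<le> ennreal (exp (- s * t)) * ennreal (exp (s * y))"
      using s by (simp add: indicator_def)
  qed auto
  also have "\<dots> = ennreal (exp (- s * t)) * ennreal (Lam s ^ n)"
    by (subst pos_lin_cmult[OF pos_lin_funpow[OF T_pos_lin]]) (auto simp: funpow_exp[OF s(1)])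
  also have "\<dots> = ennreal (Lam s ^ n * exp (- s * t))"
    using Lam_pos[OF s(1)] by (simp add: mult.commute flip: ennreal_mult)
  finally show ?thesis .
qed

end

text \<open>\<open>\<sigma>\<close> is the largest tilt in use; a second moment there dominates
  those of all tilts in \<open>{0..\<sigma>}\<close>. The numbers \<open>a < a' \<le> D\<close> make
  nondegeneracy quantitative: two independent copies are separated by at least
  \<open>a' - a\<close>, and stay below \<open>D\<close>, with positive probability.\<close>

locale tilt_rv = nonneg_rv +
  fixes \<sigma> a a' D :: real
  assumes \<sigma>: "\<sigma> > 0" and int2: "integrable M (\<lambda>\<omega>. (\<xi> \<omega>)\<^sup>2 * exp (\<sigma> * \<xi> \<omega>))"
    and aa': "0 \<le> a" "a < a'" "a' \<le> D"
    and mass: "measure M {\<omega> \<in> space M. \<xi> \<omega> \<le> a} > 0" "measure M {\<omega> \<in> space M. a' \<le> \<xi> \<omega> \<and> \<xi> \<omega> \<le> D} > 0"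
begin

lemma int_0: "integrable M (\<lambda>\<omega>. exp (\<sigma> * \<xi> \<omega>))"
proof (rule Bochner_Integration.integrable_bound)
  show "integrable M (\<lambda>\<omega>. exp \<sigma> + (\<xi> \<omega>)\<^sup>2 * exp (\<sigma> * \<xi> \<omega>))" using int2 by simp
  show "AE \<omega> in M. norm (exp (\<sigma> * \<xi> \<omega>)) \<le> norm (exp \<sigma> + (\<xi> \<omega>)\<^sup>2 * exp (\<sigma> * \<xi> \<omega>))"
    using \<xi>_nonneg
  proof eventually_elim
    case (elim \<omega>)
    show ?case
    proof (cases "\<xi> \<omega> \<le> 1")
      case True
      hence "exp (\<sigma> * \<xi> \<omega>) \<le> exp \<sigma>" using \<sigma> elim by (simp add: mult_left_le)
      moreover have "0 \<le> (\<xi> \<omega>)\<^sup>2 * exp (\<sigma> * \<xi> \<omega>)" by simp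
      ultimately show ?thesis using exp_ge_zero[of "\<sigma> * \<xi> \<omega>"] unfolding real_norm_def by linarith
    next
      case False
      hence "1 * exp (\<sigma> * \<xi> \<omega>) \<le> (\<xi> \<omega>)\<^sup>2 * exp (\<sigma> * \<xi> \<omega>)" by (intro mult_right_mono) auto
      thus ?thesis by (simp add: add_increasing)
    qed
  qed
qed auto

lemma \<sigma>_dom: "\<sigma> \<in> dom" using int_0 by (simp add: dom_def)

lemma s_dom: "s \<le> \<sigma> \<Longrightarrow> s \<in> dom" using dom_mono[OF \<sigma>_dom] .

lemma int_1: "integrable M (\<lambda>\<omega>. \<xi> \<omega> * exp (\<sigma> * \<xi> \<omega>))"
proof (rule Bochner_Integration.integrable_bound)
  show "integrable M (\<lambda>\<omega>. exp (\<sigma> * \<xi> \<omega>) + (\<xi> \<omega>)\<^sup>2 * exp (\<sigma> * \<xi> \<omega>))" using int2 int_0 by simp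
  have "norm (\<xi> \<omega> * exp (\<sigma> * \<xi> \<omega>)) \<le> norm (exp (\<sigma> * \<xi> \<omega>) + (\<xi> \<omega>)\<^sup>2 * exp (\<sigma> * \<xi> \<omega>))" for \<omega>
  proof -
    have "\<bar>\<xi> \<omega>\<bar> \<le> 1 + (\<xi> \<omega>)\<^sup>2"
      using zero_le_power2[of "\<bar>\<xi> \<omega>\<bar> - 1"] by (auto simp: power2_eq_square algebra_simps)
    hence "\<bar>\<xi> \<omega>\<bar> * exp (\<sigma> * \<xi> \<omega>) \<le> (1 + (\<xi> \<omega>)\<^sup>2) * exp (\<sigma> * \<xi> \<omega>)" by (intro mult_right_mono) auto
    thus ?thesis by (simp add: abs_mult algebra_simps)
  qed
  thus "AE \<omega> in M. norm (\<xi> \<omega> * exp (\<sigma> * \<xi> \<omega>)) \<le> norm (exp (\<sigma> * \<xi> \<omega>) + (\<xi> \<omega>)\<^sup>2 * exp (\<sigma> * \<xi> \<omega>))" by simp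
qed auto

lemma int_1s: "s \<le> \<sigma> \<Longrightarrow> integrable M (\<lambda>\<omega>. \<xi> \<omega> * exp (s * \<xi> \<omega>))"
  by (rule Bochner_Integration.integrable_bound[OF int_1])
     (use \<xi>_nonneg in \<open>auto elim!: eventually_mono simp: abs_mult intro!: mult_left_mono mult_right_mono\<close>)

definition "C1 = (\<integral>\<omega>. \<xi> \<omega> * exp (\<sigma> * \<xi> \<omega>) \<partial>M)"
definition "C2 = (\<integral>\<omega>. (\<xi> \<omega>)\<^sup>2 * exp (\<sigma> * \<xi> \<omega>) \<partial>M)"

text \<open>The tangent inequality \<open>1 + z \<le> exp z\<close> replaces the mean value theorem;
  the majorant with exponent \<open>\<sigma>\<close> makes the bound uniform in both
  exponents.\<close>

lemma exp_diff_bound: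
  assumes "0 \<le> x" "s \<le> \<sigma>" "u \<le> \<sigma>"
  shows "\<bar>exp (s * x) - exp (u * x)\<bar> \<le> \<bar>s - u\<bar> * (x * exp (\<sigma> * x))"
proof -
  have *: "exp (v * x) - exp (w * x) \<le> (v - w) * (x * exp (\<sigma> * x))" "exp (w * x) \<le> exp (v * x)" if "w \<le> v" "v \<le> \<sigma>" for v w
  proof -
    have "exp (v * x) * (1 + (w - v) * x) \<le> exp (v * x) * exp ((w - v) * x)"
      by (intro mult_left_mono exp_ge_add_one_self) auto
    also have "\<dots> = exp (w * x)" by (simp add: algebra_simps flip: exp_add)
    finally have "exp (v * x) - exp (w * x) \<le> ((v - w) * x) * exp (v * x)" by (simp add: algebra_simps)
    also have "\<dots> \<le> ((v - w) * x) * exp (\<sigma> * x)" using that assms by (intro mult_left_mono) (auto intro: mult_right_mono)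
    finally show "exp (v * x) - exp (w * x) \<le> (v - w) * (x * exp (\<sigma> * x))" by simp
    show "exp (w * x) \<le> exp (v * x)" using that assms by (auto intro: mult_right_mono)
  qed
  show ?thesis using *[of u s] *[of s u] assms by (cases "u \<le> s") (auto simp: abs_if)
qed

lemma Lam_Lipschitz:
  assumes "s \<le> \<sigma>" "u \<le> \<sigma>"
  shows "\<bar>Lam s - Lam u\<bar> \<le> \<bar>s - u\<bar> * C1"
proof -
  have "Lam s - Lam u = (\<integral>\<omega>. exp (s * \<xi> \<omega>) - exp (u * \<xi> \<omega>) \<partial>M)"
    unfolding Lam_def using s_dom[of s] s_dom[of u] assms by (subst Bochner_Integration.integral_diff) (auto simp: dom_def)
  also have "\<bar>\<dots>\<bar> \<le> (\<integral>\<omega>. \<bar>s - u\<bar> * (\<xi> \<omega> * exp (\<sigma> * \<xi> \<omega>)) \<partial>M)"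
    using \<xi>_nonneg s_dom[of s] s_dom[of u] assms int_1
    by (intro abs_integral_le_AE) (auto simp: dom_def intro!: exp_diff_bound elim!: eventually_mono)
  finally show ?thesis by (simp add: C1_def)
qed

lemma num_Lipschitz:
  assumes "s \<le> \<sigma>" "u \<le> \<sigma>"
  shows "\<bar>(\<integral>\<omega>. \<xi> \<omega> * exp (s * \<xi> \<omega>) \<partial>M) - (\<integral>\<omega>. \<xi> \<omega> * exp (u * \<xi> \<omega>) \<partial>M)\<bar> \<le> \<bar>s - u\<bar> * C2"
proof -
  have "(\<integral>\<omega>. \<xi> \<omega> * exp (s * \<xi> \<omega>) \<partial>M) - (\<integral>\<omega>. \<xi> \<omega> * exp (u * \<xi> \<omega>) \<partial>M) = (\<integral>\<omega>. \<xi> \<omega> * exp (s * \<xi> \<omega>) - \<xi> \<omega> * exp (u * \<xi> \<omega>) \<partial>M)"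
    using assms by (subst Bochner_Integration.integral_diff) (auto simp: int_1s)
  also have "\<bar>\<dots>\<bar> \<le> (\<integral>\<omega>. \<bar>s - u\<bar> * ((\<xi> \<omega>)\<^sup>2 * exp (\<sigma> * \<xi> \<omega>)) \<partial>M)"
  proof (rule abs_integral_le_AE)
    show "AE \<omega> in M. \<bar>\<xi> \<omega> * exp (s * \<xi> \<omega>) - \<xi> \<omega> * exp (u * \<xi> \<omega>)\<bar> \<le> \<bar>s - u\<bar> * ((\<xi> \<omega>)\<^sup>2 * exp (\<sigma> * \<xi> \<omega>))"
      using \<xi>_nonneg
    proof eventually_elim
      case (elim \<omega>)
      have "\<bar>\<xi> \<omega> * exp (s * \<xi> \<omega>) - \<xi> \<omega> * exp (u * \<xi> \<omega>)\<bar> = \<xi> \<omega> * \<bar>exp (s * \<xi> \<omega>) - exp (u * \<xi> \<omega>)\<bar>"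
        using elim by (simp add: abs_mult flip: right_diff_distrib)
      also have "\<dots> \<le> \<xi> \<omega> * (\<bar>s - u\<bar> * (\<xi> \<omega> * exp (\<sigma> * \<xi> \<omega>)))"
        using elim assms by (intro mult_left_mono exp_diff_bound) auto
      finally show ?case by (simp add: power2_eq_square mult_ac)
    qed
  qed (use assms int_1s int2 in auto)
  finally show ?thesis by (simp add: C2_def)
qed


lemma continuous_Lam: "continuous_on {..\<sigma>} Lam"
  and continuous_mean: "continuous_on {..\<sigma>} mean"
proof -
  have lip: "continuous_on {..\<sigma>} f" if "\<And>s u. s \<le> \<sigma> \<Longrightarrow> u \<le> \<sigma> \<Longrightarrow> \<bar>f s - f u\<bar> \<le> \<bar>s - u\<bar> * C" "C \<ge> 0" for f C
    by (rule lipschitz_on_continuous_on[of C], rule lipschitz_onI) (use that in \<open>auto simp: dist_real_def mult.commute\<close>)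
  have "C1 \<ge> 0" unfolding C1_def using \<xi>_nonneg by (intro integral_nonneg_AE) auto
  then show cL: "continuous_on {..\<sigma>} Lam" by (intro lip[of Lam C1] Lam_Lipschitz)
  have "C2 \<ge> 0" unfolding C2_def by (intro integral_nonneg_AE) auto
  hence "continuous_on {..\<sigma>} (\<lambda>s. \<integral>\<omega>. \<xi> \<omega> * exp (s * \<xi> \<omega>) \<partial>M)"
    by (intro lip[of _ C2] num_Lipschitz)
  thus "continuous_on {..\<sigma>} mean" unfolding mean_def[abs_def]
    by (rule continuous_on_divide[OF _ cL]) (auto dest!: s_dom Lam_pos)
qed

lemma mean_IVT:
  assumes "mean 0 \<le> x" "x \<le> mean \<sigma>"
  shows "\<exists>s. 0 \<le> s \<and> s \<le> \<sigma> \<and> mean s = x"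
  using IVT'[of mean 0 x \<sigma>] assms \<sigma> continuous_on_subset[OF continuous_mean] by auto

lemma mean_0: "mean 0 = (\<integral>\<omega>. \<xi> \<omega> \<partial>M)"
  by (simp add: mean_def Lam_0)

text \<open>Read backwards, this bounds \<open>1 / s\<close> by a multiple of
  \<open>1 / (mean s - mean 0)\<close>, which removes the implicitly defined tilt from the upper
  tail bound.\<close>

lemma mean_growth:
  assumes "0 \<le> s" "s \<le> \<sigma>"
  shows "mean s - mean 0 \<le> s * C2"
proof -
  have L: "Lam s \<ge> 1" using assms by (intro Lam_ge_1 s_dom)
  have "0 \<le> (\<integral>\<omega>. \<xi> \<omega> * exp (s * \<xi> \<omega>) \<partial>M)" using \<xi>_nonneg by (intro integral_nonneg_AE) auto
  hence "mean s \<le> (\<integral>\<omega>. \<xi> \<omega> * exp (s * \<xi> \<omega>) \<partial>M)"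
    unfolding mean_def using L by (simp add: divide_le_eq mult_left_le) (simp add: mult_le_cancel_left1)
  also have "\<dots> \<le> mean 0 + s * C2"
    using num_Lipschitz[of s 0] assms \<sigma> by (simp add: mean_0)
  finally show ?thesis by simp
qed

text \<open>The two copies are ordered only if both are at most \<open>D\<close>; otherwise
  \<open>Y0\<close> and \<open>Y1\<close> both equal the first copy. A gap thus occurs only below
  \<open>D\<close>, although \<open>\<xi>\<close> itself is not truncated.\<close>

definition "Y0 = (\<lambda>(\<omega>, \<omega>'). if \<xi> \<omega> \<le> D \<and> \<xi> \<omega>' \<le> D then min (\<xi> \<omega>) (\<xi> \<omega>') else \<xi> \<omega>)"
definition "Y1 = (\<lambda>(\<omega>, \<omega>'). if \<xi> \<omega> \<le> D \<and> \<xi> \<omega>' \<le> D then max (\<xi> \<omega>) (\<xi> \<omega>') else \<xi> \<omega>)"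
text \<open>A lower bound for the mean gap, valid for all tilts in \<open>{0..\<sigma>}\<close>: the
  first copy is at most \<open>a\<close>, the second lies in \<open>{a'..D}\<close>, and tilting
  divides either probability by at most \<open>Lam \<sigma>\<close>.\<close>

definition "\<delta> = (a' - a) * (measure M {\<omega> \<in> space M. \<xi> \<omega> \<le> a} * measure M {\<omega> \<in> space M. a' \<le> \<xi> \<omega> \<and> \<xi> \<omega> \<le> D}) / (Lam \<sigma>)\<^sup>2"

lemma \<delta>_pos: "\<delta> > 0"
  unfolding \<delta>_def using aa' mass Lam_pos[OF \<sigma>_dom] by (intro divide_pos_pos mult_pos_pos) auto

text \<open>Minimum and maximum form the same unordered pair as the two copies, and the event that
  both are at most \<open>D\<close> is symmetric, so there the second copy may be exchanged for the
  first.\<close>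

lemma half_mixture:
  assumes s: "s \<le> \<sigma>" and f [measurable]: "f \<in> borel_measurable borel"
  shows "2 * shift_op (tilt s) \<xi> f x =
    shift_op (tilt s \<Otimes>\<^sub>M tilt s) Y0 f x + shift_op (tilt s \<Otimes>\<^sub>M tilt s) Y1 f x"
proof -
  interpret P: prob_space "tilt s" by (rule prob_space_tilt[OF s_dom[OF s]])
  interpret PP: pair_prob_space "tilt s" "tilt s" ..
  let ?Q = "tilt s \<Otimes>\<^sub>M tilt s"
  define \<phi> where "\<phi> \<omega> = f (x + \<xi> \<omega>)" for \<omega>
  define i :: "'a \<Rightarrow> ennreal" where "i \<omega> = indicator {..D} (\<xi> \<omega>)" for \<omega>
  have [measurable]: "\<phi> \<in> borel_measurable M" "i \<in> borel_measurable M"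
    unfolding \<phi>_def i_def by measurable
  have [measurable]: "Y0 \<in> borel_measurable ?Q" "Y1 \<in> borel_measurable ?Q"
    unfolding Y0_def Y1_def by measurable
  have sym: "(\<integral>\<^sup>+z. i (fst z) * i (snd z) * \<phi> (snd z) \<partial>?Q) = (\<integral>\<^sup>+z. i (fst z) * i (snd z) * \<phi> (fst z) \<partial>?Q)"
  proof -
    have "(\<integral>\<^sup>+z. i (fst z) * i (snd z) * \<phi> (snd z) \<partial>?Q) = (\<integral>\<^sup>+\<omega>. i \<omega> * (\<integral>\<^sup>+\<omega>'. i \<omega>' * \<phi> \<omega>' \<partial>tilt s) \<partial>tilt s)"
      by (simp add: P.nn_integral_fst[symmetric] nn_integral_cmult mult.assoc)
    also have "\<dots> = (\<integral>\<^sup>+\<omega>. i \<omega> \<partial>tilt s) * (\<integral>\<^sup>+\<omega>'. i \<omega>' * \<phi> \<omega>' \<partial>tilt s)"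
      by (simp add: nn_integral_multc)
    also have "\<dots> = (\<integral>\<^sup>+\<omega>. (i \<omega> * \<phi> \<omega>) * (\<integral>\<^sup>+\<omega>'. i \<omega>' \<partial>tilt s) \<partial>tilt s)"
      by (simp add: nn_integral_multc mult.commute)
    also have "\<dots> = (\<integral>\<^sup>+\<omega>. \<integral>\<^sup>+\<omega>'. (i \<omega> * \<phi> \<omega>) * i \<omega>' \<partial>tilt s \<partial>tilt s)"
      by (simp add: nn_integral_cmult)
    also have "\<dots> = (\<integral>\<^sup>+z. i (fst z) * i (snd z) * \<phi> (fst z) \<partial>?Q)"
      by (subst P.nn_integral_fst[symmetric]) (auto simp: mult_ac)
    finally show ?thesis .
  qed
  have one: "(\<integral>\<^sup>+z. \<phi> (fst z) \<partial>?Q) = (\<integral>\<^sup>+\<omega>. \<phi> \<omega> \<partial>tilt s)"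
    by (simp add: P.nn_integral_fst[symmetric] P.emeasure_space_1[simplified])
  have "shift_op ?Q Y0 f x + shift_op ?Q Y1 f x = (\<integral>\<^sup>+z. f (x + Y0 z) + f (x + Y1 z) \<partial>?Q)"
    by (simp add: shift_op_def nn_integral_add)
  also have "\<dots> = (\<integral>\<^sup>+z. \<phi> (fst z) + ((1 - i (fst z) * i (snd z)) * \<phi> (fst z) + i (fst z) * i (snd z) * \<phi> (snd z)) \<partial>?Q)"
    by (intro nn_integral_cong) (auto simp: Y0_def Y1_def i_def \<phi>_def min_def max_def add.commute split: prod.splits)
  also have "\<dots> = (\<integral>\<^sup>+z. \<phi> (fst z) \<partial>?Q) + ((\<integral>\<^sup>+z. (1 - i (fst z) * i (snd z)) * \<phi> (fst z) \<partial>?Q) + (\<integral>\<^sup>+z. i (fst z) * i (snd z) * \<phi> (fst z) \<partial>?Q))"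
    by (simp add: nn_integral_add sym)
  also have "\<dots> = (\<integral>\<^sup>+z. \<phi> (fst z) \<partial>?Q) + (\<integral>\<^sup>+z. (1 - i (fst z) * i (snd z)) * \<phi> (fst z) + i (fst z) * i (snd z) * \<phi> (fst z) \<partial>?Q)"
    by (simp add: nn_integral_add)
  also have "(\<integral>\<^sup>+z. (1 - i (fst z) * i (snd z)) * \<phi> (fst z) + i (fst z) * i (snd z) * \<phi> (fst z) \<partial>?Q) = (\<integral>\<^sup>+z. \<phi> (fst z) \<partial>?Q)"
    by (intro nn_integral_cong) (auto simp: i_def indicator_def)
  finally show ?thesis unfolding one by (simp add: shift_op_def[of "tilt s"] \<phi>_def[abs_def] mult_2)
qed

lemma tilt_square: "0 \<le> s \<Longrightarrow> s \<le> \<sigma> \<Longrightarrow> (\<integral>\<^sup>+\<omega>. ennreal ((\<xi> \<omega>)\<^sup>2) \<partial>tilt s) \<le> ennreal C2"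
proof -
  assume s: "0 \<le> s" "s \<le> \<sigma>"
  have L: "Lam s \<ge> 1" using s by (intro Lam_ge_1 s_dom)
  have "(\<integral>\<^sup>+\<omega>. ennreal ((\<xi> \<omega>)\<^sup>2) \<partial>tilt s) = (\<integral>\<^sup>+\<omega>. ennreal (exp (s * \<xi> \<omega>) / Lam s) * ennreal ((\<xi> \<omega>)\<^sup>2) \<partial>M)"
    by (rule nn_integral_tilt) simp
  also have "\<dots> \<le> (\<integral>\<^sup>+\<omega>. ennreal ((\<xi> \<omega>)\<^sup>2 * exp (\<sigma> * \<xi> \<omega>)) \<partial>M)"
    using \<xi>_nonneg
  proof (intro nn_integral_mono_AE, eventually_elim)
    case (elim \<omega>)
    have "exp (s * \<xi> \<omega>) / Lam s \<le> exp (\<sigma> * \<xi> \<omega>) / 1"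
      using elim s L by (intro frac_le) (auto intro: mult_right_mono)
    hence "exp (s * \<xi> \<omega>) / Lam s * (\<xi> \<omega>)\<^sup>2 \<le> exp (\<sigma> * \<xi> \<omega>) * (\<xi> \<omega>)\<^sup>2" by (intro mult_right_mono) auto
    thus ?case using L by (simp add: mult.commute ennreal_leI flip: ennreal_mult)
  qed
  also have "\<dots> = ennreal C2" unfolding C2_def by (rule nn_integral_eq_integral) (use int2 in auto)
  finally show ?thesis .
qed

lemma tilt_mean:
  assumes s: "s \<le> \<sigma>"
  shows "(\<integral>\<^sup>+\<omega>. ennreal (\<xi> \<omega>) \<partial>tilt s) = ennreal (mean s)"
proof -
  have L: "Lam s > 0" using s by (intro Lam_pos s_dom)
  have "(\<integral>\<^sup>+\<omega>. ennreal (\<xi> \<omega>) \<partial>tilt s) = (\<integral>\<^sup>+\<omega>. ennreal (exp (s * \<xi> \<omega>) / Lam s) * ennreal (\<xi> \<omega>) \<partial>M)"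
    by (rule nn_integral_tilt) simp
  also have "\<dots> = (\<integral>\<^sup>+\<omega>. ennreal (\<xi> \<omega> * exp (s * \<xi> \<omega>) / Lam s) \<partial>M)"
  proof (intro nn_integral_cong)
    fix \<omega>
    have "ennreal (exp (s * \<xi> \<omega>) / Lam s) * ennreal (\<xi> \<omega>) = ennreal (exp (s * \<xi> \<omega>) / Lam s * \<xi> \<omega>)"
      using L by (intro ennreal_mult'[symmetric]) simp
    thus "ennreal (exp (s * \<xi> \<omega>) / Lam s) * ennreal (\<xi> \<omega>) = ennreal (\<xi> \<omega> * exp (s * \<xi> \<omega>) / Lam s)"
      by (simp add: mult.commute)
  qed
  also have "\<dots> = ennreal (\<integral>\<omega>. \<xi> \<omega> * exp (s * \<xi> \<omega>) / Lam s \<partial>M)"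
    by (rule nn_integral_eq_integral) (use int_1s[OF s] \<xi>_nonneg L in auto)
  finally show ?thesis by (simp add: mean_def)
qed

text \<open>The density \<open>exp (s * \<xi>) / Lam s\<close> is at least
  \<open>1 / Lam \<sigma>\<close>, because \<open>\<xi> \<ge> 0\<close> and \<open>Lam\<close> is
  increasing.\<close>

lemma measure_tilt:
  assumes "0 \<le> s" "s \<le> \<sigma>" and [measurable]: "B \<in> sets M"
  shows "measure M B / Lam \<sigma> \<le> measure (tilt s) B"
proof -
  interpret P: prob_space "tilt s" by (rule prob_space_tilt[OF s_dom]) fact
  have L: "Lam s > 0" "Lam s \<le> Lam \<sigma>" using assms by (auto intro!: Lam_pos s_dom Lam_mono)
  have "ennreal (measure M B / Lam \<sigma>) = ennreal (1 / Lam \<sigma>) * emeasure M B"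
    using L by (simp add: emeasure_eq_measure flip: ennreal_mult)
  also have "\<dots> = (\<integral>\<^sup>+\<omega>. ennreal (1 / Lam \<sigma>) * indicator B \<omega> \<partial>M)"
    by (simp add: nn_integral_cmult_indicator)
  also have "\<dots> \<le> (\<integral>\<^sup>+\<omega>. ennreal (exp (s * \<xi> \<omega>) / Lam s) * indicator B \<omega> \<partial>M)"
    using \<xi>_nonneg assms L
    by (intro nn_integral_mono_AE, elim eventually_mono) (auto intro!: mult_right_mono ennreal_leI frac_le)
  also have "\<dots> = emeasure (tilt s) B" unfolding tilt_def by (subst emeasure_density) auto
  finally show ?thesis by (simp add: P.emeasure_eq_measure)
qed

lemma coupled_tilt:
  assumes s: "0 \<le> s" "s \<le> \<sigma>"
  shows "coupled (tilt s \<Otimes>\<^sub>M tilt s) Y0 Y1 D (2 * C2) \<delta> (shift_op (tilt s) \<xi>)"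
    and "(\<integral>z. Y0 z \<partial>(tilt s \<Otimes>\<^sub>M tilt s)) + (\<integral>z. Y1 z \<partial>(tilt s \<Otimes>\<^sub>M tilt s)) = 2 * mean s"
proof -
  interpret P: prob_space "tilt s" by (rule prob_space_tilt[OF s_dom[OF s(2)]])
  interpret PP: pair_prob_space "tilt s" "tilt s" ..
  let ?Q = "tilt s \<Otimes>\<^sub>M tilt s"
  have [measurable]: "Y0 \<in> borel_measurable ?Q" "Y1 \<in> borel_measurable ?Q"
    unfolding Y0_def Y1_def by measurable
  have C2: "C2 \<ge> 0" unfolding C2_def by (intro integral_nonneg_AE) auto
  have nn_tilt: "AE \<omega> in tilt s. 0 \<le> \<xi> \<omega>" by (intro AE_tilt \<xi>_nonneg)
  have nn2: "AE z in ?Q. 0 \<le> \<xi> (fst z) \<and> 0 \<le> \<xi> (snd z)"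
  proof (rule PP.AE_pair_measure)
    show "{z \<in> space ?Q. 0 \<le> \<xi> (fst z) \<and> 0 \<le> \<xi> (snd z)} \<in> sets ?Q" by measurable
    show "AE x in tilt s. AE y in tilt s. 0 \<le> \<xi> (fst (x, y)) \<and> 0 \<le> \<xi> (snd (x, y))"
      using nn_tilt
    proof eventually_elim
      case (elim x)
      from nn_tilt show ?case by eventually_elim (use elim in simp)
    qed
  qed
  have AEY: "AE z in ?Q. 0 \<le> Y0 z \<and> Y0 z \<le> Y1 z \<and> (Y0 z < Y1 z \<longrightarrow> Y1 z \<le> D)"
    using nn2 by eventually_elim (auto simp: Y0_def Y1_def split: prod.splits if_splits)
  \<comment> \<open>Each of \<open>Y0\<close> and \<open>Y1\<close> takes the value of one of the
    two copies, so its square is at most the sum of both squares; this is the origin of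
    \<open>2 * C2\<close>.\<close>
  have sq: "(\<integral>\<^sup>+z. ennreal ((Y z)\<^sup>2) \<partial>?Q) \<le> ennreal (2 * C2)"
    if "\<And>z. (Y z)\<^sup>2 \<le> (\<xi> (fst z))\<^sup>2 + (\<xi> (snd z))\<^sup>2" for Y
  proof -
    have "(\<integral>\<^sup>+z. ennreal ((Y z)\<^sup>2) \<partial>?Q) \<le> (\<integral>\<^sup>+z. ennreal ((\<xi> (fst z))\<^sup>2) + ennreal ((\<xi> (snd z))\<^sup>2) \<partial>?Q)"
      using that by (intro nn_integral_mono) (simp add: ennreal_leI flip: ennreal_plus)
    also have "\<dots> = (\<integral>\<^sup>+\<omega>. ennreal ((\<xi> \<omega>)\<^sup>2) \<partial>tilt s) + (\<integral>\<^sup>+\<omega>. ennreal ((\<xi> \<omega>)\<^sup>2) \<partial>tilt s)"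
      by (simp add: nn_integral_add P.nn_integral_fst[symmetric] P.emeasure_space_1[simplified])
    also have "\<dots> \<le> ennreal C2 + ennreal C2" by (intro add_mono tilt_square s)
    also have "\<dots> = ennreal (2 * C2)" using C2 by (simp flip: ennreal_plus)
    finally show ?thesis .
  qed
  have sqY: "(Y0 z)\<^sup>2 \<le> (\<xi> (fst z))\<^sup>2 + (\<xi> (snd z))\<^sup>2" "(Y1 z)\<^sup>2 \<le> (\<xi> (fst z))\<^sup>2 + (\<xi> (snd z))\<^sup>2" for z
    by (auto simp: Y0_def Y1_def min_def max_def split: prod.splits)
  have int: "integrable ?Q (\<lambda>z. (Y0 z)\<^sup>2)" "integrable ?Q (\<lambda>z. (Y1 z)\<^sup>2)"
    using order.strict_trans1[OF sq[OF sqY(1)] ennreal_less_top] order.strict_trans1[OF sq[OF sqY(2)] ennreal_less_top]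
    by (auto intro!: integrableI_nonneg)
  have bd: "(\<integral>z. (Y0 z)\<^sup>2 \<partial>?Q) \<le> 2 * C2" "(\<integral>z. (Y1 z)\<^sup>2 \<partial>?Q) \<le> 2 * C2"
    using sq[OF sqY(1)] sq[OF sqY(2)] C2 by (auto intro!: integral_real_bounded)
  have intY: "integrable ?Q Y0" "integrable ?Q Y1"
    using int by (auto intro!: PP.square_integrable_imp_integrable[where f=Y0] PP.square_integrable_imp_integrable[where f=Y1])
  have diff: "\<delta> \<le> (\<integral>z. Y1 z \<partial>?Q) - (\<integral>z. Y0 z \<partial>?Q)"
  proof -
    define Sa where "Sa = {\<omega> \<in> space M. \<xi> \<omega> \<le> a}"
    define Sb where "Sb = {\<omega> \<in> space M. a' \<le> \<xi> \<omega> \<and> \<xi> \<omega> \<le> D}"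
    have [measurable]: "Sa \<in> sets M" "Sb \<in> sets M" unfolding Sa_def Sb_def by measurable
    have "\<delta> = (a' - a) * (measure M Sa / Lam \<sigma> * (measure M Sb / Lam \<sigma>))"
      by (simp add: \<delta>_def Sa_def Sb_def power2_eq_square)
    also have "\<dots> \<le> (a' - a) * (measure (tilt s) Sa * measure (tilt s) Sb)"
      using aa' Lam_pos[OF \<sigma>_dom] by (intro mult_left_mono mult_mono measure_tilt s) auto
    also have "\<dots> = (a' - a) * measure ?Q (Sa \<times> Sb)"
      by (subst measure_def) (simp add: P.emeasure_pair_measure_Times P.emeasure_eq_measure enn2real_mult)
    also have "\<dots> = (\<integral>z. (a' - a) * indicator (Sa \<times> Sb) z \<partial>?Q)"
      by simp
    also have "\<dots> \<le> (\<integral>z. Y1 z - Y0 z \<partial>?Q)"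
    proof (rule integral_mono_AE)
      show "AE z in ?Q. (a' - a) * indicator (Sa \<times> Sb) z \<le> Y1 z - Y0 z"
        using AEY by eventually_elim
          (use aa' in \<open>auto simp: Sa_def Sb_def Y0_def Y1_def indicator_def split: prod.splits\<close>)
    qed (auto intro!: Bochner_Integration.integrable_diff intY integrable_mult_right integrable_real_indicator simp: PP.P.emeasure_finite less_top[symmetric])
    also have "\<dots> = (\<integral>z. Y1 z \<partial>?Q) - (\<integral>z. Y0 z \<partial>?Q)" by (simp add: intY)
    finally show ?thesis .
  qed
  show "coupled ?Q Y0 Y1 D (2 * C2) \<delta> (shift_op (tilt s) \<xi>)"
  proof
    show "2 * shift_op (tilt s) \<xi> f x = shift_op ?Q Y0 f x + shift_op ?Q Y1 f x"
      if "f \<in> borel_measurable borel" for f x by (rule half_mixture[OF s(2) that])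
    show "0 \<le> D" using aa' by simp
  qed (use AEY int bd \<delta>_pos diff tilt_pos_lin[OF s_dom[OF s(2)]] in auto)
  have nnY: "AE z in ?Q. 0 \<le> Y0 z" "AE z in ?Q. 0 \<le> Y1 z"
    by (rule AE_mp[OF AEY AE_I2], simp)+
  have m0: "mean s \<ge> 0" unfolding mean_def using Lam_pos[OF s_dom[OF s(2)]] \<xi>_nonneg
    by (intro divide_nonneg_nonneg integral_nonneg_AE) auto
  \<comment> \<open>The mixture property for \<open>f = ennreal\<close>, which is the identity on
    nonnegative reals.\<close>
  have "2 * ennreal (mean s) = ennreal (\<integral>z. Y0 z \<partial>?Q) + ennreal (\<integral>z. Y1 z \<partial>?Q)"
    using half_mixture[OF s(2), of ennreal 0] nn_integral_eq_integral[OF intY(1) nnY(1)] nn_integral_eq_integral[OF intY(2) nnY(2)]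
    by (simp add: shift_op_def tilt_mean[OF s(2)])
  hence "ennreal (2 * mean s) = ennreal ((\<integral>z. Y0 z \<partial>?Q) + (\<integral>z. Y1 z \<partial>?Q))"
    using m0 integral_nonneg_AE[OF nnY(1)] integral_nonneg_AE[OF nnY(2)] by (simp add: ennreal_mult)
  thus "(\<integral>z. Y0 z \<partial>?Q) + (\<integral>z. Y1 z \<partial>?Q) = 2 * mean s"
    using m0 integral_nonneg_AE[OF nnY(1)] integral_nonneg_AE[OF nnY(2)] by (subst (asm) ennreal_inj) auto
qed

text \<open>Undoing the tilt leaves the weight \<open>exp (- s * (y - t))\<close> on
  \<open>{t<..}\<close>, exactly the test function of \<open>coupled.upper_bound\<close>.\<close>

lemma tail_tilt:
  assumes "s \<le> \<sigma>"
  shows "tail n t = ennreal (Lam s ^ n * exp (- s * t)) *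
     (shift_op (tilt s) \<xi> ^^ n) (\<lambda>y. ennreal (indicator {t<..} y * exp (- s * (y - t)))) 0"
proof -
  note s = s_dom[OF assms]
  let ?h = "\<lambda>y. ennreal (indicator {t<..} y * exp (- s * (y - t)))"
  have "ennreal (exp (- s * t)) * (ennreal (exp (s * y)) * ?h y) = indicator {t<..} y" for y
    by (simp add: indicator_def algebra_simps flip: ennreal_mult exp_add)
  hence "tail n t = (shift_op M \<xi> ^^ n) (\<lambda>y. ennreal (exp (- s * t)) * (ennreal (exp (s * y)) * ?h y)) 0"
    by (simp add: tail_def)
  also have "\<dots> = ennreal (exp (- s * t)) * (shift_op M \<xi> ^^ n) (\<lambda>y. ennreal (exp (s * y)) * ?h y) 0"
    by (subst pos_lin_cmult[OF pos_lin_funpow[OF T_pos_lin]]) auto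
  also have "(shift_op M \<xi> ^^ n) (\<lambda>y. ennreal (exp (s * y)) * ?h y) 0 = ennreal (Lam s ^ n) * (shift_op (tilt s) \<xi> ^^ n) ?h 0"
    by (subst funpow_tilt[OF s]) auto
  finally show ?thesis using Lam_pos[OF s]
    by (simp add: ennreal_mult mult_ac)
qed

lemma tail_upper:
  assumes s: "0 < s" "s \<le> \<sigma>" and n: "n \<ge> 1"
  shows "tail n t \<le> ennreal (Lam s ^ n * exp (- s * t) * (exp (\<sigma> * D) / \<delta> / (s * sqrt n)))"
proof -
  interpret C: coupled "tilt s \<Otimes>\<^sub>M tilt s" Y0 Y1 D "2 * C2" \<delta> "shift_op (tilt s) \<xi>"
    by (rule coupled_tilt) (use s in auto)
  have "tail n t \<le> ennreal (Lam s ^ n * exp (- s * t)) * ennreal (exp (s * D) / \<delta> / (s * sqrt n))"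
    unfolding tail_tilt[OF s(2)] by (intro mult_left_mono C.upper_bound s n) auto
  also have "\<dots> = ennreal (Lam s ^ n * exp (- s * t) * (exp (s * D) / \<delta> / (s * sqrt n)))"
    using Lam_pos[OF s_dom[OF s(2)]] \<delta>_pos s by (simp flip: ennreal_mult)
  also have "\<dots> \<le> ennreal (Lam s ^ n * exp (- s * t) * (exp (\<sigma> * D) / \<delta> / (s * sqrt n)))"
    using Lam_pos[OF s_dom[OF s(2)]] \<delta>_pos s C.D
    by (intro ennreal_leI mult_left_mono divide_right_mono) (auto intro: mult_right_mono)
  finally show ?thesis .
qed

text \<open>The level \<open>n * mean s\<close> is the mean of the tilted walk, so the window
  estimate applies, and on the window the remaining weight is at least
  \<open>exp (- \<sigma> * D)\<close>. Without a tilt the whole half-line counts and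
  \<open>1 / sqrt n\<close> disappears.\<close>

lemma tail_lower:
  "\<exists>c>0. \<exists>n0. (\<forall>n\<ge>n0. \<forall>s. 0 \<le> s \<longrightarrow> s \<le> \<sigma> \<longrightarrow>
      ennreal (Lam s ^ n * exp (- s * (n * mean s)) * (c / sqrt n)) \<le> tail n (n * mean s)) \<and>
    (\<forall>n\<ge>n0. ennreal c \<le> tail n (n * mean 0))"
proof -
  \<comment> \<open>Makes \<open>16 * (2 * C2) \<le> R^2 * \<delta>^2\<close>, where
    \<open>2 * C2\<close> plays the part of \<open>V\<close>.\<close>
  define R where "R = max 1 (sqrt (32 * C2 / \<delta>\<^sup>2))"
  have C2: "C2 \<ge> 0" unfolding C2_def by (intro integral_nonneg_AE) auto
  have R1: "R \<ge> 1" by (simp add: R_def)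
  have R2: "16 * (2 * C2) \<le> R\<^sup>2 * \<delta>\<^sup>2"
  proof -
    have "(sqrt (32 * C2 / \<delta>\<^sup>2))\<^sup>2 \<le> R\<^sup>2" unfolding R_def using C2 by (intro power_mono) auto
    hence "32 * C2 / \<delta>\<^sup>2 \<le> R\<^sup>2" using C2 by simp
    thus ?thesis using \<delta>_pos by (simp add: divide_le_eq)
  qed
  obtain c n0 where c: "c > 0" and bin: "\<And>n k. n \<ge> n0 \<Longrightarrow>
      \<bar>real k - real (n div 2)\<bar> \<le> 4 * R * sqrt n \<Longrightarrow> c / sqrt n \<le> real (n choose k) / 2 ^ n"
    using binomial_lower[of "4 * R"] R1 by auto
  define n1 where "n1 = max n0 (nat \<lceil>64 * R\<^sup>2\<rceil>)"
  have n1: "real n \<ge> 64 * R\<^sup>2" "n \<ge> n0" if "n \<ge> n1" for n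
    using that unfolding n1_def by linarith+
  define c' where "c' = c / 2 * exp (- \<sigma> * D)"
  have D0: "D \<ge> 0" using aa' by simp
  have c': "c' > 0" "c' \<le> c / 2" using c D0 \<sigma> by (auto simp: c'_def mult_left_le)
  have "ennreal (Lam s ^ n * exp (- s * (n * mean s)) * (c' / sqrt n)) \<le> tail n (n * mean s)"
    if n: "n \<ge> n1" and s: "0 \<le> s" "s \<le> \<sigma>" for n s
  proof -
    interpret C: coupled "tilt s \<Otimes>\<^sub>M tilt s" Y0 Y1 D "2 * C2" \<delta> "shift_op (tilt s) \<xi>"
      by (rule coupled_tilt) (use s in auto)
    define t where "t = n * mean s"
    have t: "2 * t = n * (C.M0 + C.M1)"
      unfolding C.M0_def C.M1_def using coupled_tilt(2)[OF s] by (simp add: t_def)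
    have L: "Lam s > 0" by (intro Lam_pos s_dom s)
    have "ennreal (c' / sqrt n) \<le> ennreal (exp (- s * D)) * ennreal (c / (2 * sqrt n))"
      unfolding c'_def using c D0 s
      by (subst ennreal_mult[symmetric]) (auto intro!: ennreal_leI mult_right_mono mult_left_mono divide_right_mono simp: mult_ac)
    also have "\<dots> \<le> ennreal (exp (- s * D)) * (shift_op (tilt s) \<xi> ^^ n) (indicator {t<..t+D}) 0"
      by (intro mult_left_mono C.local_lower_bounds(1)[OF R1 R2 c n1(1)[OF n] bin[OF n1(2)[OF n]] t]) auto
    also have "\<dots> = (shift_op (tilt s) \<xi> ^^ n) (\<lambda>y. ennreal (exp (- s * D)) * indicator {t<..t+D} y) 0"
      by (subst pos_lin_cmult[OF pos_lin_funpow[OF C.A]]) auto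
    also have "\<dots> \<le> (shift_op (tilt s) \<xi> ^^ n) (\<lambda>y. ennreal (indicator {t<..} y * exp (- s * (y - t)))) 0"
    proof (rule pos_lin_mono[OF pos_lin_funpow[OF C.A]])
      fix y
      have "exp (- s * D) \<le> exp (- s * (y - t))" if "y \<le> t + D" using that s by (auto intro: mult_left_mono)
      thus "ennreal (exp (- s * D)) * indicator {t<..t+D} y \<le> ennreal (indicator {t<..} y * exp (- s * (y - t)))"
        by (auto simp: indicator_def intro!: ennreal_leI)
    qed auto
    finally have "ennreal (Lam s ^ n * exp (- s * t)) * ennreal (c' / sqrt n) \<le> tail n t"
      unfolding tail_tilt[OF s(2)] by (intro mult_left_mono) auto
    thus ?thesis using L c' by (simp add: t_def flip: ennreal_mult)
  qed
  moreover have "ennreal c' \<le> tail n (n * mean 0)" if n: "n \<ge> n1" for n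
  proof -
    interpret C: coupled "tilt 0 \<Otimes>\<^sub>M tilt 0" Y0 Y1 D "2 * C2" \<delta> "shift_op (tilt 0) \<xi>"
      by (rule coupled_tilt) (use \<sigma> in auto)
    define t where "t = n * mean 0"
    have t: "2 * t = n * (C.M0 + C.M1)"
      unfolding C.M0_def C.M1_def using coupled_tilt(2)[of 0] \<sigma> by (simp add: t_def)
    have "ennreal c' \<le> ennreal (c / 2)" using c' by (intro ennreal_leI)
    also have "\<dots> \<le> (shift_op (tilt 0) \<xi> ^^ n) (indicator {t<..}) 0"
      by (rule C.local_lower_bounds(2)[OF R1 R2 c n1(1)[OF n] bin[OF n1(2)[OF n]] t])
    also have "\<dots> = tail n t"
      using tail_tilt[of 0 n t] \<sigma> by (simp add: Lam_0 ennreal_indicator)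
    finally show ?thesis by (simp add: t_def)
  qed
  ultimately show ?thesis using c'(1) by (intro exI[of _ c'] conjI exI[of _ n1]) auto
qed

end

section \<open>The rate function and truncation\<close>

context nonneg_rv
begin

text \<open>Each term is affine in \<open>y\<close>, and nonincreasing because
  \<open>Lam s \<ge> 1\<close> for \<open>s \<ge> 0\<close>. That negative exponents do not change
  the supremum is shown in \<open>rate_fun_eq\<close>, for \<open>y\<close> up to the reciprocal of
  the mean.\<close>

definition rate :: "real \<Rightarrow> real" where
  "rate y = (SUP s\<in>{s \<in> dom. 0 \<le> s}. s - y * ln (Lam s))"

definition q :: "nat \<Rightarrow> real \<Rightarrow> real" where "q n t = enn2real (tail n t)"

lemma tail_le_1: "tail n t \<le> 1"
proof -
  have "tail n t \<le> (shift_op M \<xi> ^^ n) (\<lambda>_. 1) 0" unfolding tail_def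
    by (rule pos_lin_mono[OF pos_lin_funpow[OF T_pos_lin]]) (auto simp: indicator_def)
  thus ?thesis by (simp add: pos_lin_one[OF pos_lin_funpow[OF T_pos_lin]])
qed

lemma tail_q: "tail n t = ennreal (q n t)"
  unfolding q_def using order.strict_trans1[OF tail_le_1[of n t], of top] by (simp add: less_top)

lemma q_nonneg: "0 \<le> q n t" by (simp add: q_def)

lemma q_le_1: "q n t \<le> 1"
  using tail_le_1[of n t] by (simp add: tail_q)

text \<open>Restricting the expectation to \<open>\<xi> > 1 / y\<close> gives
  \<open>Lam s \<ge> exp (s / y) * P(\<xi> > 1 / y)\<close>. The resulting bound is free of
  \<open>s\<close>, which makes the supremum finite.\<close>

lemma rate_upper:
  assumes y: "y > 0" and s: "s \<in> dom" "0 \<le> s"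
    and pos: "measure M {\<omega> \<in> space M. 1 / y < \<xi> \<omega>} > 0"
  shows "s - y * ln (Lam s) \<le> - y * ln (measure M {\<omega> \<in> space M. 1 / y < \<xi> \<omega>})"
proof -
  let ?A = "{\<omega> \<in> space M. 1 / y < \<xi> \<omega>}"
  have "exp (s / y) * measure M ?A = (\<integral>\<omega>. exp (s / y) * indicator ?A \<omega> \<partial>M)" by simp
  also have "\<dots> \<le> Lam s" unfolding Lam_def
  proof (rule integral_mono)
    fix \<omega>
    show "exp (s / y) * indicator ?A \<omega> \<le> exp (s * \<xi> \<omega>)"
      using s(2) mult_left_mono[of "1 / y" "\<xi> \<omega>" s] by (auto simp: indicator_def)
  qed (use s in \<open>auto simp: dom_def intro!: integrable_mult_right integrable_real_indicator simp: emeasure_eq_measure\<close>)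
  finally have "ln (exp (s / y) * measure M ?A) \<le> ln (Lam s)"
    using pos Lam_pos[OF s(1)] by (subst ln_le_cancel_iff) auto
  hence "s / y + ln (measure M ?A) \<le> ln (Lam s)" using pos by (simp add: ln_mult)
  hence "y * (s / y + ln (measure M ?A)) \<le> y * ln (Lam s)" using y by (intro mult_left_mono) auto
  thus ?thesis using y by (simp add: distrib_left)
qed

lemma rate_bdd:
  assumes "y > 0" "measure M {\<omega> \<in> space M. 1 / y < \<xi> \<omega>} > 0"
  shows "bdd_above ((\<lambda>s. s - y * ln (Lam s)) ` {s \<in> dom. 0 \<le> s})"
  using rate_upper[OF assms(1) _ _ assms(2)] by (intro bdd_aboveI2) auto

lemma rate_ge:
  assumes "y > 0" "measure M {\<omega> \<in> space M. 1 / y < \<xi> \<omega>} > 0" "s \<in> dom" "0 \<le> s"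
  shows "s - y * ln (Lam s) \<le> rate y"
  unfolding rate_def by (rule cSUP_upper[OF _ rate_bdd]) (use assms in auto)

lemma rate_least:
  assumes "\<And>s. s \<in> dom \<Longrightarrow> 0 \<le> s \<Longrightarrow> s - y * ln (Lam s) \<le> c"
  shows "rate y \<le> c"
  unfolding rate_def by (rule cSUP_least) (use assms zero_dom in auto)

lemma rate_nonneg:
  assumes "y > 0" "measure M {\<omega> \<in> space M. 1 / y < \<xi> \<omega>} > 0"
  shows "0 \<le> rate y"
  using rate_ge[OF assms zero_dom] by (simp add: Lam_0)

lemma rate_antimono:
  assumes "x > 0" "measure M {\<omega> \<in> space M. 1 / x < \<xi> \<omega>} > 0" "x \<le> y"
  shows "rate y \<le> rate x"
proof (rule rate_least)
  fix s assume s: "s \<in> dom" "0 \<le> s"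
  have "s - y * ln (Lam s) \<le> s - x * ln (Lam s)"
    using assms Lam_ge_1[OF s] by (auto intro!: mult_right_mono)
  also have "\<dots> \<le> rate x" by (rule rate_ge[OF assms(1,2) s])
  finally show "s - y * ln (Lam s) \<le> rate x" .
qed

text \<open>Chernoff's bound optimised over \<open>s\<close>; \<open>t * rate (n / t)\<close> is
  \<open>n * I (t / n)\<close>.\<close>

lemma chernoff_rate:
  assumes t: "t > 0" and q: "q n t > 0"
  shows "t * rate (n / t) \<le> - ln (q n t)"
proof -
  have "rate (n / t) \<le> - ln (q n t) / t"
  proof (rule rate_least)
    fix s assume s: "s \<in> dom" "0 \<le> s"
    have L: "Lam s > 0" by (rule Lam_pos[OF s(1)])
    have "q n t \<le> Lam s ^ n * exp (- s * t)"
      using chernoff[OF s, of n t] L by (simp add: tail_q)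
    hence "ln (q n t) \<le> ln (Lam s ^ n * exp (- s * t))"
      using q L by (subst ln_le_cancel_iff) auto
    also have "\<dots> = n * ln (Lam s) - s * t" using L by (simp add: ln_mult ln_realpow)
    finally have "(s * t - n * ln (Lam s)) / t \<le> - ln (q n t) / t"
      using t by (intro divide_right_mono) auto
    thus "s - n / t * ln (Lam s) \<le> - ln (q n t) / t"
      using t by (simp add: diff_divide_distrib)
  qed
  thus ?thesis using t by (simp add: field_simps)
qed

end

context tilt_rv
begin

text \<open>Jensen's inequality under \<open>tilt s\<close>, through
  \<open>1 + z \<le> exp z\<close>: it gives
  \<open>Lam u \<ge> exp ((u - s) * mean s) * Lam s\<close>, the tangent bound for
  \<open>ln Lam\<close> at \<open>s\<close>.\<close>

lemma rate_attained:
  assumes s: "0 \<le> s" "s \<le> \<sigma>" and x: "mean s = 1 / y" and y: "y > 0"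
  shows "rate y = s - y * ln (Lam s)"
proof -
  have *: "u - y * ln (Lam u) \<le> s - y * ln (Lam s)" if u: "u \<in> dom" for u
  proof -
    define x where "x = mean s"
    have L: "Lam s > 0" "Lam u > 0" using u s_dom[OF s(2)] by (auto intro: Lam_pos)
    have num: "(\<integral>\<omega>. \<xi> \<omega> * exp (s * \<xi> \<omega>) \<partial>M) = x * Lam s" using L by (simp add: x_def mean_def)
    note i0 = s_dom[OF s(2), unfolded dom_def mem_Collect_eq] and i1 = int_1s[OF s(2)]
    have e: "exp ((u - s) * x) * (exp (s * \<xi> \<omega>) + (u - s) * (\<xi> \<omega> * exp (s * \<xi> \<omega>) - x * exp (s * \<xi> \<omega>)))
        = exp ((u - s) * x + s * \<xi> \<omega>) * (1 + (u - s) * (\<xi> \<omega> - x))" for \<omega>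
    proof -
      have "A * (B + c * (z * B - x * B)) = A * B * (1 + c * (z - x))" for A B c z :: real
        by (simp add: algebra_simps)
      thus ?thesis by (simp only: exp_add)
    qed
    have "exp ((u - s) * x) * Lam s = exp ((u - s) * x) * (Lam s + (u - s) * ((\<integral>\<omega>. \<xi> \<omega> * exp (s * \<xi> \<omega>) \<partial>M) - x * Lam s))"
      by (simp add: num)
    also have "\<dots> = (\<integral>\<omega>. exp ((u - s) * x) * (exp (s * \<xi> \<omega>) + (u - s) * (\<xi> \<omega> * exp (s * \<xi> \<omega>) - x * exp (s * \<xi> \<omega>))) \<partial>M)"
      using i0 i1 by (simp add: Lam_def)
    also have "\<dots> \<le> Lam u" unfolding Lam_def
    proof (rule integral_mono)
      fix \<omega>
      have "exp ((u - s) * x + s * \<xi> \<omega>) * (1 + (u - s) * (\<xi> \<omega> - x)) \<le> exp ((u - s) * x + s * \<xi> \<omega>) * exp ((u - s) * (\<xi> \<omega> - x))"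
        by (intro mult_left_mono exp_ge_add_one_self) auto
      also have "\<dots> = exp (u * \<xi> \<omega>)" by (simp add: algebra_simps flip: exp_add)
      finally show "exp ((u - s) * x) * (exp (s * \<xi> \<omega>) + (u - s) * (\<xi> \<omega> * exp (s * \<xi> \<omega>) - x * exp (s * \<xi> \<omega>))) \<le> exp (u * \<xi> \<omega>)"
        unfolding e .
    qed (use i0 i1 u in \<open>auto simp: dom_def\<close>)
    finally have "ln (exp ((u - s) * x) * Lam s) \<le> ln (Lam u)" using L by (subst ln_le_cancel_iff) auto
    hence "(u - s) * x + ln (Lam s) \<le> ln (Lam u)" using L by (simp add: ln_mult)
    hence "y * ((u - s) * x + ln (Lam s)) \<le> y * ln (Lam u)" using y by (intro mult_left_mono) auto
    moreover have "y * x = 1" using assms(3) y by (simp add: x_def)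
    hence "y * ((u - s) * x) = u - s" by (simp add: mult.left_commute)
    ultimately show ?thesis by (simp add: distrib_left)
  qed
  show ?thesis
  proof (rule antisym)
    show "rate y \<le> s - y * ln (Lam s)" by (rule rate_least) (use * in auto)
    show "s - y * ln (Lam s) \<le> rate y" unfolding rate_def
      by (rule cSUP_upper) (use s s_dom * in \<open>auto intro!: bdd_aboveI2\<close>)
  qed
qed

lemma q_lower:
  "\<exists>c>0. \<exists>n0. (\<forall>n\<ge>n0. \<forall>t>0. mean 0 \<le> t / n \<longrightarrow> t / n \<le> mean \<sigma> \<longrightarrow>
      exp (- t * rate (n / t)) * (c / sqrt n) \<le> q n t) \<and> (\<forall>n\<ge>n0. \<forall>t. t \<le> n * mean 0 \<longrightarrow> c \<le> q n t)"
proof -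
  obtain c n0 where c: "c > 0"
    and 1: "\<And>n s. n \<ge> n0 \<Longrightarrow> 0 \<le> s \<Longrightarrow> s \<le> \<sigma> \<Longrightarrow>
      ennreal (Lam s ^ n * exp (- s * (n * mean s)) * (c / sqrt n)) \<le> tail n (n * mean s)"
    and 2: "\<And>n. n \<ge> n0 \<Longrightarrow> ennreal c \<le> tail n (n * mean 0)"
    using tail_lower by metis
  \<comment> \<open>\<open>Suc n0\<close> excludes \<open>n = 0\<close>, where \<open>t / n\<close>
    would be the default value 0.\<close>
  have "exp (- t * rate (n / t)) * (c / sqrt n) \<le> q n t"
    if n: "n \<ge> Suc n0" and t: "t > 0" and x: "mean 0 \<le> t / n" "t / n \<le> mean \<sigma>" for n t
  proof -
    obtain s where s: "0 \<le> s" "s \<le> \<sigma>" "mean s = t / n" using mean_IVT[OF x] by auto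
    have L: "Lam s > 0" using s by (intro Lam_pos s_dom)
    have n0: "n > 0" using n by simp
    have r: "rate (n / t) = s - n / t * ln (Lam s)"
      by (rule rate_attained) (use s t n in auto)
    have "exp (- t * rate (n / t)) = exp (n * ln (Lam s)) * exp (- s * t)"
      unfolding r using t by (simp add: algebra_simps flip: exp_add)
    also have "exp (n * ln (Lam s)) = Lam s ^ n" using L by (simp add: exp_of_nat_mult)
    finally show ?thesis
      using 1[of n s] s n n0 by (simp add: tail_q q_nonneg)
  qed
  moreover have "c \<le> q n t" if "n \<ge> Suc n0" "t \<le> n * mean 0" for n t
  proof -
    have "ennreal c \<le> tail n (n * mean 0)" using 2[of n] that by simp
    also have "\<dots> \<le> tail n t" unfolding tail_def
      by (rule pos_lin_mono[OF pos_lin_funpow[OF T_pos_lin]]) (use that in \<open>auto simp: indicator_def\<close>)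
    finally show ?thesis by (simp add: tail_q q_nonneg)
  qed
  ultimately show ?thesis using c by (intro exI[of _ c] conjI exI[of _ "Suc n0"]) auto
qed

text \<open>The factor \<open>1 / s\<close> from \<open>tail_upper\<close> becomes
  \<open>1 / (t / n - mean 0)\<close> by \<open>mean_growth\<close>. It blows up as
  \<open>t / n\<close> approaches the mean, hence the strict inequality.\<close>

lemma q_upper:
  "\<exists>C>0. \<forall>n\<ge>1. \<forall>t>0. mean 0 < t / n \<longrightarrow> t / n \<le> mean \<sigma> \<longrightarrow>
      q n t \<le> exp (- t * rate (n / t)) * (C / ((t / n - mean 0) * sqrt n))"
proof (intro exI conjI allI impI)
  define C where "C = exp (\<sigma> * D) / \<delta> * (C2 + 1)"
  have C2: "C2 \<ge> 0" unfolding C2_def by (intro integral_nonneg_AE) auto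
  show "exp (\<sigma> * D) / \<delta> * (C2 + 1) > 0" using C2 \<delta>_pos by (auto intro!: mult_pos_pos divide_pos_pos)
  fix n :: nat and t :: real
  assume n: "n \<ge> 1" and t: "t > 0" and x: "mean 0 < t / n" "t / n \<le> mean \<sigma>"
  obtain s where s: "0 \<le> s" "s \<le> \<sigma>" "mean s = t / n" using mean_IVT[of "t / n"] x by auto
  have s0: "s > 0" using s x by (cases "s = 0") auto
  have L: "Lam s > 0" using s by (intro Lam_pos s_dom)
  have r: "rate (n / t) = s - n / t * ln (Lam s)"
    by (rule rate_attained) (use s t n in auto)
  have "exp (- t * rate (n / t)) = exp (n * ln (Lam s)) * exp (- s * t)"
    unfolding r using t by (simp add: algebra_simps flip: exp_add)
  also have "exp (n * ln (Lam s)) = Lam s ^ n" using L by (simp add: exp_of_nat_mult)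
  finally have "q n t \<le> exp (- t * rate (n / t)) * (exp (\<sigma> * D) / \<delta> / (s * sqrt n))"
    using tail_upper[OF s0 s(2) n, of t] s0 \<delta>_pos L n by (simp add: tail_q)
  also have "exp (\<sigma> * D) / \<delta> / (s * sqrt n) \<le> exp (\<sigma> * D) / \<delta> * (C2 + 1) / ((t / n - mean 0) * sqrt n)"
  proof -
    have "t / n - mean 0 \<le> s * (C2 + 1)" using mean_growth[OF s(1,2)] s by (simp add: distrib_left)
    hence "1 / s \<le> (C2 + 1) / (t / n - mean 0)" using s0 x by (simp add: field_simps)
    hence "exp (\<sigma> * D) / \<delta> / sqrt n * (1 / s) \<le> exp (\<sigma> * D) / \<delta> / sqrt n * ((C2 + 1) / (t / n - mean 0))"
      using \<delta>_pos by (intro mult_left_mono) auto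
    thus ?thesis by (simp add: mult_ac)
  qed
  finally show "q n t \<le> exp (- t * rate (n / t)) * (exp (\<sigma> * D) / \<delta> * (C2 + 1) / ((t / n - mean 0) * sqrt n))"
    by (simp add: mult_left_mono)
qed

end

text \<open>Rate functions are only compared on \<open>y\<close> with \<open>P(\<xi> > 1/y) > 0\<close>; elsewhere the supremum defining
  \<open>rate y\<close> may be infinite and its value is junk.\<close>

locale unbounded_rv = nonneg_rv +
  assumes unb: "\<And>x. measure M {\<omega> \<in> space M. x < \<xi> \<omega>} > 0"
begin

definition trunc :: "nat \<Rightarrow> 'a \<Rightarrow> real" where "trunc L \<omega> = min (\<xi> \<omega>) L"

sublocale tr: nonneg_rv M "trunc L" for L
proof
  show "trunc L \<in> borel_measurable M" unfolding trunc_def[abs_def] by measurable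
  show "AE \<omega> in M. 0 \<le> trunc L \<omega>" using \<xi>_nonneg by eventually_elim (simp add: trunc_def)
qed

lemma trunc_mass: "x < real L \<Longrightarrow> measure M {\<omega> \<in> space M. x < trunc L \<omega>} > 0"
  using unb[of x] by (simp add: trunc_def cong: conj_cong)

lemma trunc_dom: "s \<ge> 0 \<Longrightarrow> s \<in> tr.dom L"
  unfolding tr.dom_def mem_Collect_eq
proof (rule integrable_const_bound)
  show "AE \<omega> in M. norm (exp (s * trunc L \<omega>)) \<le> exp (s * L)" if "s \<ge> 0"
    using that by (auto simp: trunc_def intro!: mult_left_mono)
qed auto

lemma trunc_Lam_mono:
  assumes "s \<ge> 0" "L \<le> L'"
  shows "tr.Lam L s \<le> tr.Lam L' s"
  unfolding tr.Lam_def using assms trunc_dom[OF assms(1)]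
  by (intro integral_mono) (auto simp: tr.dom_def trunc_def min_def intro!: mult_left_mono)

lemma trunc_Lam_le:
  assumes "s \<ge> 0" "s \<in> dom"
  shows "tr.Lam L s \<le> Lam s"
  unfolding tr.Lam_def Lam_def using assms trunc_dom[OF assms(1)]
  by (intro integral_mono) (auto simp: tr.dom_def dom_def trunc_def intro!: mult_left_mono)

lemma trunc_rate_ge:
  assumes "y > 0" "1 / y < real L"
  shows "rate y \<le> tr.rate L y"
proof (rule rate_least)
  fix s assume s: "s \<in> dom" "0 \<le> s"
  have "ln (tr.Lam L s) \<le> ln (Lam s)"
    using trunc_Lam_le[OF s(2,1)] tr.Lam_pos[OF trunc_dom[OF s(2)]] Lam_pos[OF s(1)] by simp
  hence "s - y * ln (Lam s) \<le> s - y * ln (tr.Lam L s)" using assms by (auto intro!: mult_left_mono)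
  also have "\<dots> \<le> tr.rate L y"
    by (rule tr.rate_ge) (use assms s trunc_dom trunc_mass in auto)
  finally show "s - y * ln (Lam s) \<le> tr.rate L y" .
qed

text \<open>Truncation shortens every step. The comparison moves the starting point, so the iterates
  of the indicator must also be known to be increasing.\<close>

lemma trunc_q_le: "tr.q L n t \<le> q n t"
proof -
  have mono: "mono ((shift_op M (trunc L) ^^ n) (indicator {t<..}))" for n
  proof (induction n)
    case (Suc n)
    thus ?case by (auto simp: mono_def shift_op_def intro!: nn_integral_mono)
  qed (auto simp: mono_def indicator_def)
  have "(shift_op M (trunc L) ^^ n) (indicator {t<..}) x \<le> (shift_op M \<xi> ^^ n) (indicator {t<..}) x" for x
  proof (induction n arbitrary: x)
    case (Suc n)
    have "(shift_op M (trunc L) ^^ n) (indicator {t<..}) (x + trunc L \<omega>) \<le> (shift_op M \<xi> ^^ n) (indicator {t<..}) (x + \<xi> \<omega>)" for \<omega>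
      by (rule order_trans[OF monoD[OF mono] Suc]) (simp add: trunc_def)
    thus ?case
      unfolding funpow.simps o_def
        shift_op_def[of M "trunc L" "(shift_op M (trunc L) ^^ n) (indicator {t<..})"]
        shift_op_def[of M \<xi> "(shift_op M \<xi> ^^ n) (indicator {t<..})"]
      by (intro nn_integral_mono)
  qed simp
  hence "tr.tail L n t \<le> tail n t" by (simp add: tail_def tr.tail_def)
  thus ?thesis by (simp add: tail_q tr.tail_q q_nonneg)
qed

lemma exists_mass: "\<exists>a\<ge>0. measure M {\<omega> \<in> space M. \<xi> \<omega> \<le> a} > 0"
proof -
  have "(\<lambda>n. measure M {\<omega> \<in> space M. \<xi> \<omega> \<le> real n}) \<longlonglongrightarrow> measure M (\<Union>n. {\<omega> \<in> space M. \<xi> \<omega> \<le> real n})"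
    by (rule finite_Lim_measure_incseq) (auto simp: incseq_def)
  also have "(\<Union>n. {\<omega> \<in> space M. \<xi> \<omega> \<le> real n}) = space M" using real_arch_simple by auto
  finally have "(\<lambda>n. measure M {\<omega> \<in> space M. \<xi> \<omega> \<le> real n}) \<longlonglongrightarrow> 1" by (simp add: prob_space)
  hence "eventually (\<lambda>n. measure M {\<omega> \<in> space M. \<xi> \<omega> \<le> real n} > 0) sequentially"
    by (rule order_tendstoD) simp
  then obtain n where "measure M {\<omega> \<in> space M. \<xi> \<omega> \<le> real n} > 0" by (auto simp: eventually_sequentially)
  thus ?thesis by (intro exI[of _ "real n"]) auto
qed

text \<open>A bounded variable has all exponential moments, so every \<open>\<sigma> > 0\<close> is
  admissible, and the lower tail bound becomes available whatever the tilted means of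
  \<open>\<xi>\<close> are.\<close>

lemma tilt_rv_trunc:
  "\<exists>L0. \<forall>L\<ge>L0. \<exists>a. \<forall>\<sigma>>0. tilt_rv M (trunc L) \<sigma> a (a + 1) L"
proof -
  obtain a where a: "a \<ge> 0" "measure M {\<omega> \<in> space M. \<xi> \<omega> \<le> a} > 0" using exists_mass by auto
  have "tilt_rv M (trunc L) \<sigma> a (a + 1) L" if L: "L \<ge> nat \<lceil>a\<rceil> + 2" and \<sigma>: "\<sigma> > 0" for L \<sigma>
  proof
    have aL: "a + 1 < real L" using L by linarith
    show "0 < \<sigma>" "0 \<le> a" "a < a + 1" "a + 1 \<le> real L" using \<sigma> a aL by auto
    show "integrable M (\<lambda>\<omega>. (trunc L \<omega>)\<^sup>2 * exp (\<sigma> * trunc L \<omega>))"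
    proof (rule integrable_const_bound[where B = "(real L)\<^sup>2 * exp (\<sigma> * L)"])
      show "AE \<omega> in M. norm ((trunc L \<omega>)\<^sup>2 * exp (\<sigma> * trunc L \<omega>)) \<le> (real L)\<^sup>2 * exp (\<sigma> * L)"
        using tr.\<xi>_nonneg[of L] by eventually_elim
          (use \<sigma> in \<open>auto simp: trunc_def intro!: mult_mono power_mono mult_left_mono\<close>)
    qed auto
    show "0 < measure M {\<omega> \<in> space M. trunc L \<omega> \<le> a}"
      using a aL by (simp add: trunc_def min_le_iff_disj)
    have "measure M {\<omega> \<in> space M. a + 1 < \<xi> \<omega>} \<le> measure M {\<omega> \<in> space M. a + 1 \<le> trunc L \<omega> \<and> trunc L \<omega> \<le> L}"
      using aL by (intro finite_measure_mono) (auto simp: trunc_def)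
    thus "0 < measure M {\<omega> \<in> space M. a + 1 \<le> trunc L \<omega> \<and> trunc L \<omega> \<le> real L}"
      using unb[of "a + 1"] by linarith
  qed
  thus ?thesis by blast
qed

text \<open>A violation of the limit yields nested nonempty compact sets of exponents; a common point of all
  of them has a finite moment generating function by monotone convergence and beats \<open>rate y\<close>.\<close>

lemma trunc_rate_tendsto:
  assumes y: "y > 0"
  shows "(\<lambda>L. tr.rate L y) \<longlonglongrightarrow> rate y"
proof (rule order_tendstoI)
  fix v assume "v < rate y"
  moreover have "eventually (\<lambda>L. 1 / y < real L) sequentially" by real_asymp
  ultimately show "eventually (\<lambda>L. v < tr.rate L y) sequentially"
    using trunc_rate_ge[OF y] by (auto elim!: eventually_mono) (meson less_le_trans)
next
  fix v' assume "rate y < v'"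
  then obtain v where v: "rate y < v" "v < v'" using dense by blast
  obtain L0 where L0: "\<And>L. L \<ge> L0 \<Longrightarrow> \<exists>a. \<forall>\<sigma>>0. tilt_rv M (trunc L) \<sigma> a (a + 1) L"
    using tilt_rv_trunc by auto
  define \<pi> where "\<pi> = measure M {\<omega> \<in> space M. 2 / y < \<xi> \<omega>}"
  have \<pi>: "\<pi> > 0" unfolding \<pi>_def by (rule unb)
  define C where "C = max 1 (- y * ln \<pi>)"
  \<comment> \<open>From \<open>L1\<close> on, truncation does not affect the event
    \<open>2 / y < \<xi>\<close>.\<close>
  define L1 where "L1 = max L0 (nat \<lceil>2 / y\<rceil> + 1)"
  define S where "S L = {s \<in> {0..C}. v \<le> s - y * ln (tr.Lam (L1 + L) s)}" for L
  have v0: "v > 0" using v rate_nonneg[OF y unb] by simp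
  \<comment> \<open>Confines the exponents to \<open>{0..C}\<close>: \<open>rate_upper\<close> at
    \<open>y / 2\<close>, doubled, reads \<open>2 * s - y * ln Lam \<le> - y * ln \<pi>\<close> for
    the truncated \<open>Lam\<close>, and subtracting \<open>0 < v \<le> s - y * ln Lam\<close>
    leaves \<open>s \<le> - y * ln \<pi>\<close>.\<close>
  have in_S: "s \<in> S L" if "s \<ge> 0" "v \<le> s - y * ln (tr.Lam (L1 + L) s)" for s L
  proof -
    have L: "2 / y < real (L1 + L)" unfolding L1_def by linarith
    have eq: "{\<omega> \<in> space M. 2 / y < trunc (L1 + L) \<omega>} = {\<omega> \<in> space M. 2 / y < \<xi> \<omega>}"
      using L by (auto simp: trunc_def)
    have "s - y / 2 * ln (tr.Lam (L1 + L) s) \<le> - (y / 2) * ln \<pi>"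
      using tr.rate_upper[of "y / 2" s "L1 + L"] that trunc_dom \<pi> y by (simp add: eq \<pi>_def del: of_nat_add)
    hence "2 * s - y * ln (tr.Lam (L1 + L) s) \<le> - y * ln \<pi>" by simp
    with that v0 have "s \<le> - y * ln \<pi>" by linarith
    hence "s \<le> C" unfolding C_def by simp
    with that show ?thesis by (simp add: S_def)
  qed
  have "\<exists>L. S L = {}"
  proof (rule ccontr)
    assume "\<not> (\<exists>L. S L = {})"
    hence ne: "S L \<noteq> {}" for L by auto
    have "\<Inter>(range S) \<noteq> {}"
    proof (rule compact_nest)
      fix L
      have "L0 \<le> L1 + L" "C > 0" by (auto simp: L1_def C_def)
      then obtain a where "tilt_rv M (trunc (L1 + L)) C a (a + 1) (L1 + L)"
        using L0 by blast
      then interpret t: tilt_rv M "trunc (L1 + L)" C a "a + 1" "L1 + L" .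
      have "continuous_on {0..C} (\<lambda>s. s - y * ln (tr.Lam (L1 + L) s))"
        by (intro continuous_intros continuous_on_subset[OF t.continuous_Lam]) (auto dest!: t.s_dom tr.Lam_pos)
      hence "closed (S L)" unfolding S_def
        using continuous_closed_preimage[of "{0..C}" "\<lambda>s. s - y * ln (tr.Lam (L1 + L) s)" "{v..}"]
        by (simp add: vimage_def Int_def)
      moreover have "{0..C} \<inter> S L = S L" by (auto simp: S_def)
      ultimately show "compact (S L)" using compact_Int_closed[OF compact_Icc[of 0 C]] by metis
    next
      fix m n :: nat assume mn: "m \<le> n"
      show "S n \<subseteq> S m"
      proof
        fix s assume s: "s \<in> S n"
        have "ln (tr.Lam (L1 + m) s) \<le> ln (tr.Lam (L1 + n) s)"
          using s mn tr.Lam_pos[OF trunc_dom] trunc_Lam_mono[of s "L1 + m" "L1 + n"] by (simp add: S_def)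
        hence "y * ln (tr.Lam (L1 + m) s) \<le> y * ln (tr.Lam (L1 + n) s)" using y by simp
        with s show "s \<in> S m" by (simp add: S_def)
      qed
    qed (rule ne)
    then obtain s where s: "\<And>L. s \<in> S L" by auto
    hence s0: "0 \<le> s" by (simp add: S_def)
    define c where "c = exp ((s - v) / y)"
    have Lc: "tr.Lam (L1 + L) s \<le> c" for L
    proof -
      have "y * ln (tr.Lam (L1 + L) s) \<le> s - v" using s[of L] by (simp add: S_def)
      hence "ln (tr.Lam (L1 + L) s) \<le> (s - v) / y" using y by (simp add: field_simps)
      hence "exp (ln (tr.Lam (L1 + L) s)) \<le> c" by (simp add: c_def)
      thus ?thesis using tr.Lam_pos[OF trunc_dom[OF s0]] by simp
    qed
    have "(\<integral>\<^sup>+\<omega>. ennreal (exp (s * \<xi> \<omega>)) \<partial>M) \<le> (\<integral>\<^sup>+\<omega>. (SUP L. ennreal (exp (s * trunc (L1 + L) \<omega>))) \<partial>M)"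
    proof (rule nn_integral_mono)
      fix \<omega>
      obtain L where "\<xi> \<omega> \<le> real L" using real_arch_simple by blast
      hence "trunc (L1 + L) \<omega> = \<xi> \<omega>" by (simp add: trunc_def)
      thus "ennreal (exp (s * \<xi> \<omega>)) \<le> (SUP L. ennreal (exp (s * trunc (L1 + L) \<omega>)))"
        by (intro SUP_upper2[of L]) auto
    qed
    also have "\<dots> = (SUP L. \<integral>\<^sup>+\<omega>. ennreal (exp (s * trunc (L1 + L) \<omega>)) \<partial>M)"
      by (rule nn_integral_monotone_convergence_SUP)
         (use s0 in \<open>auto simp: incseq_def le_fun_def trunc_def min_def intro!: ennreal_leI mult_left_mono\<close>)
    also have "\<dots> \<le> ennreal c"
      by (rule SUP_least) (auto simp: tr.Lam_nn[OF trunc_dom[OF s0]] intro!: ennreal_leI Lc)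
    finally have le: "(\<integral>\<^sup>+\<omega>. ennreal (exp (s * \<xi> \<omega>)) \<partial>M) \<le> ennreal c" .
    have sd: "s \<in> dom" unfolding dom_def mem_Collect_eq
      using order.strict_trans1[OF le ennreal_less_top] by (intro integrableI_nonneg) auto
    have "Lam s \<le> c" using le Lam_nn[OF sd] by (simp add: c_def)
    hence "ln (Lam s) \<le> (s - v) / y" 
      using Lam_pos[OF sd] ln_le_cancel_iff[of "Lam s" c] by (simp add: c_def)
    hence "v \<le> s - y * ln (Lam s)" using y by (simp add: field_simps)
    also have "\<dots> \<le> rate y" by (rule rate_ge[OF y unb sd s0])
    finally show False using v by simp
  qed
  then obtain L where SL: "S L = {}" ..
  have "tr.rate L' y < v'" if "L' \<ge> L1 + L" for L'
  proof -
    have "tr.rate L' y \<le> v"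
    proof (rule tr.rate_least)
      fix s assume s: "s \<in> tr.dom L'" "0 \<le> s"
      have "\<not> v \<le> s - y * ln (tr.Lam (L1 + L) s)" using in_S[OF s(2)] SL by auto
      moreover have "ln (tr.Lam (L1 + L) s) \<le> ln (tr.Lam L' s)"
        using s that tr.Lam_pos[OF trunc_dom] trunc_Lam_mono[of s "L1 + L" L'] by simp
      hence "y * ln (tr.Lam (L1 + L) s) \<le> y * ln (tr.Lam L' s)" using y by simp
      ultimately show "s - y * ln (tr.Lam L' s) \<le> v" by linarith
    qed
    thus ?thesis using v by simp
  qed
  thus "eventually (\<lambda>L. tr.rate L y < v') sequentially" by (auto simp: eventually_sequentially)
qed

end

section \<open>Reduction to tails of partial sums\<close>

text \<open>Independence splits off the last summand; \<open>x\<close> is arbitrary so that this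
  summand can be absorbed into the starting point.\<close>

lemma (in prob_space) nn_integral_partial_sum:
  fixes X :: "nat \<Rightarrow> 'a \<Rightarrow> real"
  assumes [measurable]: "\<xi> \<in> borel_measurable M" and ind: "indep_vars (\<lambda>_. borel) X {1..}"
    and dist: "\<And>i. i \<ge> 1 \<Longrightarrow> distr M borel (X i) = distr M borel \<xi>"
    and f: "f \<in> borel_measurable borel"
  shows "(\<integral>\<^sup>+\<omega>. f (x + (\<Sum>i=1..n. X i \<omega>)) \<partial>M) = (shift_op M \<xi> ^^ n) f x"
proof (induction n arbitrary: x)
  case 0
  show ?case by (simp add: emeasure_space_1)
next
  case (Suc n)
  note T = pos_lin_shift_op[OF prob_space_axioms assms(1)]
  note [measurable] = f pos_lin_meas[OF pos_lin_funpow[OF T] f]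
  define S where "S \<omega> = (\<Sum>i=1..n. X i \<omega>)" for \<omega>
  have "indep_vars (\<lambda>_. borel) X (insert (Suc n) {1..n})"
    by (rule indep_vars_subset[OF ind]) auto
  hence iv: "indep_var borel (X (Suc n)) borel S"
    unfolding S_def[abs_def] by (intro indep_vars_sum) auto
  hence [measurable]: "X (Suc n) \<in> borel_measurable M" "S \<in> borel_measurable M"
    and pair: "distr M borel (X (Suc n)) \<Otimes>\<^sub>M distr M borel S = distr M (borel \<Otimes>\<^sub>M borel) (\<lambda>\<omega>. (X (Suc n) \<omega>, S \<omega>))"
    by (auto simp: indep_var_distribution_eq)
  interpret DS: prob_space "distr M borel S" by (rule prob_space_distr) simp
  have "(\<integral>\<^sup>+\<omega>. f (x + (\<Sum>i=1..Suc n. X i \<omega>)) \<partial>M) = (\<integral>\<^sup>+\<omega>. (\<lambda>(a, s). f (x + a + s)) (X (Suc n) \<omega>, S \<omega>) \<partial>M)"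
    by (simp add: S_def add_ac)
  also have "\<dots> = (\<integral>\<^sup>+z. (\<lambda>(a, s). f (x + a + s)) z \<partial>(distr M borel (X (Suc n)) \<Otimes>\<^sub>M distr M borel S))"
    unfolding pair by (subst nn_integral_distr) auto
  also have "\<dots> = (\<integral>\<^sup>+a. \<integral>\<^sup>+s. f (x + a + s) \<partial>distr M borel S \<partial>distr M borel (X (Suc n)))"
    by (subst DS.nn_integral_fst[symmetric]) auto
  also have "\<dots> = (\<integral>\<^sup>+a. (shift_op M \<xi> ^^ n) f (x + a) \<partial>distr M borel (X (Suc n)))"
    using Suc by (intro nn_integral_cong) (simp add: nn_integral_distr S_def)
  also have "distr M borel (X (Suc n)) = distr M borel \<xi>" by (rule dist) simp
  also have "(\<integral>\<^sup>+a. (shift_op M \<xi> ^^ n) f (x + a) \<partial>distr M borel \<xi>) = (shift_op M \<xi> ^^ Suc n) f x"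
    by (simp add: nn_integral_distr shift_op_def[of M \<xi> "(shift_op M \<xi> ^^ n) f"])
  finally show ?case .
qed

lemma (in nonneg_rv) partial_sum_tail:
  assumes "indep_vars (\<lambda>_. borel) X {1..}"
    and "\<And>i. i \<ge> 1 \<Longrightarrow> distr M borel (X i) = distr M borel \<xi>"
    and [measurable]: "S \<in> borel_measurable M"
    and S: "distr M borel S = distr M borel (\<lambda>\<omega>. \<Sum>i=1..n. X i \<omega>)"
  shows "prob {\<omega> \<in> space M. t < S \<omega>} = q n t"
proof -
  have [measurable]: "X i \<in> borel_measurable M" if "i \<in> {1..n}" for i
    using assms(1) that by (auto simp: indep_vars_def2)
  have "emeasure M {\<omega> \<in> space M. t < S \<omega>} = (\<integral>\<^sup>+x. indicator {t<..} x \<partial>distr M borel S)"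
    by (simp add: emeasure_distr vimage_def Int_def conj_commute)
  also have "\<dots> = (\<integral>\<^sup>+\<omega>. indicator {t<..} (\<Sum>i=1..n. X i \<omega>) \<partial>M)"
    unfolding S by (subst nn_integral_distr) auto
  also have "\<dots> = tail n t"
    using nn_integral_partial_sum[OF \<xi>_meas assms(1,2), of "indicator {t<..}" 0 n] by (simp add: tail_def)
  finally show ?thesis by (simp add: tail_q emeasure_eq_measure q_nonneg)
qed

text \<open>The factors increase and are at most 1, so deleting up to \<open>k\<close> of them
  leaves most when the \<open>k\<close> smallest go. If the top index is deleted, the product from
  the induction hypothesis is shifted up by one index.\<close>

lemma prod_removed_le:
  fixes Q :: "nat \<Rightarrow> real"
  assumes "\<And>n. n \<ge> 1 \<Longrightarrow> 0 \<le> Q n \<and> Q n \<le> 1" and mono: "\<And>m n. 1 \<le> m \<Longrightarrow> m \<le> n \<Longrightarrow> Q m \<le> Q n"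
  shows "A \<subseteq> {1..T} \<Longrightarrow> card A \<le> k \<Longrightarrow> (\<Prod>n\<in>{1..T} - A. Q n) \<le> (\<Prod>n\<in>{k<..T}. Q n)"
proof (induction T arbitrary: A k)
  case (Suc T)
  have fin: "finite A" using Suc.prems finite_subset by blast
  show ?case
  proof (cases "k \<ge> Suc T")
    case True
    hence "{k<..Suc T} = {}" by auto
    moreover have "(\<Prod>n\<in>{1..Suc T} - A. Q n) \<le> 1" using assms(1) by (intro prod_le_1) auto
    ultimately show ?thesis by simp
  next
    case False
    hence kT: "{k<..Suc T} = insert (Suc T) {k<..T}" by auto
    show ?thesis
    proof (cases "Suc T \<in> A")
      case False
      hence "{1..Suc T} - A = insert (Suc T) ({1..T} - A)" by auto
      moreover have "A \<subseteq> {1..T}" using Suc.prems False by (auto simp: atLeastAtMostSuc_conv)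
      ultimately show ?thesis using Suc.IH[of A k] Suc.prems assms(1)[of "Suc T"]
        by (simp add: kT mult_left_mono)
    next
      case True
      define A' where "A' = A - {Suc T}"
      have "{1..Suc T} - A = {1..T} - A'" using True by (auto simp: A'_def le_Suc_eq)
      moreover have "A' \<subseteq> {1..T}" using Suc.prems by (auto simp: A'_def le_Suc_eq)
      moreover have "card A' \<le> k - 1" "k \<ge> 1" using Suc.prems True fin
        by (auto simp: A'_def card_gt_0_iff Suc_le_eq intro: order.strict_trans2[of 0 "card A"])
      ultimately have "(\<Prod>n\<in>{1..Suc T} - A. Q n) \<le> (\<Prod>n\<in>{k-1<..T}. Q n)"
        using Suc.IH[of A' "k - 1"] by simp
      also have "\<dots> \<le> (\<Prod>n\<in>{k-1<..T}. Q (Suc n))"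
        using assms(1) mono by (intro prod_mono) auto
      also have "\<dots> = (\<Prod>n\<in>{k<..Suc T}. Q n)"
        using \<open>k \<ge> 1\<close> by (intro prod.reindex_bij_witness[of _ "\<lambda>n. n - 1" Suc]) auto
      finally show ?thesis .
    qed
  qed
qed simp

context prob_space
begin

lemma counting_process_measurable:
  assumes "\<And>n. n \<ge> 1 \<Longrightarrow> Sh n \<in> borel_measurable M"
  shows "counting_process Sh t \<in> borel_measurable M"
proof -
  have [measurable]: "Sh (Suc n) \<in> borel_measurable M" for n using assms by simp
  have "counting_process Sh t = (\<lambda>\<omega>. \<Sum>n. indicator {..t} (Sh (Suc n) \<omega>))"
    by (auto simp: counting_process_def fun_eq_iff indicator_def intro!: suminf_cong)
  thus ?thesis by simp
qed

text \<open>Only the indices up to \<open>T\<close> outside \<open>A\<close> are constrained, namely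
  to exceed \<open>t\<close>. \<open>A\<close> may have fewer than \<open>k\<close> elements, since
  indices beyond \<open>T\<close> may be counted as well.\<close>

lemma counting_upper:
  fixes Sh :: "nat \<Rightarrow> 'a \<Rightarrow> real"
  assumes ind: "indep_vars (\<lambda>_. borel) Sh {1..}"
    and mono: "\<And>m n. 1 \<le> m \<Longrightarrow> m \<le> n \<Longrightarrow> prob {\<omega> \<in> space M. t < Sh m \<omega>} \<le> prob {\<omega> \<in> space M. t < Sh n \<omega>}"
  shows "prob {\<omega> \<in> space M. counting_process Sh t \<omega> = of_nat k} \<le> 2 ^ T * (\<Prod>n\<in>{k<..T}. prob {\<omega> \<in> space M. t < Sh n \<omega>})"
proof -
  have Sm [measurable]: "Sh n \<in> borel_measurable M" if "n \<ge> 1" for n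
    using ind that by (auto simp: indep_vars_def2)
  define E where "E A = {\<omega> \<in> space M. \<forall>n\<in>{1..T} - A. t < Sh n \<omega>}" for A
  define I where "I = {A. A \<subseteq> {1..T} \<and> card A \<le> k}"
  have fin: "finite I" unfolding I_def by (rule finite_subset[of _ "Pow {1..T}"]) auto
  have Em: "E A \<in> sets M" for A unfolding E_def
  proof (rule sets.sets_Collect_finite_All)
    fix n assume "n \<in> {1..T} - A"
    hence [measurable]: "Sh n \<in> borel_measurable M" by (intro Sm) simp
    show "{\<omega> \<in> space M. t < Sh n \<omega>} \<in> sets M" by measurable
  qed simp
  have sub: "{\<omega> \<in> space M. counting_process Sh t \<omega> = of_nat k} \<subseteq> (\<Union>A\<in>I. E A)"
  proof
    fix \<omega> assume w: "\<omega> \<in> {\<omega> \<in> space M. counting_process Sh t \<omega> = of_nat k}"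
    define A where "A = {n \<in> {1..T}. Sh n \<omega> \<le> t}"
    have "(of_nat (card A) :: ennreal) = (\<Sum>n\<in>{1..T}. indicator {\<omega>. Sh n \<omega> \<le> t} \<omega>)"
      unfolding A_def by (simp add: indicator_def sum.If_cases Int_def)
    also have "\<dots> = (\<Sum>n<T. indicator {\<omega>. Sh (Suc n) \<omega> \<le> t} \<omega>)"
      by (intro sum.reindex_bij_witness[of _ Suc "\<lambda>n. n - 1"]) auto
    also have "\<dots> \<le> counting_process Sh t \<omega>"
      unfolding counting_process_def by (rule sum_le_suminf) auto
    also have "\<dots> = of_nat k" using w by simp
    finally have "card A \<le> k" by simp
    hence "A \<in> I" by (auto simp: I_def A_def)
    moreover have "\<omega> \<in> E A" using w by (auto simp: E_def A_def not_le)
    ultimately show "\<omega> \<in> (\<Union>A\<in>I. E A)" by blast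
  qed
  have PE: "prob (E A) \<le> (\<Prod>n\<in>{k<..T}. prob {\<omega> \<in> space M. t < Sh n \<omega>})" if "A \<in> I" for A
  proof -
    have "prob (E A) = (\<Prod>n\<in>{1..T} - A. prob {\<omega> \<in> space M. t < Sh n \<omega>})"
    proof (cases "{1..T} - A = {}")
      case True
      thus ?thesis unfolding E_def by (simp only: True) (simp add: prob_space)
    next
      case False
      define J where "J = {1..T} - A"
      have "J \<noteq> {}" using False by (simp add: J_def)
      hence "E A = (\<Inter>n\<in>{1..T} - A. Sh n -` {t<..} \<inter> space M)"
        unfolding E_def J_def[symmetric] by auto
      also have "prob \<dots> = (\<Prod>n\<in>{1..T} - A. prob (Sh n -` {t<..} \<inter> space M))"
        by (rule indep_varsD[OF ind]) (use False in auto)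
      also have "\<dots> = (\<Prod>n\<in>{1..T} - A. prob {\<omega> \<in> space M. t < Sh n \<omega>})"
        by (intro prod.cong arg_cong[of _ _ prob]) auto
      finally show ?thesis .
    qed
    also have "\<dots> \<le> (\<Prod>n\<in>{k<..T}. prob {\<omega> \<in> space M. t < Sh n \<omega>})"
      by (rule prod_removed_le) (use mono that in \<open>auto simp: I_def\<close>)
    finally show ?thesis .
  qed
  have "prob {\<omega> \<in> space M. counting_process Sh t \<omega> = of_nat k} \<le> prob (\<Union>A\<in>I. E A)"
    by (rule finite_measure_mono[OF sub]) (use fin Em in auto)
  also have "\<dots> \<le> (\<Sum>A\<in>I. prob (E A))"
    by (rule finite_measure_subadditive_finite) (use fin Em in auto)
  also have "\<dots> \<le> (\<Sum>A\<in>I. \<Prod>n\<in>{k<..T}. prob {\<omega> \<in> space M. t < Sh n \<omega>})"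
    by (intro sum_mono PE)
  also have "\<dots> = card I * (\<Prod>n\<in>{k<..T}. prob {\<omega> \<in> space M. t < Sh n \<omega>})" by simp
  also have "\<dots> \<le> 2 ^ T * (\<Prod>n\<in>{k<..T}. prob {\<omega> \<in> space M. t < Sh n \<omega>})"
  proof (intro mult_right_mono prod_nonneg)
    have "card I \<le> card (Pow {1..T})" unfolding I_def by (intro card_mono) auto
    also have "\<dots> = 2 ^ T" by (simp add: card_Pow)
    finally show "real (card I) \<le> 2 ^ T" by (metis of_nat_le_iff of_nat_numeral of_nat_power)
  qed auto
  finally show ?thesis .
qed

text \<open>Counting exactly the indices up to \<open>k\<close> constrains infinitely many
  variables. The event is the decreasing limit of the \<open>E j\<close>, so the bound
  \<open>c\<close> has to hold for every \<open>j\<close>.\<close>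

lemma counting_lower:
  fixes Sh :: "nat \<Rightarrow> 'a \<Rightarrow> real"
  assumes ind: "indep_vars (\<lambda>_. borel) Sh {1..}" and T: "k < T"
    and low: "\<And>j. c \<le> (\<Prod>n\<in>{1..k}. 1 - prob {\<omega> \<in> space M. t < Sh n \<omega>}) * (\<Prod>n\<in>{k<..T+j}. prob {\<omega> \<in> space M. t < Sh n \<omega>})"
  shows "c \<le> prob {\<omega> \<in> space M. counting_process Sh t \<omega> = of_nat k}"
proof -
  have Sm [measurable]: "Sh n \<in> borel_measurable M" if "n \<ge> 1" for n
    using ind that by (auto simp: indep_vars_def2)
  define B where "B n = (if n \<le> k then {..t} else {t<..})" for n
  define E where "E j = (\<Inter>n\<in>{1..T+j}. Sh n -` B n \<inter> space M)" for j
  have PE: "prob (E j) = (\<Prod>n\<in>{1..k}. 1 - prob {\<omega> \<in> space M. t < Sh n \<omega>}) * (\<Prod>n\<in>{k<..T+j}. prob {\<omega> \<in> space M. t < Sh n \<omega>})" for j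
  proof -
    have "prob (E j) = (\<Prod>n\<in>{1..T+j}. prob (Sh n -` B n \<inter> space M))"
      unfolding E_def by (rule indep_varsD[OF ind]) (use T in \<open>auto simp: B_def\<close>)
    also have "{1..T+j} = {1..k} \<union> {k<..T+j}" using T by auto
    also have "(\<Prod>n\<in>{1..k} \<union> {k<..T+j}. prob (Sh n -` B n \<inter> space M)) =
        (\<Prod>n\<in>{1..k}. prob (Sh n -` B n \<inter> space M)) * (\<Prod>n\<in>{k<..T+j}. prob (Sh n -` B n \<inter> space M))"
      by (rule prod.union_disjoint) auto
    also have "(\<Prod>n\<in>{1..k}. prob (Sh n -` B n \<inter> space M)) = (\<Prod>n\<in>{1..k}. 1 - prob {\<omega> \<in> space M. t < Sh n \<omega>})"
    proof (rule prod.cong)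
      fix n assume n: "n \<in> {1..k}"
      hence "Sh n -` B n \<inter> space M = space M - {\<omega> \<in> space M. t < Sh n \<omega>}" by (auto simp: B_def)
      moreover have "{\<omega> \<in> space M. t < Sh n \<omega>} \<in> events"
      proof -
        have [measurable]: "Sh n \<in> borel_measurable M" using n by (intro Sm) simp
        show ?thesis by measurable
      qed
      ultimately show "prob (Sh n -` B n \<inter> space M) = 1 - prob {\<omega> \<in> space M. t < Sh n \<omega>}"
        using prob_compl by simp
    qed simp
    also have "(\<Prod>n\<in>{k<..T+j}. prob (Sh n -` B n \<inter> space M)) = (\<Prod>n\<in>{k<..T+j}. prob {\<omega> \<in> space M. t < Sh n \<omega>})"
      by (intro prod.cong arg_cong[of _ _ prob]) (auto simp: B_def)
    finally show ?thesis .
  qed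
  have Em: "E j \<in> sets M" for j unfolding E_def
    using T by (intro sets.finite_INT measurable_sets[OF Sm]) (auto simp: B_def)
  have "(\<lambda>j. prob (E j)) \<longlonglongrightarrow> prob (\<Inter>j. E j)"
  proof (rule finite_Lim_measure_decseq)
    show "decseq E" unfolding decseq_def E_def by (intro allI impI INF_superset_mono) auto
  qed (use Em in auto)
  hence "c \<le> prob (\<Inter>j. E j)"
    by (rule LIMSEQ_le_const) (use low PE in auto)
  also have "\<dots> \<le> prob {\<omega> \<in> space M. counting_process Sh t \<omega> = of_nat k}"
  proof (rule finite_measure_mono)
    show "{\<omega> \<in> space M. counting_process Sh t \<omega> = of_nat k} \<in> sets M"
      using counting_process_measurable[of Sh t] Sm by measurable
    show "(\<Inter>j. E j) \<subseteq> {\<omega> \<in> space M. counting_process Sh t \<omega> = of_nat k}"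
    proof
      fix \<omega> assume w: "\<omega> \<in> (\<Inter>j. E j)"
      have sp: "\<omega> \<in> space M" using w T by (force simp: E_def)
      have B: "Sh n \<omega> \<in> B n" if "n \<ge> 1" for n
      proof -
        \<comment> \<open>\<open>E n\<close> already constrains index \<open>n\<close>, as
          \<open>n \<le> T + n\<close>.\<close>
        have "\<omega> \<in> E n" using w by blast
        thus ?thesis using that T unfolding E_def by (blast intro: atLeastAtMost_iff[THEN iffD2] le_add2)
      qed
      have "counting_process Sh t \<omega> = (\<Sum>n<k. indicator {\<omega>. Sh (Suc n) \<omega> \<le> t} \<omega>)"
        unfolding counting_process_def
      proof (rule suminf_finite)
        fix n assume "n \<notin> {..<k}"
        thus "indicator {\<omega>. Sh (Suc n) \<omega> \<le> t} \<omega> = (0::ennreal)" using B[of "Suc n"] by (auto simp: B_def)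
      qed simp
      also have "\<dots> = (\<Sum>n<k. 1)"
      proof (rule sum.cong)
        fix n assume "n \<in> {..<k}"
        hence "Sh (Suc n) \<omega> \<le> t" using B[of "Suc n"] by (auto simp: B_def)
        thus "indicator {\<omega>. Sh (Suc n) \<omega> \<le> t} \<omega> = (1::ennreal)" by simp
      qed simp
      finally show "\<omega> \<in> {\<omega> \<in> space M. counting_process Sh t \<omega> = of_nat k}" using sp by simp
    qed
  qed
  finally show ?thesis .
qed

end

text \<open>Each summand is compared with the integral over a cell of length \<open>1 / t\<close>.
  The cell at \<open>\<alpha>\<close> may stick out of \<open>{\<alpha>..\<beta>}\<close>, which
  costs \<open>g \<alpha>\<close> in either direction.\<close>

lemma antimono_riemann_sum:
  fixes g :: "real \<Rightarrow> real" and k T :: nat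
  assumes \<alpha>: "0 < \<alpha>" "\<alpha> < \<beta>" and t: "t > 0"
    and anti: "\<And>x y. \<alpha> \<le> x \<Longrightarrow> x \<le> y \<Longrightarrow> y \<le> \<beta> \<Longrightarrow> g y \<le> g x" and pos: "\<And>x. \<alpha> \<le> x \<Longrightarrow> x \<le> \<beta> \<Longrightarrow> 0 \<le> g x"
    and j: "(\<integral>\<^sup>+y\<in>{\<alpha>..\<beta>}. ennreal (g y) \<partial>lborel) = ennreal j" "0 \<le> j"
    and k: "k = nat \<lfloor>\<alpha> * t\<rfloor>" and T: "T = nat \<lfloor>\<beta> * t\<rfloor>"
  shows "t * j \<le> g \<alpha> + (\<Sum>n\<in>{k<..T}. g (real n / t))"
    and "(\<Sum>n\<in>{k<..T}. g (real n / t)) \<le> t * j + g \<alpha>"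
proof -
  have kb: "real k \<le> \<alpha> * t" "\<alpha> * t < real k + 1" using \<alpha> t unfolding k by (auto simp: of_nat_nat)
  have Tb: "real T \<le> \<beta> * t" "\<beta> * t < real T + 1" using \<alpha> t unfolding T by (auto simp: of_nat_nat)
  have k\<alpha>: "real k / t \<le> \<alpha>" using kb t by (simp add: divide_le_eq)
  have n\<alpha>: "\<alpha> \<le> real n / t" if "k < n" for n using kb t that by (simp add: le_divide_eq)
  have n\<beta>: "real n / t \<le> \<beta>" if "n \<le> T" for n using Tb t that by (simp add: divide_le_eq)
  have kT: "k \<le> T" unfolding k T using \<alpha> t by (intro nat_mono floor_mono) simp
  have em: "emeasure lborel {real n / t..<(real n + 1) / t} = ennreal (1 / t)"
    "emeasure lborel {(real n - 1) / t<..real n / t} = ennreal (1 / t)" for n :: nat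
    using t by (simp_all add: divide_right_mono diff_divide_distrib[symmetric])
  \<comment> \<open>The first cell may begin to the left of \<open>\<alpha>\<close>, where nothing
    is known about \<open>g\<close>; \<open>max\<close> moves its end point to
    \<open>\<alpha>\<close>.\<close>
  define G where "G n = g (max \<alpha> (real n / t))" for n
  have Gpos: "0 \<le> G n" if "n \<le> T" for n unfolding G_def using n\<beta>[OF that] \<alpha> by (intro pos) auto
  have "ennreal j \<le> (\<integral>\<^sup>+y. (\<Sum>n\<in>{k..T}. ennreal (G n) * indicator {real n / t..<(real n + 1) / t} y) \<partial>lborel)"
    unfolding j(1)[symmetric]
  proof (intro nn_integral_mono)
    fix y :: real
    show "ennreal (g y) * indicator {\<alpha>..\<beta>} y \<le> (\<Sum>n\<in>{k..T}. ennreal (G n) * indicator {real n / t..<(real n + 1) / t} y)"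
    proof (cases "y \<in> {\<alpha>..\<beta>}")
      case True
      define n where "n = nat \<lfloor>y * t\<rfloor>"
      have y0: "0 < y" using True \<alpha> by auto
      have nb: "real n \<le> y * t" "y * t < real n + 1" using y0 t unfolding n_def by (auto simp: of_nat_nat)
      have n: "n \<in> {k..T}" unfolding n_def k T using True t by (auto intro!: nat_mono floor_mono)
      have "g y \<le> G n" unfolding G_def using True nb t by (intro anti) (auto simp: divide_le_eq)
      hence "ennreal (g y) * indicator {\<alpha>..\<beta>} y \<le> ennreal (G n) * indicator {real n / t..<(real n + 1) / t} y"
        using True nb t by (simp add: ennreal_leI divide_le_eq less_divide_eq)
      also have "\<dots> \<le> (\<Sum>n\<in>{k..T}. ennreal (G n) * indicator {real n / t..<(real n + 1) / t} y)"
        by (rule member_le_sum) (use n in auto)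
      finally show ?thesis .
    qed simp
  qed
  also have "\<dots> = (\<Sum>n\<in>{k..T}. ennreal (G n) * ennreal (1 / t))"
    using t by (subst nn_integral_sum) (auto simp: nn_integral_cmult_indicator em intro!: sum.cong)
  also have "\<dots> = ennreal (\<Sum>n\<in>{k..T}. G n * (1 / t))"
  proof -
    have "ennreal (G n) * ennreal (1 / t) = ennreal (G n * (1 / t))" if "n \<in> {k..T}" for n
      by (rule ennreal_mult[symmetric]) (use that Gpos t in auto)
    thus ?thesis using t Gpos by (subst sum_ennreal[symmetric]) (auto intro!: sum.cong)
  qed
  finally have "j \<le> (\<Sum>n\<in>{k..T}. G n * (1 / t))"
    using t Gpos by (subst (asm) ennreal_le_iff) (auto intro!: sum_nonneg)
  hence "t * j \<le> (\<Sum>n\<in>{k..T}. G n)"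
    using t by (simp add: sum_divide_distrib[symmetric] field_simps)
  also have "{k..T} = insert k {k<..T}" using kT by auto
  also have "(\<Sum>n\<in>insert k {k<..T}. G n) = G k + (\<Sum>n\<in>{k<..T}. G n)" by simp
  also have "G k = g \<alpha>" using k\<alpha> by (simp add: G_def max_def)
  also have "(\<Sum>n\<in>{k<..T}. G n) = (\<Sum>n\<in>{k<..T}. g (real n / t))"
    using n\<alpha> by (intro sum.cong) (auto simp: G_def max_def)
  finally show "t * j \<le> g \<alpha> + (\<Sum>n\<in>{k<..T}. g (real n / t))" .
  \<comment> \<open>\<open>Suc k\<close> is left out: its cell begins at
    \<open>k / t \<le> \<alpha>\<close> and need not lie in the range of integration.\<close>
  define I where "I = {Suc k<..T}"
  have gn: "0 \<le> g (real n / t)" if "n \<in> I" for n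
    using that n\<alpha>[of n] n\<beta>[of n] by (intro pos) (auto simp: I_def)
  have "ennreal (\<Sum>n\<in>I. g (real n / t) * (1 / t)) = (\<Sum>n\<in>I. ennreal (g (real n / t)) * ennreal (1 / t))"
  proof -
    have "ennreal (g (real n / t)) * ennreal (1 / t) = ennreal (g (real n / t) * (1 / t))" if "n \<in> I" for n
      by (rule ennreal_mult[symmetric]) (use that gn t in auto)
    thus ?thesis using t gn by (subst sum_ennreal[symmetric]) (auto intro!: sum.cong)
  qed
  also have "\<dots> = (\<integral>\<^sup>+y. (\<Sum>n\<in>I. ennreal (g (real n / t)) * indicator {(real n - 1) / t<..real n / t} y) \<partial>lborel)"
    using t by (subst nn_integral_sum) (auto simp: nn_integral_cmult_indicator em intro!: sum.cong)
  also have "\<dots> \<le> (\<integral>\<^sup>+y\<in>{\<alpha>..\<beta>}. ennreal (g y) \<partial>lborel)"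
  proof (intro nn_integral_mono)
    fix y :: real
    define N where "N = nat \<lceil>y * t\<rceil>"
    have iff: "n = N" if "n \<in> I" "y \<in> {(real n - 1) / t<..real n / t}" for n
    proof -
      have "real n - 1 < y * t" "y * t \<le> real n" using that t by (auto simp: divide_less_eq le_divide_eq)
      hence "\<lceil>y * t\<rceil> = int n" by (simp add: ceiling_eq_iff)
      thus ?thesis by (simp add: N_def)
    qed
    have "(\<Sum>n\<in>I. ennreal (g (real n / t)) * indicator {(real n - 1) / t<..real n / t} y)
       = (\<Sum>n\<in>I. if n = N then ennreal (g (N / t)) * indicator {(real N - 1) / t<..real N / t} y else 0)"
    proof (rule sum.cong)
      fix n assume "n \<in> I"
      with iff[of n] have "n \<noteq> N \<Longrightarrow> y \<notin> {(real n - 1) / t<..real n / t}" by blast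
      thus "ennreal (g (real n / t)) * indicator {(real n - 1) / t<..real n / t} y =
          (if n = N then ennreal (g (N / t)) * indicator {(real N - 1) / t<..real N / t} y else 0)"
        by (cases "n = N") simp_all
    qed simp
    also have "\<dots> \<le> ennreal (g y) * indicator {\<alpha>..\<beta>} y"
    proof (cases "N \<in> I \<and> y \<in> {(real N - 1) / t<..real N / t}")
      case True
      hence "k < N - 1" "N \<ge> 1" "N \<le> T" by (auto simp: I_def)
      hence "\<alpha> \<le> (real N - 1) / t" using n\<alpha>[of "N - 1"] by (simp add: of_nat_diff)
      hence y: "\<alpha> \<le> y" "y \<le> real N / t" using True by auto
      have "y \<le> \<beta>" using y n\<beta>[OF \<open>N \<le> T\<close>] by simp
      have "g (real N / t) \<le> g y" using y n\<beta>[OF \<open>N \<le> T\<close>] by (intro anti) auto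
      thus ?thesis using True y \<open>y \<le> \<beta>\<close> by (simp add: I_def ennreal_leI)
    next
      case False
      have "finite I" by (simp add: I_def)
      thus ?thesis using False by (auto simp: sum.delta)
    qed
    finally show "(\<Sum>n\<in>I. ennreal (g (real n / t)) * indicator {(real n - 1) / t<..real n / t} y) \<le> ennreal (g y) * indicator {\<alpha>..\<beta>} y" .
  qed
  finally have "(\<Sum>n\<in>I. g (real n / t) * (1 / t)) \<le> j" using j by simp
  hence "(\<Sum>n\<in>I. g (real n / t)) \<le> t * j"
    using t by (simp add: sum_divide_distrib[symmetric] field_simps)
  moreover have "(\<Sum>n\<in>{k<..T}. g (real n / t)) \<le> g \<alpha> + (\<Sum>n\<in>I. g (real n / t))"
  proof (cases "k < T")
    case True
    hence "{k<..T} = insert (Suc k) I" by (auto simp: I_def)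
    moreover have "g (real (Suc k) / t) \<le> g \<alpha>"
      using n\<alpha>[of "Suc k"] n\<beta>[of "Suc k"] True by (intro anti) auto
    ultimately show ?thesis by (simp add: I_def)
  next
    case False
    thus ?thesis using pos[of \<alpha>] \<alpha> by (simp add: I_def)
  qed
  ultimately show "(\<Sum>n\<in>{k<..T}. g (real n / t)) \<le> t * j + g \<alpha>" by simp
qed

section \<open>Logarithmic sums and tails\<close>

text \<open>In this range \<open>ln n\<close> differs from \<open>ln t\<close> by a bounded amount,
  and the number of indices is \<open>(\<beta> - \<alpha>) * t\<close> up to an error of at most
  1.\<close>

lemma sum_ln_bounds:
  fixes \<alpha> \<beta> :: real
  assumes "0 < \<alpha>" "\<alpha> < \<beta>"
  shows "\<exists>C. \<forall>t\<ge>1. \<bar>(\<Sum>n\<in>{nat \<lfloor>\<alpha> * t\<rfloor><..nat \<lfloor>\<beta> * t\<rfloor>}. ln (real n)) - (\<beta> - \<alpha>) * t * ln t\<bar> \<le> C * t"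
proof (intro exI allI impI)
  fix t :: real assume t: "t \<ge> 1"
  define k T where "k = nat \<lfloor>\<alpha> * t\<rfloor>" and "T = nat \<lfloor>\<beta> * t\<rfloor>"
  have kb: "real k \<le> \<alpha> * t" "\<alpha> * t < real k + 1" using assms t unfolding k_def by (auto simp: of_nat_nat)
  have Tb: "real T \<le> \<beta> * t" "\<beta> * t < real T + 1" using assms t unfolding T_def by (auto simp: of_nat_nat)
  have kT: "k \<le> T" unfolding k_def T_def using assms t by (intro nat_mono floor_mono) simp
  define A where "A = \<bar>ln \<alpha>\<bar> + \<bar>ln \<beta>\<bar>"
  have "\<bar>ln (real n) - ln t\<bar> \<le> A" if "n \<in> {k<..T}" for n
  proof -
    have n: "\<alpha> * t \<le> real n" "real n \<le> \<beta> * t" using that kb Tb by auto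
    have pos: "0 < \<alpha> * t" "0 < \<beta> * t" "0 < real n" using assms t that by auto
    have "ln (\<alpha> * t) \<le> ln (real n)" "ln (real n) \<le> ln (\<beta> * t)" using n pos by (auto simp: ln_le_cancel_iff)
    moreover have "ln (\<alpha> * t) = ln \<alpha> + ln t" "ln (\<beta> * t) = ln \<beta> + ln t" using assms t by (auto simp: ln_mult)
    ultimately show ?thesis unfolding A_def by linarith
  qed
  hence "\<bar>\<Sum>n\<in>{k<..T}. ln (real n) - ln t\<bar> \<le> (\<Sum>n\<in>{k<..T}. A)"
    by (intro order_trans[OF sum_abs sum_mono])
  hence 1: "\<bar>(\<Sum>n\<in>{k<..T}. ln (real n)) - (real T - real k) * ln t\<bar> \<le> (real T - real k) * A"
    using kT by (simp add: sum_subtractf of_nat_diff)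
  have "real T - real k \<le> \<beta> * t" using Tb by linarith
  hence 2: "(real T - real k) * A \<le> \<beta> * t * A" unfolding A_def by (intro mult_right_mono) auto
  have "\<bar>(real T - real k) - (\<beta> - \<alpha>) * t\<bar> \<le> 1" using kb Tb by (simp add: left_diff_distrib abs_le_iff)
  hence "\<bar>((real T - real k) - (\<beta> - \<alpha>) * t) * ln t\<bar> \<le> 1 * ln t"
    using t by (subst abs_mult) (intro mult_mono, auto)
  moreover have "ln t \<le> t" using ln_le_minus_one[of t] t by linarith
  ultimately have 3: "\<bar>(real T - real k) * ln t - (\<beta> - \<alpha>) * t * ln t\<bar> \<le> t" by (simp add: left_diff_distrib)
  show "\<bar>(\<Sum>n\<in>{nat \<lfloor>\<alpha> * t\<rfloor><..nat \<lfloor>\<beta> * t\<rfloor>}. ln (real n)) - (\<beta> - \<alpha>) * t * ln t\<bar> \<le> (\<beta> * A + 1) * t"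
    using 1 2 3 unfolding k_def[symmetric] T_def[symmetric] by (simp add: algebra_simps)
qed

text \<open>The tilts vanish as \<open>n\<close> approaches \<open>t/\<mu>\<close>; this bound makes their logarithms summable to \<open>O(t)\<close>.\<close>

lemma sum_ln_ratio: "(\<Sum>n\<in>{k<..<T}. ln (real T / (real T - real n))) \<le> real T"
proof (cases "T = 0")
  case False
  have "(\<Sum>n\<in>{k<..<T}. ln (real T / (real T - real n))) \<le> (\<Sum>n\<in>{1..<T}. ln (real T / (real T - real n)))"
    by (rule sum_mono2) auto
  also have "\<dots> = (\<Sum>j\<in>{1..<T}. ln (real T / real j))"
    by (rule sum.reindex_bij_witness[of _ "\<lambda>j. T - j" "\<lambda>n. T - n"]) (auto simp: of_nat_diff)
  also have "\<dots> \<le> (\<Sum>j\<in>{1..T}. ln (real T / real j))" by (rule sum_mono2) auto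
  also have "\<dots> = ln (\<Prod>j\<in>{1..T}. real T / real j)"
    using False by (subst ln_prod) auto
  also have "(\<Prod>j\<in>{1..T}. real T / real j) = real T ^ T / fact T"
    by (simp add: prod_dividef fact_prod)
  \<comment> \<open>\<open>T ^ T / fact T\<close> is a single term of the exponential series at
    \<open>T\<close>.\<close>
  also have "\<dots> \<le> exp (real T)"
  proof -
    have "(\<Sum>n\<in>{T}. real T ^ n /\<^sub>R fact n) \<le> (\<Sum>n. real T ^ n /\<^sub>R fact n)"
      by (rule sum_le_suminf[OF summable_exp_generic]) auto
    thus ?thesis by (simp add: exp_def divide_inverse mult.commute)
  qed
  hence "ln (real T ^ T / fact T) \<le> real T"
    using False ln_le_cancel_iff[of "real T ^ T / fact T" "exp (real T)"] by simp
  finally show ?thesis .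
qed simp

section \<open>Tails for small and large indices, and the supply of tilts\<close>

context unbounded_rv
begin

lemma q_mono_n: "m \<le> n \<Longrightarrow> q m t \<le> q n t"
proof (induction n rule: dec_induct)
  case (step n)
  have "indicator {t<..} x \<le> shift_op M \<xi> (indicator {t<..}) x" for x
  proof -
    have "indicator {t<..} x = (\<integral>\<^sup>+\<omega>. indicator {t<..} x \<partial>M)" by (simp add: emeasure_space_1)
    also have "\<dots> \<le> shift_op M \<xi> (indicator {t<..}) x"
      unfolding shift_op_def using \<xi>_nonneg
      by (intro nn_integral_mono_AE) (auto elim!: eventually_mono simp: indicator_def)
    finally show ?thesis .
  qed
  hence "tail n t \<le> tail (Suc n) t"
    unfolding tail_def funpow_Suc_right o_def
    by (intro pos_lin_mono[OF pos_lin_funpow[OF T_pos_lin]] pos_lin_meas[OF T_pos_lin]) auto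
  hence "q n t \<le> q (Suc n) t" by (simp add: tail_q q_nonneg)
  with step show ?case by simp
qed simp

lemma q_pos: "n \<ge> 1 \<Longrightarrow> q n t > 0"
proof -
  assume n: "n \<ge> 1"
  have "tail 1 t = (\<integral>\<^sup>+\<omega>. indicator {t<..} (\<xi> \<omega>) \<partial>M)"
    by (simp add: tail_def shift_op_def)
  also have "\<dots> = (\<integral>\<^sup>+\<omega>. indicator {\<omega> \<in> space M. t < \<xi> \<omega>} \<omega> \<partial>M)"
    by (intro nn_integral_cong) (auto simp: indicator_def)
  finally have "q 1 t = prob {\<omega> \<in> space M. t < \<xi> \<omega>}"
    by (simp add: q_def emeasure_eq_measure)
  hence "q 1 t > 0" using unb by simp
  thus ?thesis using q_mono_n[OF n, of t] by simp
qed

text \<open>For \<open>n \<le> b * t / \<mu>\<close> this gives \<open>q n t \<le> b\<close>, so the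
  factors \<open>1 - q n t\<close> of the counted indices are at least \<open>1 - b\<close>.\<close>

lemma q_markov:
  assumes int: "integrable M \<xi>" and t: "t > 0"
  shows "q n t \<le> n * (\<integral>\<omega>. \<xi> \<omega> \<partial>M) / t"
proof -
  define \<mu> where "\<mu> = (\<integral>\<omega>. \<xi> \<omega> \<partial>M)"
  have \<mu>: "\<mu> \<ge> 0" unfolding \<mu>_def by (intro integral_nonneg_AE \<xi>_nonneg)
  have mean: "(shift_op M \<xi> ^^ n) ennreal x = ennreal (x + n * \<mu>)" if "x \<ge> 0" for x n
    using that
  proof (induction n arbitrary: x)
    case (Suc n)
    have "(shift_op M \<xi> ^^ Suc n) ennreal x = (\<integral>\<^sup>+\<omega>. ennreal (x + \<xi> \<omega> + n * \<mu>) \<partial>M)"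
      unfolding funpow.simps o_def shift_op_def[of M \<xi> "(shift_op M \<xi> ^^ n) ennreal"]
      using \<xi>_nonneg by (intro nn_integral_cong_AE) (auto elim!: eventually_mono intro!: Suc.IH simp: Suc.prems)
    also have "\<dots> = ennreal (\<integral>\<omega>. x + \<xi> \<omega> + n * \<mu> \<partial>M)"
      using int \<mu> Suc.prems \<xi>_nonneg by (intro nn_integral_eq_integral) (auto elim!: eventually_mono)
    also have "(\<integral>\<omega>. x + \<xi> \<omega> + n * \<mu> \<partial>M) = x + Suc n * \<mu>"
      using int by (simp add: \<mu>_def prob_space algebra_simps)
    finally show ?case .
  qed simp
  have "tail n t \<le> (shift_op M \<xi> ^^ n) (\<lambda>y. ennreal (1 / t) * ennreal y) 0"
    unfolding tail_def
    by (rule pos_lin_mono[OF pos_lin_funpow[OF T_pos_lin]])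
       (use t in \<open>auto simp: indicator_def le_divide_eq simp flip: ennreal_mult' intro!: ennreal_leI[of 1, simplified]\<close>)
  also have "\<dots> = ennreal (1 / t) * ennreal (n * \<mu>)"
    by (subst pos_lin_cmult[OF pos_lin_funpow[OF T_pos_lin]]) (auto simp: mean)
  finally show ?thesis using t \<mu> by (simp add: tail_q \<mu>_def flip: ennreal_mult)
qed

lemma Lam_minus_1: "0 < Lam (- 1)" "Lam (- 1) < 1"
proof -
  have d: "- 1 \<in> dom" by (rule dom_mono[OF zero_dom]) simp
  thus "0 < Lam (- 1)" by (rule Lam_pos)
  have "Lam (- 1) \<le> (\<integral>\<omega>. 1 - (1 - exp (- 1)) * indicator {\<omega> \<in> space M. 1 < \<xi> \<omega>} \<omega> \<partial>M)"
    unfolding Lam_def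
  proof (rule integral_mono_AE)
    show "AE \<omega> in M. exp (- 1 * \<xi> \<omega>) \<le> 1 - (1 - exp (- 1)) * indicator {\<omega> \<in> space M. 1 < \<xi> \<omega>} \<omega>"
      using \<xi>_nonneg by eventually_elim (auto simp: indicator_def)
  qed (use d in \<open>auto simp: dom_def emeasure_eq_measure intro!: integrable_mult_right integrable_real_indicator\<close>)
  also have "\<dots> = 1 - (1 - exp (- 1)) * prob {\<omega> \<in> space M. 1 < \<xi> \<omega>}"
    by (subst Bochner_Integration.integral_diff) (auto simp: prob_space emeasure_eq_measure intro!: integrable_mult_right integrable_real_indicator)
  also have "\<dots> < 1" using unb[of 1] by (simp add: mult_pos_pos)
  finally show "Lam (- 1) < 1" .
qed

text \<open>Chernoff's bound for small sums, with exponent \<open>- 1\<close>: as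
  \<open>Lam (- 1) < 1\<close>, the defect decays geometrically in \<open>n\<close>, and long
  products of the \<open>q n t\<close> stay away from 0.\<close>

lemma one_minus_q_le: "1 - q n t \<le> exp t * Lam (- 1) ^ n"
proof -
  have d: "- 1 \<in> dom" by (rule dom_mono[OF zero_dom]) simp
  note P = pos_lin_funpow[OF T_pos_lin, of n]
  have "1 = (shift_op M \<xi> ^^ n) (\<lambda>_. 1) 0" by (simp add: pos_lin_one[OF P])
  also have "\<dots> \<le> (shift_op M \<xi> ^^ n) (\<lambda>y. indicator {t<..} y + ennreal (exp t) * ennreal (exp (- 1 * y))) 0"
  proof (rule pos_lin_mono[OF P])
    fix y
    have "ennreal (exp t) * ennreal (exp (- 1 * y)) = ennreal (exp (t - y))"
      by (simp add: exp_diff exp_minus divide_inverse flip: ennreal_mult)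
    thus "1 \<le> indicator {t<..} y + ennreal (exp t) * ennreal (exp (- 1 * y))"
      by (simp add: indicator_def)
  qed auto
  also have "\<dots> = tail n t + ennreal (exp t) * ennreal (Lam (- 1) ^ n)"
    unfolding tail_def by (subst pos_lin_add[OF P], simp, simp, subst pos_lin_cmult[OF P]) (simp_all only: funpow_exp[OF d], auto)
  also have "\<dots> = ennreal (q n t + exp t * Lam (- 1) ^ n)"
    using Lam_minus_1 by (simp add: tail_q q_nonneg ennreal_mult)
  finally have "ennreal 1 \<le> ennreal (q n t + exp t * Lam (- 1) ^ n)" by (simp del: ennreal_plus)
  thus ?thesis using Lam_minus_1 q_nonneg[of n t] by (subst (asm) ennreal_le_iff) auto
qed

text \<open>Strictly inside the domain \<open>exp ((s - \<sigma>) * \<xi>)\<close> dominates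
  \<open>\<xi>^2\<close> up to a constant.\<close>

lemma tilt_rv_exists:
  assumes s: "s \<in> dom" and \<sigma>: "0 < \<sigma>" "\<sigma> < s"
  shows "\<exists>a D. tilt_rv M \<xi> \<sigma> a (a + 1) D"
proof -
  obtain a where a: "a \<ge> 0" "prob {\<omega> \<in> space M. \<xi> \<omega> \<le> a} > 0" using exists_mass by auto
  have "(\<lambda>n. prob {\<omega> \<in> space M. a + 1 \<le> \<xi> \<omega> \<and> \<xi> \<omega> \<le> real n}) \<longlonglongrightarrow> prob (\<Union>n. {\<omega> \<in> space M. a + 1 \<le> \<xi> \<omega> \<and> \<xi> \<omega> \<le> real n})"
    by (rule finite_Lim_measure_incseq) (auto simp: incseq_def)
  also have "(\<Union>n. {\<omega> \<in> space M. a + 1 \<le> \<xi> \<omega> \<and> \<xi> \<omega> \<le> real n}) = {\<omega> \<in> space M. a + 1 \<le> \<xi> \<omega>}"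
    using real_arch_simple by auto
  finally have lim: "(\<lambda>n. prob {\<omega> \<in> space M. a + 1 \<le> \<xi> \<omega> \<and> \<xi> \<omega> \<le> real n}) \<longlonglongrightarrow> prob {\<omega> \<in> space M. a + 1 \<le> \<xi> \<omega>}" .
  have "prob {\<omega> \<in> space M. a + 1 < \<xi> \<omega>} \<le> prob {\<omega> \<in> space M. a + 1 \<le> \<xi> \<omega>}"
    by (intro finite_measure_mono) auto
  hence "0 < prob {\<omega> \<in> space M. a + 1 \<le> \<xi> \<omega>}" using unb[of "a + 1"] by linarith
  from order_tendstoD(1)[OF lim this] obtain n where n: "0 < prob {\<omega> \<in> space M. a + 1 \<le> \<xi> \<omega> \<and> \<xi> \<omega> \<le> real n}"
    by (auto simp: eventually_sequentially)
  have "a + 1 \<le> real n"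
  proof (rule ccontr)
    assume "\<not> a + 1 \<le> real n"
    hence "{\<omega> \<in> space M. a + 1 \<le> \<xi> \<omega> \<and> \<xi> \<omega> \<le> real n} = {}" by auto
    thus False using n by (simp only: measure_empty)
  qed
  define h where "h = s - \<sigma>"
  have h: "h > 0" using \<sigma> by (simp add: h_def)
  have "integrable M (\<lambda>\<omega>. (\<xi> \<omega>)\<^sup>2 * exp (\<sigma> * \<xi> \<omega>))"
  proof (rule Bochner_Integration.integrable_bound)
    show "integrable M (\<lambda>\<omega>. 2 / h\<^sup>2 * exp (s * \<xi> \<omega>))" using s by (simp add: dom_def)
    show "AE \<omega> in M. norm ((\<xi> \<omega>)\<^sup>2 * exp (\<sigma> * \<xi> \<omega>)) \<le> norm (2 / h\<^sup>2 * exp (s * \<xi> \<omega>))"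
      using \<xi>_nonneg
    proof eventually_elim
      case (elim \<omega>)
      have "0 \<le> h * \<xi> \<omega>" using elim h by simp
      hence "(h * \<xi> \<omega>)\<^sup>2 / 2 \<le> exp (h * \<xi> \<omega>)"
        using exp_lower_Taylor_quadratic[of "h * \<xi> \<omega>"] by linarith
      hence "(\<xi> \<omega>)\<^sup>2 \<le> 2 / h\<^sup>2 * exp (h * \<xi> \<omega>)" using h by (simp add: power_mult_distrib field_simps)
      hence "(\<xi> \<omega>)\<^sup>2 * exp (\<sigma> * \<xi> \<omega>) \<le> 2 / h\<^sup>2 * exp (h * \<xi> \<omega>) * exp (\<sigma> * \<xi> \<omega>)"
        by (intro mult_right_mono) auto
      also have "\<dots> = 2 / h\<^sup>2 * exp (s * \<xi> \<omega>)" by (simp add: h_def left_diff_distrib flip: exp_add)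
      finally show ?case by simp
    qed
  qed auto
  hence "tilt_rv M \<xi> \<sigma> a (a + 1) (real n)"
    using \<sigma> a n \<open>a + 1 \<le> real n\<close> by unfold_locales auto
  thus ?thesis by blast
qed

text \<open>Under growing tilts the law of \<open>trunc L\<close> concentrates at its maximal value
  \<open>L\<close>, which exceeds \<open>x\<close>.\<close>

lemma trunc_mean_large:
  assumes L: "x < real L" and x: "0 \<le> x" and tilt: "\<And>\<sigma>. \<sigma> > 0 \<Longrightarrow> tilt_rv M (trunc L) \<sigma> a a' D"
  shows "\<exists>\<sigma>>0. x \<le> tr.mean L \<sigma>"
proof -
  define A where "A = {\<omega> \<in> space M. real L < \<xi> \<omega>}"
  have [measurable]: "A \<in> events" unfolding A_def by measurable
  have A: "prob A > 0" unfolding A_def by (rule unb)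
  \<comment> \<open>Ensures \<open>\<sigma> * (L - x) \<ge> x / ((L - x) * prob A)\<close>. Then the
    surplus from \<open>A\<close>, weighted with \<open>exp (\<sigma> * L)\<close>, outweighs the
    deficit of at most \<open>x * exp (\<sigma> * x)\<close> from values below
    \<open>x\<close>.\<close>
  define \<sigma> where "\<sigma> = x / ((real L - x)\<^sup>2 * prob A) + 1"
  have \<sigma>: "\<sigma> > 0" unfolding \<sigma>_def using x A by (intro add_nonneg_pos) auto
  interpret t: tilt_rv M "trunc L" \<sigma> a a' D by (rule tilt[OF \<sigma>])
  have e: "x / ((real L - x) * prob A) \<le> exp (\<sigma> * (real L - x))"
  proof -
    have "x / ((real L - x) * prob A) \<le> \<sigma> * (real L - x)"
      using L A by (simp add: \<sigma>_def power2_eq_square distrib_right)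
    also have "\<dots> \<le> exp (\<sigma> * (real L - x))" using exp_ge_add_one_self[of "\<sigma> * (real L - x)"] by linarith
    finally show ?thesis .
  qed
  have "x \<le> (real L - x) * prob A * exp (\<sigma> * (real L - x))"
    using e L A by (simp add: divide_le_eq mult_ac)
  hence "x * exp (\<sigma> * x) \<le> (real L - x) * prob A * exp (\<sigma> * (real L - x)) * exp (\<sigma> * x)"
    by (intro mult_right_mono) auto
  also have "\<dots> = (real L - x) * exp (\<sigma> * L) * prob A"
    by (simp add: right_diff_distrib mult.assoc flip: exp_add)
  finally have "0 \<le> (real L - x) * exp (\<sigma> * L) * prob A - x * exp (\<sigma> * x)" by simp
  also have "\<dots> = (\<integral>\<omega>. (real L - x) * exp (\<sigma> * L) * indicator A \<omega> - x * exp (\<sigma> * x) \<partial>M)"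
    by (subst Bochner_Integration.integral_diff) (auto simp: prob_space emeasure_eq_measure intro!: integrable_mult_right integrable_real_indicator)
  also have "\<dots> \<le> (\<integral>\<omega>. trunc L \<omega> * exp (\<sigma> * trunc L \<omega>) - x * exp (\<sigma> * trunc L \<omega>) \<partial>M)"
  proof (rule integral_mono_AE)
    show "AE \<omega> in M. (real L - x) * exp (\<sigma> * L) * indicator A \<omega> - x * exp (\<sigma> * x) \<le> trunc L \<omega> * exp (\<sigma> * trunc L \<omega>) - x * exp (\<sigma> * trunc L \<omega>)"
      using tr.\<xi>_nonneg[of L]
    proof eventually_elim
      case (elim \<omega>)
      show ?case
      proof (cases "\<omega> \<in> A")
        case True
        hence "trunc L \<omega> = real L" by (simp add: A_def trunc_def)
        thus ?thesis using True x by (simp add: left_diff_distrib)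
      next
        case False
        have "- x * exp (\<sigma> * x) \<le> (trunc L \<omega> - x) * exp (\<sigma> * trunc L \<omega>)"
        proof (cases "trunc L \<omega> \<ge> x")
          case True
          hence "0 \<le> (trunc L \<omega> - x) * exp (\<sigma> * trunc L \<omega>)" by simp
          moreover have "- x * exp (\<sigma> * x) \<le> 0" using x by simp
          ultimately show ?thesis by linarith
        next
          case f: False
          have "(x - trunc L \<omega>) * exp (\<sigma> * trunc L \<omega>) \<le> x * exp (\<sigma> * x)"
            using f elim x \<sigma> by (intro mult_mono) auto
          thus ?thesis by (simp add: left_diff_distrib)
        qed
        thus ?thesis using False by (simp add: left_diff_distrib)
      qed
    qed
  qed (use t.int_1 t.int_0 in \<open>auto simp: emeasure_eq_measure intro!: integrable_mult_right integrable_real_indicator\<close>)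
  also have "\<dots> = (\<integral>\<omega>. trunc L \<omega> * exp (\<sigma> * trunc L \<omega>) \<partial>M) - x * tr.Lam L \<sigma>"
    using t.int_1 t.int_0 by (simp add: tr.Lam_def)
  finally have "x \<le> tr.mean L \<sigma>"
    using tr.Lam_pos[OF t.\<sigma>_dom] by (simp add: tr.mean_def le_divide_eq)
  thus ?thesis using \<sigma> by blast
qed

end

section \<open>Asymptotics\<close>

text \<open>Composing with \<open>max u\<close> makes \<open>g\<close> monotone on the whole line
  without changing it on the interval.\<close>

lemma antimono_indicator_measurable:
  fixes g :: "real \<Rightarrow> real"
  assumes "\<And>x y. u \<le> x \<Longrightarrow> x \<le> y \<Longrightarrow> g y \<le> g x"
  shows "(\<lambda>y. ennreal (g y) * indicator {u..v} y) \<in> borel_measurable borel"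
proof -
  have "mono (\<lambda>y. - g (max u y))" using assms by (auto simp: mono_def)
  hence "(\<lambda>y. - (- g (max u y))) \<in> borel_measurable borel"
    by (intro borel_measurable_uminus borel_measurable_mono)
  hence [measurable]: "(\<lambda>y. g (max u y)) \<in> borel_measurable borel" by simp
  have "(\<lambda>y. ennreal (g y) * indicator {u..v} y) = (\<lambda>y. ennreal (g (max u y)) * indicator {u..v} y)"
    by (auto simp: fun_eq_iff indicator_def max_def)
  thus ?thesis by simp
qed

lemma neg_ln_le_of_exp_le:
  fixes r c Q t :: real
  assumes q: "exp (- t * r) * (c / sqrt n) \<le> Q" and c: "c > 0" and n: "n > (0::nat)"
  shows "- ln Q \<le> t * r + ln (real n) / 2 + \<bar>ln c\<bar>"
proof -
  have pos: "0 < exp (- t * r) * (c / sqrt n)" using c n by simp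
  hence "ln (exp (- t * r) * (c / sqrt n)) \<le> ln Q" using q by (subst ln_le_cancel_iff) auto
  hence "- t * r + (ln c - ln (real n) / 2) \<le> ln Q" using c n by (simp add: ln_mult ln_div ln_sqrt)
  thus ?thesis by linarith
qed

section \<open>The decoupled renewal process\<close>

locale decoupled_rv = unbounded_rv +
  fixes Sh :: "nat \<Rightarrow> 'a \<Rightarrow> real" and s0 b :: real
  assumes Sh_ind: "indep_vars (\<lambda>_. borel) Sh {1..}"
    and Sh_tail: "\<And>n t. n \<ge> 1 \<Longrightarrow> prob {\<omega> \<in> space M. t < Sh n \<omega>} = q n t"
    and s0: "s0 \<in> dom" "0 < s0" and b: "0 < b" "b < 1"
begin

definition "\<mu> = (\<integral>\<omega>. \<xi> \<omega> \<partial>M)"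
definition "\<alpha> = b / \<mu>"
definition "\<beta> = 1 / \<mu>"
definition kk :: "real \<Rightarrow> nat" where "kk t = nat \<lfloor>\<alpha> * t\<rfloor>"
definition TT :: "real \<Rightarrow> nat" where "TT t = nat \<lfloor>\<beta> * t\<rfloor>"
definition p :: "real \<Rightarrow> real" where "p t = prob {\<omega> \<in> space M. counting_process Sh t \<omega> = of_nat (kk t)}"

lemma base_tilt: "\<exists>a D. tilt_rv M \<xi> (s0 / 2) a (a + 1) D"
  by (rule tilt_rv_exists[OF s0(1)]) (use s0 in auto)

lemma int_\<xi>: "integrable M \<xi>"
proof -
  obtain a D where "tilt_rv M \<xi> (s0 / 2) a (a + 1) D" using base_tilt by auto
  then interpret t: tilt_rv M \<xi> "s0 / 2" a "a + 1" D .
  show ?thesis using t.int_1s[of 0] s0 by simp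
qed

lemma \<mu>_pos: "\<mu> > 0"
proof -
  have "prob {\<omega> \<in> space M. 1 < \<xi> \<omega>} = (\<integral>\<omega>. indicator {\<omega> \<in> space M. 1 < \<xi> \<omega>} \<omega> \<partial>M)" by simp
  also have "\<dots> \<le> \<mu>" unfolding \<mu>_def
  proof (rule integral_mono_AE)
    show "integrable M (indicator {\<omega> \<in> space M. 1 < \<xi> \<omega>} :: _ \<Rightarrow> real)"
      by (intro integrable_real_indicator) (auto simp: emeasure_eq_measure)
    show "AE \<omega> in M. indicator {\<omega> \<in> space M. 1 < \<xi> \<omega>} \<omega> \<le> \<xi> \<omega>"
      using \<xi>_nonneg by eventually_elim (auto simp: indicator_def)
  qed (rule int_\<xi>)
  finally show ?thesis using unb[of 1] by linarith
qed

lemma \<alpha>\<beta>: "0 < \<alpha>" "\<alpha> < \<beta>"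
  using \<mu>_pos b by (auto simp: \<alpha>_def \<beta>_def divide_strict_right_mono)

lemma kk_bounds: "t > 0 \<Longrightarrow> real (kk t) \<le> \<alpha> * t" "t > 0 \<Longrightarrow> \<alpha> * t < real (kk t) + 1"
  and TT_bounds: "t > 0 \<Longrightarrow> real (TT t) \<le> \<beta> * t" "t > 0 \<Longrightarrow> \<beta> * t < real (TT t) + 1"
  using \<alpha>\<beta> by (auto simp: kk_def TT_def of_nat_nat)

lemma ratio_bounds:
  assumes "t > 0" "n \<in> {kk t<..TT t}"
  shows "\<mu> \<le> t / n" "t / n < \<mu> / b" "\<alpha> \<le> n / t" "n / t \<le> \<beta>" "0 < n"
proof -
  show n: "0 < n" using assms by auto
  have 1: "\<alpha> * t < real n" using kk_bounds(2)[OF assms(1)] assms(2) by (auto simp: Suc_le_eq intro: order.strict_trans2)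
  have 2: "real n \<le> \<beta> * t" using TT_bounds(1)[OF assms(1)] assms(2) by (auto intro: order_trans)
  show "\<mu> \<le> t / n" using 2 n \<mu>_pos by (simp add: \<beta>_def field_simps)
  show "t / n < \<mu> / b" using 1 n \<mu>_pos b by (simp add: \<alpha>_def field_simps)
  show "\<alpha> \<le> n / t" using 1 assms by (simp add: field_simps)
  show "n / t \<le> \<beta>" using 2 assms by (simp add: field_simps)
qed

text \<open>For \<open>n > T\<close> the mean of the sum exceeds \<open>t\<close>, so
  \<open>q n t\<close> is bounded below by a constant; this suffices for the \<open>O(t)\<close>
  indices up to \<open>N\<close>. Beyond \<open>N\<close> the defects are geometrically small, so
  the bound is uniform in \<open>j\<close>.\<close>

lemma tail_product:
  "\<exists>C t0. \<forall>t\<ge>t0. \<forall>j. exp (- C * t) \<le> (\<Prod>n\<in>{TT t<..TT t + j}. q n t)"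
proof -
  obtain a D where "tilt_rv M \<xi> (s0 / 2) a (a + 1) D" using base_tilt by auto
  then interpret t: tilt_rv M \<xi> "s0 / 2" a "a + 1" D .
  obtain c n0 where c: "c > 0" and low: "\<And>n t. n \<ge> n0 \<Longrightarrow> t \<le> n * mean 0 \<Longrightarrow> c \<le> q n t"
    using t.q_lower by metis
  have m0: "mean 0 = \<mu>" by (simp add: t.mean_0 \<mu>_def)
  define c' where "c' = - ln (min c 1)"
  have c': "c' \<ge> 0" "exp (- c') \<le> c" using c by (auto simp: c'_def)
  define \<phi> where "\<phi> = Lam (- 1)"
  have \<phi>: "0 < \<phi>" "\<phi> < 1" using Lam_minus_1 by (auto simp: \<phi>_def)
  define l where "l = - ln \<phi>"
  have l: "l > 0" using \<phi> by (simp add: l_def)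
  define C where "C = c' * (2 / l + 2) + 1 / (1 - \<phi>)"
  define t0 where "t0 = max 1 ((real n0 + 1) * \<mu>)"
  have "exp (- C * t) \<le> (\<Prod>n\<in>{TT t<..TT t + j}. q n t)" if t: "t \<ge> t0" for t j
  proof -
    have t1: "t \<ge> 1" and tn: "t \<ge> (real n0 + 1) * \<mu>" using t by (auto simp: t0_def)
    \<comment> \<open>Gives \<open>t + 1 \<le> N * l\<close>, that is
      \<open>exp t * \<phi> ^ N \<le> exp (- 1)\<close>.\<close>
    define N where "N = nat \<lceil>(t + 1) / l\<rceil>"
    have N: "(t + 1) / l \<le> real N" "real N \<le> (t + 1) / l + 1" 
    proof -
      have "0 \<le> (t + 1) / l" using t1 l by simp
      thus "(t + 1) / l \<le> real N" "real N \<le> (t + 1) / l + 1" unfolding N_def by linarith+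
    qed
    define g where "g n = (if n \<le> N then c' else \<phi> ^ (n - N))" for n
    have gq: "exp (- g n) \<le> q n t" if n: "n \<in> {TT t<..TT t + j}" for n
    proof (cases "n \<le> N")
      case True
      have "\<beta> * t < real n" using TT_bounds(2)[of t] t1 n by auto
      hence tm: "t \<le> n * \<mu>" using \<mu>_pos by (simp add: \<beta>_def field_simps)
      hence "(real n0 + 1) * \<mu> \<le> real n * \<mu>" using tn by linarith
      hence "n0 \<le> n" using \<mu>_pos by simp
      with low[of n t] tm m0 c' True show ?thesis by (simp add: g_def)
    next
      case False
      have "exp t * \<phi> ^ N \<le> exp (- 1)"
      proof -
        have "\<phi> ^ N = exp (- (real N * l))" using \<phi> by (simp add: l_def exp_of_nat_mult)
        moreover have "t + 1 \<le> real N * l" using N(1) l by (simp add: divide_le_eq)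
        ultimately show ?thesis by (simp flip: exp_add)
      qed
      also have "exp (- 1 :: real) \<le> 1 / 2"
        using exp_ge_add_one_self[of 1] by (simp add: exp_minus field_simps)
      finally have e: "exp t * \<phi> ^ N \<le> 1 / 2" .
      define u where "u = \<phi> ^ (n - N) / 2"
      have "1 - q n t \<le> exp t * \<phi> ^ n" using one_minus_q_le[of n t] by (simp add: \<phi>_def)
      also have "\<phi> ^ n = \<phi> ^ N * \<phi> ^ (n - N)" using False by (simp flip: power_add)
      also have "exp t * (\<phi> ^ N * \<phi> ^ (n - N)) \<le> 1 / 2 * \<phi> ^ (n - N)"
        unfolding mult.assoc[symmetric] using e \<phi> by (intro mult_right_mono) auto
      finally have q: "1 - u \<le> q n t" by (simp add: u_def)
      have u: "0 \<le> u" "u \<le> 1 / 2" using \<phi> by (auto simp: u_def power_le_one)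
      have "2 * u\<^sup>2 \<le> u" using mult_right_mono[OF u(2) u(1)] by (simp add: power2_eq_square)
      hence "- 2 * u \<le> ln (1 - u)" using ln_one_minus_pos_lower_bound[of u] u by linarith
      moreover have "0 < 1 - u" using u by linarith
      ultimately have "exp (- 2 * u) \<le> 1 - u" using ln_ge_iff by blast
      with q show ?thesis using False by (simp add: g_def u_def)
    qed
    define S where "S = {TT t<..TT t + j}"
    have g_nonneg: "0 \<le> g n" for n using \<phi> c' by (simp add: g_def)
    have "(\<Sum>n\<in>S. g n) \<le> (\<Sum>n\<in>{..N} \<union> {N<..TT t + j}. g n)"
      unfolding S_def by (rule sum_mono2) (auto simp: g_nonneg)
    also have "\<dots> = (\<Sum>n\<in>{..N}. g n) + (\<Sum>n\<in>{N<..TT t + j}. g n)"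
      by (rule sum.union_disjoint) auto
    also have "(\<Sum>n\<in>{..N}. g n) = c' * (real N + 1)" by (simp add: g_def)
    also have "(\<Sum>n\<in>{N<..TT t + j}. g n) = (\<Sum>i\<in>{1..TT t + j - N}. \<phi> ^ i)"
      by (rule sum.reindex_bij_witness[of _ "\<lambda>i. i + N" "\<lambda>n. n - N"]) (auto simp: g_def)
    also have "\<dots> \<le> (\<Sum>i. \<phi> ^ i)"
      by (rule sum_le_suminf) (use \<phi> in \<open>auto simp: summable_geometric\<close>)
    also have "(\<Sum>i. \<phi> ^ i) = 1 / (1 - \<phi>)" using \<phi> by (simp add: suminf_geometric)
    finally have "(\<Sum>n\<in>S. g n) \<le> c' * (real N + 1) + 1 / (1 - \<phi>)" by simp
    also have "\<dots> \<le> c' * ((2 / l + 2) * t) + 1 / (1 - \<phi>) * t"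
    proof (intro add_mono mult_left_mono)
      have "(t + 1) / l \<le> 2 * t / l" using t1 l by (intro divide_right_mono) auto
      thus "real N + 1 \<le> (2 / l + 2) * t" using N(2) t1 by (simp add: distrib_right)
      show "1 / (1 - \<phi>) \<le> 1 / (1 - \<phi>) * t" using \<phi> t1 by (simp add: divide_right_mono)
    qed (use c' in auto)
    also have "\<dots> = C * t" by (simp add: C_def algebra_simps)
    finally have "exp (- C * t) \<le> exp (\<Sum>n\<in>S. - g n)" by (simp add: sum_negf)
    also have "\<dots> = (\<Prod>n\<in>S. exp (- g n))" by (rule exp_sum) (simp add: S_def)
    also have "\<dots> \<le> (\<Prod>n\<in>S. q n t)" unfolding S_def by (intro prod_mono conjI gq) auto
    finally show ?thesis by (simp add: S_def)
  qed
  thus ?thesis by blast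
qed

lemma p_bounds:
  "\<exists>C\<ge>0. \<exists>t0\<ge>1. \<forall>t\<ge>t0. p t > 0 \<and> \<bar>- ln (p t) - (\<Sum>n\<in>{kk t<..TT t}. - ln (q n t))\<bar> \<le> C * t"
proof -
  obtain C1 t1 where tp: "\<And>t j. t \<ge> t1 \<Longrightarrow> exp (- C1 * t) \<le> (\<Prod>n\<in>{TT t<..TT t + j}. q n t)"
    using tail_product by blast
  \<comment> \<open>\<open>t > 1 / (\<beta> - \<alpha>)\<close> forces \<open>k < T\<close>.\<close>
  define t0 where "t0 = max (max 1 t1) (1 / (\<beta> - \<alpha>) + 1)"
  \<comment> \<open>The three losses: \<open>2 ^ T\<close> choices of the counted set,
    \<open>(1 - b) ^ k\<close> for the counted indices, and the product over
    \<open>n > T\<close>.\<close>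
  define C where "C = \<beta> * ln 2 + (\<alpha> * (- ln (1 - b)) + \<bar>C1\<bar>)"
  have lnb: "0 \<le> - ln (1 - b)" using b by simp
  have "p t > 0 \<and> \<bar>- ln (p t) - (\<Sum>n\<in>{kk t<..TT t}. - ln (q n t))\<bar> \<le> C * t" if t: "t \<ge> t0" for t
  proof -
    have tt: "t \<ge> 1" "t \<ge> t1" "t > 1 / (\<beta> - \<alpha>)" using t by (auto simp: t0_def)
    have t0: "t > 0" using tt by simp
    define k T where "k = kk t" and "T = TT t"
    note kb = kk_bounds[OF t0, folded k_def] and Tb = TT_bounds[OF t0, folded T_def]
    have kT: "k < T"
    proof -
      have "1 < (\<beta> - \<alpha>) * t" using tt(3) \<alpha>\<beta> by (simp add: divide_less_eq mult.commute)
      hence "real k < real T" using kb Tb by (simp add: left_diff_distrib)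
      thus ?thesis by simp
    qed
    have qp: "q n t > 0" if "n \<in> {k<..T}" for n using that by (intro q_pos) auto
    define P where "P = (\<Prod>n\<in>{k<..T}. q n t)"
    have P: "P > 0" unfolding P_def by (intro prod_pos qp) auto
    have lnP: "- ln P = (\<Sum>n\<in>{k<..T}. - ln (q n t))"
    proof -
      have "ln P = (\<Sum>n\<in>{k<..T}. ln (q n t))"
        unfolding P_def by (rule ln_prod) (simp, metis less_irrefl qp)
      thus ?thesis by (simp add: sum_negf)
    qed
    have up: "p t \<le> 2 ^ T * P"
    proof -
      have "p t \<le> 2 ^ T * (\<Prod>n\<in>{k<..T}. prob {\<omega> \<in> space M. t < Sh n \<omega>})"
        unfolding p_def k_def[symmetric]
        by (rule counting_upper[OF Sh_ind]) (simp add: Sh_tail q_mono_n)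
      also have "(\<Prod>n\<in>{k<..T}. prob {\<omega> \<in> space M. t < Sh n \<omega>}) = P"
        unfolding P_def by (intro prod.cong Sh_tail) auto
      finally show ?thesis .
    qed
    have low: "(1 - b) ^ k * (P * exp (- C1 * t)) \<le> p t"
      unfolding p_def k_def[symmetric]
    proof (rule counting_lower[OF Sh_ind kT])
      fix j
      have 1: "(1 - b) ^ k \<le> (\<Prod>n\<in>{1..k}. 1 - q n t)"
      proof -
        have "1 - b \<le> 1 - q n t" if "n \<in> {1..k}" for n
        proof -
          have "q n t \<le> n * \<mu> / t" using q_markov[OF int_\<xi> t0, of n] by (simp add: \<mu>_def)
          also have "\<dots> \<le> \<alpha> * t * \<mu> / t"
            using that kb \<mu>_pos t0 by (intro divide_right_mono mult_right_mono) auto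
          also have "\<dots> = b" using \<mu>_pos t0 by (simp add: \<alpha>_def)
          finally show ?thesis by simp
        qed
        hence "(\<Prod>n\<in>{1..k}. 1 - b) \<le> (\<Prod>n\<in>{1..k}. 1 - q n t)" using b by (intro prod_mono) auto
        thus ?thesis by simp
      qed
      have "{k<..T+j} = {k<..T} \<union> {T<..T+j}" using kT by auto
      hence 2: "(\<Prod>n\<in>{k<..T+j}. q n t) = P * (\<Prod>n\<in>{T<..T+j}. q n t)"
        unfolding P_def by (simp add: prod.union_disjoint ivl_disj_int)
      have "(1 - b) ^ k * (P * exp (- C1 * t)) \<le> (\<Prod>n\<in>{1..k}. 1 - q n t) * (\<Prod>n\<in>{k<..T+j}. q n t)"
        unfolding 2 using 1 P b tp[OF tt(2), of j]
        by (intro mult_mono) (auto simp: T_def q_le_1 intro!: prod_nonneg)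
      also have "\<dots> = (\<Prod>n\<in>{1..k}. 1 - prob {\<omega> \<in> space M. t < Sh n \<omega>}) * (\<Prod>n\<in>{k<..T+j}. prob {\<omega> \<in> space M. t < Sh n \<omega>})"
        by (intro arg_cong2[of _ _ _ _ "(*)"] prod.cong) (auto simp: Sh_tail)
      finally show "(1 - b) ^ k * (P * exp (- C1 * t)) \<le> \<dots>" .
    qed
    have L0: "0 < (1 - b) ^ k * (P * exp (- C1 * t))" using P b by simp
    hence pp: "p t > 0" using low by linarith
    have "ln (p t) \<le> ln (2 ^ T * P)" using up pp P by (subst ln_le_cancel_iff) auto
    hence u: "ln (p t) \<le> real T * ln 2 + ln P" using P by (simp add: ln_mult ln_realpow)
    have "ln ((1 - b) ^ k * (P * exp (- C1 * t))) \<le> ln (p t)"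
      using low pp L0 by (subst ln_le_cancel_iff) auto
    hence l: "real k * ln (1 - b) + ln P - C1 * t \<le> ln (p t)" using P b by (simp add: ln_mult ln_realpow)
    have "real T * ln 2 \<le> \<beta> * t * ln 2" using Tb by (intro mult_right_mono) auto
    moreover have "real k * (- ln (1 - b)) \<le> \<alpha> * t * (- ln (1 - b))" using kb lnb by (intro mult_right_mono) auto
    moreover have "C1 * t \<le> \<bar>C1\<bar> * t" using t0 by (intro mult_right_mono) auto
    moreover have "0 \<le> \<beta> * t * ln 2" "0 \<le> \<alpha> * t * (- ln (1 - b))" "0 \<le> \<bar>C1\<bar> * t"
      using \<alpha>\<beta> t0 by (intro mult_nonneg_nonneg lnb; simp)+
    moreover have "C * t = \<beta> * t * ln 2 + \<alpha> * t * (- ln (1 - b)) + \<bar>C1\<bar> * t" by (simp add: C_def algebra_simps)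
    ultimately have "- ln (p t) - (- ln P) \<le> C * t" "- (- ln (p t) - (- ln P)) \<le> C * t"
      using u l by linarith+
    hence "\<bar>- ln (p t) - (- ln P)\<bar> \<le> C * t" by (rule abs_leI)
    thus ?thesis using pp lnP by (simp add: k_def T_def)
  qed
  moreover have "C \<ge> 0" unfolding C_def using \<alpha>\<beta> lnb by (intro add_nonneg_nonneg mult_nonneg_nonneg) auto
  moreover have "t0 \<ge> 1" by (simp add: t0_def)
  ultimately show ?thesis by blast
qed

definition J :: ennreal where "J = (\<integral>\<^sup>+y\<in>{\<alpha>..\<beta>}. ennreal (rate y) \<partial>lborel)"

lemma nn_integral_rate_finite:
  fixes g :: "real \<Rightarrow> real"
  assumes "\<And>x. \<alpha> \<le> x \<Longrightarrow> x \<le> \<beta> \<Longrightarrow> g x \<le> g \<alpha>"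
  shows "(\<integral>\<^sup>+y\<in>{\<alpha>..\<beta>}. ennreal (g y) \<partial>lborel) < \<infinity>"
proof -
  have "(\<integral>\<^sup>+y\<in>{\<alpha>..\<beta>}. ennreal (g y) \<partial>lborel) \<le> (\<integral>\<^sup>+y. ennreal (g \<alpha>) * indicator {\<alpha>..\<beta>} y \<partial>lborel)"
    using assms by (intro nn_integral_mono) (auto simp: indicator_def ennreal_leI)
  also have "\<dots> = ennreal (g \<alpha>) * ennreal (\<beta> - \<alpha>)"
    using \<alpha>\<beta> by (subst nn_integral_cmult_indicator) auto
  also have "\<dots> < \<infinity>" by (simp add: ennreal_mult_less_top)
  finally show ?thesis .
qed

lemma rate_anti: "\<alpha> \<le> x \<Longrightarrow> x \<le> y \<Longrightarrow> rate y \<le> rate x"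
  using \<alpha>\<beta> by (intro rate_antimono unb) auto

lemma rate_nn: "\<alpha> \<le> x \<Longrightarrow> 0 \<le> rate x"
  using \<alpha>\<beta> by (intro rate_nonneg unb) auto

lemma J_finite: "J < \<infinity>"
  unfolding J_def by (rule nn_integral_rate_finite) (use rate_anti in auto)

definition j :: real where "j = enn2real J"

lemma J_j: "J = ennreal j" "j \<ge> 0"
  using J_finite by (auto simp: j_def)

lemma rate_sum:
  assumes t: "t > 0"
  shows "t * j \<le> rate \<alpha> + (\<Sum>n\<in>{kk t<..TT t}. rate (real n / t))"
    and "(\<Sum>n\<in>{kk t<..TT t}. rate (real n / t)) \<le> t * j + rate \<alpha>"
  using antimono_riemann_sum[OF \<alpha>\<beta> t rate_anti rate_nn J_j(1)[unfolded J_def] J_j(2) kk_def TT_def] by auto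

context
  fixes L :: nat
  assumes L: "\<mu> / b < real L"
begin

lemma trunc_mass_\<alpha>: "\<alpha> \<le> x \<Longrightarrow> prob {\<omega> \<in> space M. 1 / x < trunc L \<omega>} > 0"
proof (rule trunc_mass)
  assume "\<alpha> \<le> x"
  hence "1 / x \<le> 1 / \<alpha>" using \<alpha>\<beta> by (intro divide_left_mono) auto
  also have "1 / \<alpha> = \<mu> / b" by (simp add: \<alpha>_def)
  finally show "1 / x < real L" using L by simp
qed

lemma trunc_rate_anti: "\<alpha> \<le> x \<Longrightarrow> x \<le> y \<Longrightarrow> tr.rate L y \<le> tr.rate L x"
  using \<alpha>\<beta> by (intro tr.rate_antimono trunc_mass_\<alpha>) auto

lemma trunc_rate_nn: "\<alpha> \<le> x \<Longrightarrow> 0 \<le> tr.rate L x"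
  using \<alpha>\<beta> by (intro tr.rate_nonneg trunc_mass_\<alpha>) auto

text \<open>A higher truncation level increases \<open>tr.Lam\<close> and so lowers the rate; hence
  the value at \<open>\<alpha>\<close> for one fixed level dominates in
  \<open>Jt_tendsto\<close>.\<close>

lemma trunc_rate_mono_L:
  assumes "\<alpha> \<le> x" "L \<le> L'"
  shows "tr.rate L' x \<le> tr.rate L x"
proof (rule tr.rate_least)
  fix s assume s: "s \<in> tr.dom L'" "0 \<le> s"
  have "ln (tr.Lam L s) \<le> ln (tr.Lam L' s)"
    using s assms tr.Lam_pos[OF trunc_dom] trunc_Lam_mono by simp
  hence "s - x * ln (tr.Lam L' s) \<le> s - x * ln (tr.Lam L s)" using assms \<alpha>\<beta> by simp
  also have "\<dots> \<le> tr.rate L x"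
    by (rule tr.rate_ge) (use assms \<alpha>\<beta> s trunc_mass_\<alpha> trunc_dom in auto)
  finally show "s - x * ln (tr.Lam L' s) \<le> tr.rate L x" .
qed

end

definition Jt :: "nat \<Rightarrow> ennreal" where "Jt L = (\<integral>\<^sup>+y\<in>{\<alpha>..\<beta>}. ennreal (tr.rate L y) \<partial>lborel)"

lemma Jt_tendsto: "Jt \<longlonglongrightarrow> J"
proof -
  \<comment> \<open>From \<open>L1\<close> on \<open>1 / \<alpha> = \<mu> / b < L\<close>, so the
    truncated rates are genuine suprema on \<open>{\<alpha>..\<beta>}\<close>.\<close>
  define L1 where "L1 = nat \<lceil>\<mu> / b\<rceil> + 1"
  have L1: "\<mu> / b < real (L1 + i)" for i unfolding L1_def by linarith
  have "(\<lambda>i. Jt (i + L1)) \<longlonglongrightarrow> J" unfolding Jt_def J_def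
  proof (rule nn_integral_dominated_convergence[where w = "\<lambda>y. ennreal (tr.rate L1 \<alpha>) * indicator {\<alpha>..\<beta>} y"])
    show "(\<lambda>y. ennreal (tr.rate (i + L1) y) * indicator {\<alpha>..\<beta>} y) \<in> borel_measurable lborel" for i
      using antimono_indicator_measurable[OF trunc_rate_anti[OF L1[of i]]] by (simp add: add.commute)
    show "(\<lambda>y. ennreal (rate y) * indicator {\<alpha>..\<beta>} y) \<in> borel_measurable lborel"
      using antimono_indicator_measurable[OF rate_anti] by simp
    show "AE y in lborel. ennreal (tr.rate (i + L1) y) * indicator {\<alpha>..\<beta>} y \<le> ennreal (tr.rate L1 \<alpha>) * indicator {\<alpha>..\<beta>} y" for i
    proof (rule AE_I2)
      fix y
      have "tr.rate (i + L1) y \<le> tr.rate L1 \<alpha>" if "\<alpha> \<le> y"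
        using trunc_rate_mono_L[of L1 y "i + L1"] trunc_rate_anti[of L1 \<alpha> y] L1[of 0] that by simp
      thus "ennreal (tr.rate (i + L1) y) * indicator {\<alpha>..\<beta>} y \<le> ennreal (tr.rate L1 \<alpha>) * indicator {\<alpha>..\<beta>} y"
        by (auto simp: indicator_def ennreal_leI)
    qed
    show "AE y in lborel. (\<lambda>i. ennreal (tr.rate (i + L1) y) * indicator {\<alpha>..\<beta>} y) \<longlonglongrightarrow> ennreal (rate y) * indicator {\<alpha>..\<beta>} y"
    proof (rule AE_I2)
      fix y
      show "(\<lambda>i. ennreal (tr.rate (i + L1) y) * indicator {\<alpha>..\<beta>} y) \<longlonglongrightarrow> ennreal (rate y) * indicator {\<alpha>..\<beta>} y"
      proof (cases "y \<in> {\<alpha>..\<beta>}")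
        case True
        hence "y > 0" using \<alpha>\<beta> by auto
        from LIMSEQ_ignore_initial_segment[OF trunc_rate_tendsto[OF this]] show ?thesis
          using True by (simp add: tendsto_ennrealI)
      qed simp
    qed
    show "(\<integral>\<^sup>+y. ennreal (tr.rate L1 \<alpha>) * indicator {\<alpha>..\<beta>} y \<partial>lborel) < \<infinity>"
      using \<alpha>\<beta> by (subst nn_integral_cmult_indicator) (auto simp: ennreal_mult_less_top)
  qed auto
  thus ?thesis by (rule LIMSEQ_offset)
qed

lemma log_sum_upper:
  assumes low: "\<And>n. n \<in> {kk t<..TT t} \<Longrightarrow> - ln (q n t) \<le> t * r (real n / t) + ln (real n) / 2 + c"
    and c: "c \<ge> 0" and t: "t > 0" and r: "(\<Sum>n\<in>{kk t<..TT t}. r (real n / t)) \<le> t * i + d"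
  shows "(\<Sum>n\<in>{kk t<..TT t}. - ln (q n t)) \<le> t\<^sup>2 * i + t * d + (\<Sum>n\<in>{kk t<..TT t}. ln (real n)) / 2 + \<beta> * c * t"
proof -
  have "(\<Sum>n\<in>{kk t<..TT t}. - ln (q n t)) \<le> (\<Sum>n\<in>{kk t<..TT t}. t * r (real n / t) + ln (real n) / 2 + c)"
    by (intro sum_mono low)
  also have "\<dots> = t * (\<Sum>n\<in>{kk t<..TT t}. r (real n / t)) + (\<Sum>n\<in>{kk t<..TT t}. ln (real n)) / 2 + real (TT t - kk t) * c"
    by (simp add: sum.distrib sum_distrib_left sum_divide_distrib)
  also have "\<dots> \<le> t * (t * i + d) + (\<Sum>n\<in>{kk t<..TT t}. ln (real n)) / 2 + (\<beta> * t) * c"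
    using t c r TT_bounds(1)[OF t] by (intro add_mono mult_left_mono mult_right_mono) auto
  finally show ?thesis by (simp add: power2_eq_square algebra_simps)
qed

text \<open>Chernoff's bound yields the lower limit directly. For the upper limit \<open>L\<close>
  is fixed first, with \<open>Jt L\<close> close to \<open>J\<close>, and only then \<open>t\<close>
  grows; the constants of the tail bound may therefore depend on \<open>L\<close>.\<close>

lemma first_order: "((\<lambda>t. - ln (p t) / t\<^sup>2) \<longlongrightarrow> j) at_top"
proof -
  obtain C t0 where C: "C \<ge> 0" "t0 \<ge> 1" and pb: "\<And>t. t \<ge> t0 \<Longrightarrow> p t > 0"
    "\<And>t. t \<ge> t0 \<Longrightarrow> \<bar>- ln (p t) - (\<Sum>n\<in>{kk t<..TT t}. - ln (q n t))\<bar> \<le> C * t"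
    using p_bounds by metis
  have low: "j - (rate \<alpha> + C) / t \<le> - ln (p t) / t\<^sup>2" if t: "t \<ge> t0" for t
  proof -
    have t': "t > 0" using t C by simp
    have "t * (t * j - rate \<alpha>) \<le> t * (\<Sum>n\<in>{kk t<..TT t}. rate (real n / t))"
      using rate_sum(1)[OF t'] t' by (intro mult_left_mono) auto
    also have "\<dots> \<le> (\<Sum>n\<in>{kk t<..TT t}. - ln (q n t))"
      unfolding sum_distrib_left using t' by (intro sum_mono chernoff_rate q_pos) auto
    finally have "t * (t * j - rate \<alpha>) - C * t \<le> - ln (p t)" using pb(2)[OF t] by (simp add: abs_le_iff)
    hence "(t * (t * j - rate \<alpha>) - C * t) / t\<^sup>2 \<le> - ln (p t) / t\<^sup>2" by (intro divide_right_mono) auto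
    moreover have "(t * (t * j - rate \<alpha>) - C * t) / t\<^sup>2 = j - (rate \<alpha> + C) / t"
      using t' by (simp add: power2_eq_square field_simps)
    ultimately show ?thesis by simp
  qed
  obtain Cl where Cl: "\<And>t. t \<ge> 1 \<Longrightarrow> \<bar>(\<Sum>n\<in>{kk t<..TT t}. ln (real n)) - (\<beta> - \<alpha>) * t * ln t\<bar> \<le> Cl * t"
    using sum_ln_bounds[OF \<alpha>\<beta>] unfolding kk_def TT_def by blast
  have inv: "((\<lambda>t::real. 1 / t) \<longlongrightarrow> 0) at_top" by real_asymp
  show ?thesis
  proof (rule order_tendstoI)
    fix x assume x: "x < j"
    have "((\<lambda>t. j - (rate \<alpha> + C) * (1 / t)) \<longlongrightarrow> j - (rate \<alpha> + C) * 0) at_top"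
      by (intro tendsto_intros inv)
    hence "((\<lambda>t. j - (rate \<alpha> + C) / t) \<longlongrightarrow> j) at_top" by simp
    from order_tendstoD(1)[OF this x] eventually_ge_at_top[of t0]
    show "eventually (\<lambda>t. x < - ln (p t) / t\<^sup>2) at_top"
      by eventually_elim (use low in \<open>auto intro: less_le_trans\<close>)
  next
    fix x assume x: "j < x"
    obtain L0 where L0: "\<And>L. L \<ge> L0 \<Longrightarrow> \<exists>a. \<forall>\<sigma>>0. tilt_rv M (trunc L) \<sigma> a (a + 1) L"
      using tilt_rv_trunc by auto
    have "J < ennreal x" using x J_j by (simp add: ennreal_less_iff)
    from order_tendstoD(2)[OF Jt_tendsto this] obtain L1 where L1: "\<And>L. L \<ge> L1 \<Longrightarrow> Jt L < ennreal x"
      by (auto simp: eventually_sequentially)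
    define L where "L = max (max L0 L1) (nat \<lceil>\<mu> / b\<rceil> + 1)"
    have L: "\<mu> / b < real L" "L \<ge> L0" "L \<ge> L1" unfolding L_def by (auto, linarith)
    obtain a where a: "\<And>\<sigma>. \<sigma> > 0 \<Longrightarrow> tilt_rv M (trunc L) \<sigma> a (a + 1) L" using L0[OF L(2)] by auto
    have "0 \<le> \<mu> / b" using \<mu>_pos b by simp
    \<comment> \<open>A tilt whose mean reaches \<open>\<mu> / b\<close> covers every ratio
      \<open>t / n\<close> with \<open>k < n \<le> T\<close>.\<close>
    from trunc_mean_large[OF L(1) this a] obtain \<sigma> where \<sigma>: "\<sigma> > 0" "\<mu> / b \<le> tr.mean L \<sigma>" by auto
    interpret t: tilt_rv M "trunc L" \<sigma> a "a + 1" L by (rule a[OF \<sigma>(1)])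
    obtain c n0 where c: "c > 0" and ql: "\<And>n t. n \<ge> n0 \<Longrightarrow> t > 0 \<Longrightarrow> tr.mean L 0 \<le> t / n \<Longrightarrow> t / n \<le> tr.mean L \<sigma> \<Longrightarrow>
        exp (- t * tr.rate L (n / t)) * (c / sqrt n) \<le> tr.q L n t"
      using t.q_lower by metis
    \<comment> \<open>Truncation lowers the mean, so ratios \<open>t / n \<ge> \<mu>\<close> satisfy
      the left condition of \<open>q_lower\<close> too.\<close>
    have m0: "tr.mean L 0 \<le> \<mu>"
    proof -
      have "integrable M (trunc L)" using t.int_1s[of 0] \<sigma> by simp
      thus ?thesis unfolding t.mean_0 \<mu>_def by (rule integral_mono[OF _ int_\<xi>]) (simp add: trunc_def)
    qed
    define i where "i = enn2real (Jt L)"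
    have Jt: "Jt L = ennreal i" "i \<ge> 0"
      using nn_integral_rate_finite[of "tr.rate L"] trunc_rate_anti[OF L(1)] by (auto simp: i_def Jt_def)
    have ix: "i < x" using L1[OF L(3)] Jt by (simp add: ennreal_less_iff)
    have rs: "(\<Sum>n\<in>{kk t<..TT t}. tr.rate L (real n / t)) \<le> t * i + tr.rate L \<alpha>" if "t > 0" for t
      using antimono_riemann_sum(2)[OF \<alpha>\<beta> that trunc_rate_anti[OF L(1)] trunc_rate_nn[OF L(1)] Jt(1)[unfolded Jt_def] Jt(2) kk_def TT_def] by auto
    define E where "E = tr.rate L \<alpha> + Cl / 2 + \<beta> * \<bar>ln c\<bar> + C"
    have up: "- ln (p t) / t\<^sup>2 \<le> i + (\<beta> - \<alpha>) / 2 * ln t / t + E / t" if t: "t \<ge> t0" "t \<ge> real (n0 + 1) / \<alpha>" for t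
    proof -
      have t': "t > 0" "t \<ge> 1" using t C by auto
      have *: "- ln (q n t) \<le> t * tr.rate L (real n / t) + ln (real n) / 2 + \<bar>ln c\<bar>" if n: "n \<in> {kk t<..TT t}" for n
      proof -
        note rb = ratio_bounds[OF t'(1) n]
        have "real (n0 + 1) \<le> \<alpha> * t" using t(2) \<alpha>\<beta> by (simp add: divide_le_eq mult.commute)
        also have "\<dots> \<le> real n" using rb(3) t' by (simp add: le_divide_eq)
        finally have "n0 \<le> n" by simp
        hence "exp (- t * tr.rate L (n / t)) * (c / sqrt n) \<le> q n t"
          using ql[of n t] trunc_q_le[of L n t] rb m0 \<sigma>(2) t' by linarith
        thus ?thesis using c rb(5) by (rule neg_ln_le_of_exp_le)
      qed
      define A where "A = (\<Sum>n\<in>{kk t<..TT t}. - ln (q n t))"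
      from log_sum_upper[OF * _ t'(1) rs[OF t'(1)], folded A_def]
      have 1: "A \<le> t\<^sup>2 * i + t * tr.rate L \<alpha> + (\<Sum>n\<in>{kk t<..TT t}. ln (real n)) / 2 + \<beta> * \<bar>ln c\<bar> * t"
        by simp
      have 2: "(\<Sum>n\<in>{kk t<..TT t}. ln (real n)) \<le> (\<beta> - \<alpha>) * t * ln t + Cl * t" using Cl[OF t'(2)] by linarith
      have "- ln (p t) \<le> t\<^sup>2 * i + t * tr.rate L \<alpha> + ((\<beta> - \<alpha>) * t * ln t + Cl * t) / 2 + \<beta> * \<bar>ln c\<bar> * t + C * t"
        using 1 2 abs_le_D1[OF pb(2)[OF t(1), folded A_def]] unfolding add_divide_distrib by linarith
      also have "\<dots> = t\<^sup>2 * (i + (\<beta> - \<alpha>) / 2 * ln t / t + E / t)"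
        using t' by (simp add: E_def power2_eq_square field_simps)
      finally show ?thesis using t' by (subst pos_divide_le_eq) (simp_all only: mult.commute zero_less_power)
    qed
    have "((\<lambda>t::real. ln t / t) \<longlongrightarrow> 0) at_top" by real_asymp
    hence "((\<lambda>t. i + (\<beta> - \<alpha>) / 2 * (ln t / t) + E * (1 / t)) \<longlongrightarrow> i + (\<beta> - \<alpha>) / 2 * 0 + E * 0) at_top"
      by (intro tendsto_intros inv)
    hence "((\<lambda>t. i + (\<beta> - \<alpha>) / 2 * ln t / t + E / t) \<longlongrightarrow> i) at_top" by simp
    from order_tendstoD(2)[OF this ix] eventually_ge_at_top[of t0] eventually_ge_at_top[of "real (n0 + 1) / \<alpha>"]
    show "eventually (\<lambda>t. - ln (p t) / t\<^sup>2 < x) at_top"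
      by eventually_elim (use up in \<open>auto intro: le_less_trans\<close>)
  qed
qed

text \<open>Since a tilted mean of \<open>\<xi>\<close> itself reaches \<open>\<mu> / b\<close>, the
  lower tail bound applies without truncation and the matching upper bound is at hand. What remains
  is to sum the logarithms of \<open>sqrt n\<close> and of \<open>t / n - \<mu>\<close>.\<close>

lemma second_order:
  assumes tilt: "tilt_rv M \<xi> \<sigma> a a' D" and \<sigma>: "\<mu> / b \<le> mean \<sigma>"
  shows "\<exists>C t0. \<forall>t\<ge>t0. \<bar>- ln (p t) - (t\<^sup>2 * j + (1 - b) / (2 * \<mu>) * t * ln t)\<bar> \<le> C * t"
proof -
  interpret t: tilt_rv M \<xi> \<sigma> a a' D by (rule tilt)
  obtain C t0 where C: "C \<ge> 0" "t0 \<ge> 1" and pb: "\<And>t. t \<ge> t0 \<Longrightarrow> p t > 0"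
    "\<And>t. t \<ge> t0 \<Longrightarrow> \<bar>- ln (p t) - (\<Sum>n\<in>{kk t<..TT t}. - ln (q n t))\<bar> \<le> C * t"
    using p_bounds by metis
  obtain Cl where Cl: "\<And>t. t \<ge> 1 \<Longrightarrow> \<bar>(\<Sum>n\<in>{kk t<..TT t}. ln (real n)) - (\<beta> - \<alpha>) * t * ln t\<bar> \<le> Cl * t"
    using sum_ln_bounds[OF \<alpha>\<beta>] unfolding kk_def TT_def by blast
  obtain c n0 where c: "c > 0" and ql: "\<And>n t. n \<ge> n0 \<Longrightarrow> t > 0 \<Longrightarrow> mean 0 \<le> t / n \<Longrightarrow> t / n \<le> mean \<sigma> \<Longrightarrow>
      exp (- t * rate (n / t)) * (c / sqrt n) \<le> q n t"
    using t.q_lower by metis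
  obtain K where K: "K > 0" and qu: "\<And>n t. n \<ge> 1 \<Longrightarrow> t > 0 \<Longrightarrow> mean 0 < t / n \<Longrightarrow> t / n \<le> mean \<sigma> \<Longrightarrow>
      q n t \<le> exp (- t * rate (n / t)) * (K / ((t / n - mean 0) * sqrt n))"
    using t.q_upper by metis
  have m0: "mean 0 = \<mu>" by (simp add: t.mean_0 \<mu>_def)
  define d where "d = \<bar>ln (K / \<mu>)\<bar>"
  define E1 where "E1 = rate \<alpha> + Cl / 2 + \<beta> * \<bar>ln c\<bar> + C"
  define E2 where "E2 = rate \<alpha> + Cl / 2 + \<beta> * d + 2 * \<beta> + C"
  have "\<bar>- ln (p t) - (t\<^sup>2 * j + (1 - b) / (2 * \<mu>) * t * ln t)\<bar> \<le> max E1 E2 * t"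
    if t: "t \<ge> max t0 (real (n0 + 1) / \<alpha>)" for t
  proof -
    have tt: "t \<ge> t0" "t > 0" "t \<ge> 1" "t \<ge> real (n0 + 1) / \<alpha>" using t C by auto
    define T where "T = TT t"
    define S where "S = {kk t<..TT t}"
    define l where "l = (\<Sum>n\<in>S. ln (real n))"
    define A where "A = (\<Sum>n\<in>S. - ln (q n t))"
    have half: "(1 - b) / (2 * \<mu>) * t * ln t = (\<beta> - \<alpha>) * t * ln t / 2"
      by (simp add: \<alpha>_def \<beta>_def diff_divide_distrib left_diff_distrib)
    have l: "\<bar>l / 2 - (1 - b) / (2 * \<mu>) * t * ln t\<bar> \<le> Cl / 2 * t"
    proof -
      have e: "l / 2 - (\<beta> - \<alpha>) * t * ln t / 2 = (l - (\<beta> - \<alpha>) * t * ln t) / 2" by (simp add: diff_divide_distrib)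
      show ?thesis unfolding half e using Cl[OF tt(3)] by (simp add: l_def S_def)
    qed
    have "- ln (q n t) \<le> t * rate (real n / t) + ln (real n) / 2 + \<bar>ln c\<bar>" if n: "n \<in> {kk t<..TT t}" for n
    proof -
      note rb = ratio_bounds[OF tt(2) n]
      have "real (n0 + 1) \<le> \<alpha> * t" using tt(4) \<alpha>\<beta> by (simp add: divide_le_eq mult.commute)
      also have "\<dots> \<le> real n" using rb(3) tt by (simp add: le_divide_eq)
      finally have "n0 \<le> n" by simp
      hence "exp (- t * rate (n / t)) * (c / sqrt n) \<le> q n t"
        using ql[of n t] rb m0 \<sigma> tt by linarith
      thus ?thesis using c rb(5) by (rule neg_ln_le_of_exp_le)
    qed
    from log_sum_upper[OF this _ tt(2) rate_sum(2)[OF tt(2)]]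
    have up: "A \<le> t\<^sup>2 * j + t * rate \<alpha> + l / 2 + \<beta> * \<bar>ln c\<bar> * t" by (simp add: A_def S_def l_def)
    \<comment> \<open>The loss caused by the factor \<open>1 / (t / n - \<mu>)\<close>. At
      \<open>n = T\<close> the ratio \<open>t / n\<close> may equal \<open>\<mu>\<close>; there
      plain Chernoff is used, and \<open>w T\<close> cancels the missing
      \<open>ln T / 2\<close>.\<close>
    define w where "w n = (if n = T then ln (real T) / 2 else ln (real T / (real T - real n)))" for n
    have "t * rate (real n / t) + ln (real n) / 2 - d - w n \<le> - ln (q n t)" if n: "n \<in> S" for n
    proof (cases "n = T")
      case True
      have "t * rate (real n / t) \<le> - ln (q n t)"
        using ratio_bounds(5)[OF tt(2), of n] n tt(2) by (intro chernoff_rate q_pos) (auto simp: S_def)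
      thus ?thesis using True by (simp add: w_def d_def)
    next
      case False
      note rb = ratio_bounds[OF tt(2) n[unfolded S_def]]
      have nT: "n < T" using n False by (auto simp: S_def T_def)
      \<comment> \<open>From \<open>T * \<mu> \<le> t\<close> follows
        \<open>t / n - \<mu> \<ge> \<mu> * (T - n) / n \<ge> g\<close>, and
        \<open>ln g = ln \<mu> - w n\<close>.\<close>
      define g where "g = \<mu> * (real T - real n) / real T"
      have g0: "g > 0" using nT \<mu>_pos by (simp add: g_def)
      have "real T * \<mu> \<le> t" using TT_bounds(1)[OF tt(2)] \<mu>_pos by (simp add: T_def \<beta>_def field_simps)
      hence "\<mu> * (real T - real n) / real n \<le> t / n - \<mu>"
        using rb(5) by (simp add: field_simps)
      moreover have "g \<le> \<mu> * (real T - real n) / real n"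
        unfolding g_def using nT rb(5) \<mu>_pos by (intro divide_left_mono) auto
      ultimately have g: "g \<le> t / n - mean 0" by (simp add: m0)
      have "q n t \<le> exp (- t * rate (n / t)) * (K / ((t / n - mean 0) * sqrt n))"
        using rb g g0 \<sigma> tt by (intro qu) auto
      also have "\<dots> \<le> exp (- t * rate (n / t)) * (K / (g * sqrt n))"
        using K g g0 rb(5) by (intro mult_left_mono divide_left_mono mult_right_mono mult_pos_pos) auto
      finally have "ln (q n t) \<le> ln (exp (- t * rate (n / t)) * (K / (g * sqrt n)))"
        using q_pos[of n t] rb(5) K g0 by (subst ln_le_cancel_iff) auto
      also have "\<dots> = - t * rate (n / t) + (ln K - (ln g + ln (real n) / 2))"
        using K g0 rb(5) by (simp add: ln_mult ln_div ln_sqrt)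
      also have "ln g = ln \<mu> - w n"
        using nT \<mu>_pos by (simp add: g_def w_def ln_mult ln_div)
      finally show ?thesis using K \<mu>_pos by (simp add: d_def ln_div)
    qed
    hence "(\<Sum>n\<in>S. t * rate (real n / t) + ln (real n) / 2 - d - w n) \<le> A"
      unfolding A_def by (rule sum_mono)
    moreover have "(\<Sum>n\<in>S. t * rate (real n / t) + ln (real n) / 2 - d - w n) = t * (\<Sum>n\<in>S. rate (real n / t)) + l / 2 - real (card S) * d - (\<Sum>n\<in>S. w n)"
      by (simp add: sum.distrib sum_subtractf sum_distrib_left sum_divide_distrib l_def)
    moreover have "t * (t * j - rate \<alpha>) \<le> t * (\<Sum>n\<in>S. rate (real n / t))"
      using rate_sum(1)[OF tt(2)] tt(2) unfolding S_def by (intro mult_left_mono) auto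
    moreover have T\<beta>: "real T \<le> \<beta> * t" unfolding T_def by (rule TT_bounds(1)[OF tt(2)])
    have "real (card S) * d \<le> (\<beta> * t) * d"
      using T\<beta> unfolding S_def T_def d_def by (intro mult_right_mono) auto
    moreover have "(\<Sum>n\<in>S. w n) \<le> 2 * (\<beta> * t)"
    proof -
      have "(\<Sum>n\<in>S. w n) \<le> (\<Sum>n\<in>{kk t<..<T}. w n) + real T"
      proof (cases "kk t < T")
        case True
        hence "S = insert T {kk t<..<T}" unfolding S_def T_def by auto
        moreover have "w T \<le> real T" using ln_le_minus_one[of "real T"] True by (simp add: w_def)
        ultimately show ?thesis by simp
      next
        case False
        thus ?thesis by (simp add: S_def T_def)
      qed
      also have "(\<Sum>n\<in>{kk t<..<T}. w n) = (\<Sum>n\<in>{kk t<..<T}. ln (real T / (real T - real n)))"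
        by (intro sum.cong) (auto simp: w_def)
      also have "\<dots> \<le> real T" by (rule sum_ln_ratio)
      finally show ?thesis using T\<beta> by simp
    qed
    ultimately have low: "t * (t * j - rate \<alpha>) + l / 2 - \<beta> * t * d - 2 * (\<beta> * t) \<le> A" by linarith
    have pA: "\<bar>- ln (p t) - A\<bar> \<le> C * t" using pb(2)[OF tt(1)] by (simp add: A_def S_def)
    have "- ln (p t) - (t\<^sup>2 * j + (1 - b) / (2 * \<mu>) * t * ln t) \<le> E1 * t"
    proof -
      have "E1 * t = t * rate \<alpha> + Cl / 2 * t + \<beta> * \<bar>ln c\<bar> * t + C * t" by (simp add: E1_def algebra_simps)
      thus ?thesis using up abs_le_D1[OF l] abs_le_D1[OF pA] by linarith
    qed
    moreover have "- (- ln (p t) - (t\<^sup>2 * j + (1 - b) / (2 * \<mu>) * t * ln t)) \<le> E2 * t"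
    proof -
      have "E2 * t = t * rate \<alpha> + Cl / 2 * t + \<beta> * t * d + 2 * (\<beta> * t) + C * t" by (simp add: E2_def algebra_simps)
      moreover have "t * (t * j - rate \<alpha>) = t\<^sup>2 * j - t * rate \<alpha>" by (simp add: right_diff_distrib power2_eq_square)
      ultimately show ?thesis using low abs_le_D2[OF l] abs_le_D2[OF pA] by linarith
    qed
    moreover have "E1 * t \<le> max E1 E2 * t" "E2 * t \<le> max E1 E2 * t" using tt(2) by (auto intro!: mult_right_mono)
    ultimately show ?thesis by (simp add: abs_le_iff)
  qed
  thus ?thesis by blast
qed

end

section \<open>Cumulant generating function and the theorem\<close>

context tilt_rv
begin

text \<open>Convexity makes the pointwise remainder nonnegative and, applied from the other end
  point, at most \<open>(u - s) * x * (exp (u * x) - exp (s * x))\<close>;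
  \<open>exp_diff_bound\<close> then supplies the second factor \<open>u - s\<close>.\<close>

lemma Lam_taylor:
  assumes "s \<le> \<sigma>" "u \<le> \<sigma>"
  shows "\<bar>Lam u - Lam s - (u - s) * (\<integral>\<omega>. \<xi> \<omega> * exp (s * \<xi> \<omega>) \<partial>M)\<bar> \<le> (u - s)\<^sup>2 * C2"
proof -
  have "Lam u - Lam s - (u - s) * (\<integral>\<omega>. \<xi> \<omega> * exp (s * \<xi> \<omega>) \<partial>M) =
      (\<integral>\<omega>. exp (u * \<xi> \<omega>) - exp (s * \<xi> \<omega>) - (u - s) * (\<xi> \<omega> * exp (s * \<xi> \<omega>)) \<partial>M)"
    using s_dom[OF assms(1)] s_dom[OF assms(2)] int_1s[OF assms(1)] by (simp add: Lam_def dom_def)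
  also have "\<bar>\<dots>\<bar> \<le> (\<integral>\<omega>. (u - s)\<^sup>2 * ((\<xi> \<omega>)\<^sup>2 * exp (\<sigma> * \<xi> \<omega>)) \<partial>M)"
  proof (rule abs_integral_le_AE)
    show "AE \<omega> in M. \<bar>exp (u * \<xi> \<omega>) - exp (s * \<xi> \<omega>) - (u - s) * (\<xi> \<omega> * exp (s * \<xi> \<omega>))\<bar> \<le> (u - s)\<^sup>2 * ((\<xi> \<omega>)\<^sup>2 * exp (\<sigma> * \<xi> \<omega>))"
      using \<xi>_nonneg
    proof eventually_elim
      case (elim \<omega>)
      define x where "x = \<xi> \<omega>"
      have lin: "(v - w) * x * exp (w * x) \<le> exp (v * x) - exp (w * x)" for v w
      proof -
        have "exp (w * x) * (1 + (v - w) * x) \<le> exp (w * x) * exp ((v - w) * x)"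
          by (intro mult_left_mono exp_ge_add_one_self) auto
        also have "\<dots> = exp (v * x)" by (simp add: algebra_simps flip: exp_add)
        finally show ?thesis by (simp add: algebra_simps)
      qed
      have 1: "0 \<le> exp (u * x) - exp (s * x) - (u - s) * (x * exp (s * x))"
        using lin[of u s] by (simp add: mult.assoc)
      have "exp (u * x) - exp (s * x) - (u - s) * (x * exp (s * x)) \<le> (u - s) * x * (exp (u * x) - exp (s * x))"
        using lin[of s u] by (simp add: algebra_simps)
      also have "\<dots> \<le> \<bar>(u - s) * x * (exp (u * x) - exp (s * x))\<bar>" by simp
      also have "\<dots> = \<bar>u - s\<bar> * x * \<bar>exp (u * x) - exp (s * x)\<bar>" using elim by (simp add: abs_mult x_def)
      also have "\<dots> \<le> \<bar>u - s\<bar> * x * (\<bar>u - s\<bar> * (x * exp (\<sigma> * x)))"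
        using elim assms by (intro mult_left_mono exp_diff_bound) (auto simp: x_def)
      also have "\<dots> = (u - s)\<^sup>2 * (x\<^sup>2 * exp (\<sigma> * x))" by (simp add: power2_eq_square mult_ac flip: abs_mult)
      finally show ?case using 1 by (simp add: x_def)
    qed
  qed (use s_dom[OF assms(1)] s_dom[OF assms(2)] int_1s[OF assms(1)] int2 in \<open>auto simp: dom_def\<close>)
  finally show ?thesis by (simp add: C2_def)
qed

text \<open>Links \<open>tilted_mean\<close>, defined through \<open>deriv\<close>, to the integral
  in \<open>mean\<close>. The strict \<open>s < \<sigma>\<close> leaves room for a two-sided
  difference quotient.\<close>

lemma DERIV_mgf:
  assumes "0 \<le> s" "s < \<sigma>"
  shows "((\<lambda>u. enn2real (mgf M \<xi> u)) has_real_derivative (\<integral>\<omega>. \<xi> \<omega> * exp (s * \<xi> \<omega>) \<partial>M)) (at s)"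
  unfolding DERIV_def
proof (rule LIM_zero_cancel, rule Lim_null_comparison)
  let ?N = "\<integral>\<omega>. \<xi> \<omega> * exp (s * \<xi> \<omega>) \<partial>M"
  have mgf: "enn2real (mgf M \<xi> u) = Lam u" if "u \<le> \<sigma>" for u
    using Lam_nn[OF s_dom[OF that]] Lam_pos[OF s_dom[OF that]] by (simp add: mgf_def)
  show "eventually (\<lambda>h. norm ((enn2real (mgf M \<xi> (s + h)) - enn2real (mgf M \<xi> s)) / h - ?N) \<le> \<bar>h\<bar> * C2) (at 0)"
    unfolding eventually_at
  proof (intro exI[of _ "\<sigma> - s"] conjI ballI impI)
    fix h :: real assume h: "h \<noteq> 0 \<and> dist h 0 < \<sigma> - s"
    hence "s + h \<le> \<sigma>" "h \<noteq> 0" by auto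
    have "(Lam (s + h) - Lam s) / h - ?N = (Lam (s + h) - Lam s - h * ?N) / h"
      using \<open>h \<noteq> 0\<close> by (simp add: diff_divide_distrib)
    also have "\<bar>\<dots>\<bar> \<le> h\<^sup>2 * C2 / \<bar>h\<bar>"
      unfolding abs_divide using Lam_taylor[of s "s + h"] \<open>s + h \<le> \<sigma>\<close> assms by (intro divide_right_mono) auto
    also have "\<dots> = \<bar>h\<bar> * C2" using \<open>h \<noteq> 0\<close> by (simp add: power2_eq_square abs_if)
    finally show "norm ((enn2real (mgf M \<xi> (s + h)) - enn2real (mgf M \<xi> s)) / h - ?N) \<le> \<bar>h\<bar> * C2"
      using \<open>s + h \<le> \<sigma>\<close> assms by (simp add: mgf)
  qed (use assms in auto)
  show "((\<lambda>h. \<bar>h\<bar> * C2) \<longlongrightarrow> 0) (at 0)" by (auto intro!: tendsto_eq_intros)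
qed

lemma tilted_mean_eq: "0 \<le> s \<Longrightarrow> s < \<sigma> \<Longrightarrow> tilted_mean M \<xi> s = mean s"
  unfolding tilted_mean_def mean_def
  using DERIV_imp_deriv[OF DERIV_mgf[of s]] Lam_nn[OF s_dom[of s]] Lam_pos[OF s_dom[of s]] by (simp add: mgf_def)

text \<open>\<open>exp ((u - s) * z)\<close> and \<open>z\<close> increase together, so the product
  of their deviations from the values at \<open>z = m\<close> is nonnegative. Integrating it against
  \<open>exp (s * \<xi>)\<close> avoids second derivatives of \<open>ln Lam\<close>.\<close>

lemma mean_mono:
  assumes "s \<le> u" "u \<le> \<sigma>"
  shows "mean s \<le> mean u"
proof -
  define m where "m = mean s"
  have s: "s \<le> \<sigma>" using assms by simp
  have L: "Lam s > 0" "Lam u > 0" using s assms by (auto intro!: Lam_pos s_dom)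
  have num: "(\<integral>\<omega>. \<xi> \<omega> * exp (s * \<xi> \<omega>) \<partial>M) = m * Lam s" using L by (simp add: m_def mean_def)
  note ints = s_dom[OF s, unfolded dom_def mem_Collect_eq] s_dom[OF assms(2), unfolded dom_def mem_Collect_eq] int_1s[OF s] int_1s[OF assms(2)]
  have "0 \<le> (\<integral>\<omega>. (\<xi> \<omega> * exp (u * \<xi> \<omega>) - m * exp (u * \<xi> \<omega>)) - exp ((u - s) * m) * (\<xi> \<omega> * exp (s * \<xi> \<omega>) - m * exp (s * \<xi> \<omega>)) \<partial>M)"
  proof (rule integral_nonneg_AE, rule AE_I2)
    fix \<omega>
    have "0 \<le> (exp ((u - s) * \<xi> \<omega>) - exp ((u - s) * m)) * (\<xi> \<omega> - m)"
    proof (cases "m \<le> \<xi> \<omega>")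
      case True
      thus ?thesis using assms by (intro mult_nonneg_nonneg) (auto intro!: mult_left_mono)
    next
      case False
      thus ?thesis using assms by (intro mult_nonpos_nonpos) (auto intro!: mult_left_mono)
    qed
    hence "0 \<le> exp (s * \<xi> \<omega>) * ((exp ((u - s) * \<xi> \<omega>) - exp ((u - s) * m)) * (\<xi> \<omega> - m))" by simp
    also have "\<dots> = (exp (s * \<xi> \<omega>) * exp ((u - s) * \<xi> \<omega>)) * (\<xi> \<omega> - m) - exp ((u - s) * m) * (\<xi> \<omega> * exp (s * \<xi> \<omega>) - m * exp (s * \<xi> \<omega>))"
      by (simp add: algebra_simps)
    also have "exp (s * \<xi> \<omega>) * exp ((u - s) * \<xi> \<omega>) = exp (u * \<xi> \<omega>)" by (simp add: algebra_simps flip: exp_add)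
    finally show "0 \<le> (\<xi> \<omega> * exp (u * \<xi> \<omega>) - m * exp (u * \<xi> \<omega>)) - exp ((u - s) * m) * (\<xi> \<omega> * exp (s * \<xi> \<omega>) - m * exp (s * \<xi> \<omega>))"
      by (simp add: algebra_simps)
  qed
  also have "\<dots> = (\<integral>\<omega>. \<xi> \<omega> * exp (u * \<xi> \<omega>) \<partial>M) - m * Lam u - exp ((u - s) * m) * ((\<integral>\<omega>. \<xi> \<omega> * exp (s * \<xi> \<omega>) \<partial>M) - m * Lam s)"
    using ints by (simp add: Lam_def)
  finally have "m * Lam u \<le> (\<integral>\<omega>. \<xi> \<omega> * exp (u * \<xi> \<omega>) \<partial>M)" by (simp add: num)
  thus ?thesis using L by (simp add: m_def mean_def le_divide_eq)
qed

end

section \<open>Identification with the Legendre transform and with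
  \<open>tilted_mean_sup\<close>\<close>

context decoupled_rv
begin

lemma mgf_eq: "s \<in> dom \<Longrightarrow> mgf M \<xi> s = ennreal (Lam s)"
  by (simp add: mgf_def Lam_nn)

lemma mgf_infinite: "s \<notin> dom \<Longrightarrow> mgf M \<xi> s = \<infinity>"
proof (rule ccontr)
  assume "s \<notin> dom" "mgf M \<xi> s \<noteq> \<infinity>"
  hence "integrable M (\<lambda>\<omega>. exp (s * \<xi> \<omega>))"
    by (intro integrableI_nonneg) (auto simp: mgf_def less_top)
  with \<open>s \<notin> dom\<close> show False by (simp add: dom_def)
qed

lemma mgf_domain_eq: "mgf_domain M \<xi> = {s \<in> dom. 0 \<le> s}"
  using mgf_eq mgf_infinite by (auto simp: mgf_domain_def) (metis less_irrefl)

lemma exponent_value: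
  "ereal (s * x) - extended_ln (mgf M \<xi> s) = (if s \<in> dom then ereal (s * x - ln (Lam s)) else - \<infinity>)"
  using Lam_pos[of s] by (auto simp: extended_ln_def mgf_eq mgf_infinite)

text \<open>Exponents \<open>s < 0\<close> contribute at most 0: Jensen gives
  \<open>Lam s \<ge> exp (s * \<mu>)\<close>, and \<open>1 / y \<ge> \<mu>\<close>. As
  \<open>s = 0\<close> contributes exactly 0, the supremum over \<open>s \<ge> 0\<close>
  decides.\<close>

lemma rate_fun_eq:
  assumes y: "0 < y" "y \<le> \<beta>"
  shows "rate_fun M \<xi> (1 / y) = ereal (rate y / y)"
proof -
  define R where "R = rate_fun M \<xi> (1 / y)"
  have R: "R = (SUP s. ereal (s * (1 / y)) - extended_ln (mgf M \<xi> s))"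
    by (simp add: R_def rate_fun_def legendre_def)
  have rn: "0 \<le> rate y" using y by (intro rate_nonneg unb) auto
  have "ereal (s * (1 / y)) - extended_ln (mgf M \<xi> s) \<le> ereal (rate y / y)" for s
  proof (cases "s \<in> dom")
    case True
    have "s * (1 / y) - ln (Lam s) \<le> rate y / y"
    proof (cases "s \<ge> 0")
      case s: True
      have "s - y * ln (Lam s) \<le> rate y" by (rule rate_ge) (use y unb True s in auto)
      hence "(s - y * ln (Lam s)) / y \<le> rate y / y" using y by (intro divide_right_mono) auto
      thus ?thesis using y by (simp add: diff_divide_distrib)
    next
      case False
      have "exp (s * \<mu>) = (\<integral>\<omega>. exp (s * \<mu>) * (1 + s * (\<xi> \<omega> - \<mu>)) \<partial>M)"
        using int_\<xi> by (simp add: prob_space \<mu>_def)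
      also have "\<dots> \<le> Lam s" unfolding Lam_def
      proof (rule integral_mono)
        fix \<omega>
        have "exp (s * \<mu>) * (1 + s * (\<xi> \<omega> - \<mu>)) \<le> exp (s * \<mu>) * exp (s * (\<xi> \<omega> - \<mu>))"
          by (intro mult_left_mono exp_ge_add_one_self) auto
        thus "exp (s * \<mu>) * (1 + s * (\<xi> \<omega> - \<mu>)) \<le> exp (s * \<xi> \<omega>)"
          by (simp add: algebra_simps flip: exp_add)
      qed (use True int_\<xi> in \<open>auto simp: dom_def\<close>)
      finally have "ln (exp (s * \<mu>)) \<le> ln (Lam s)" using Lam_pos[OF True] by (subst ln_le_cancel_iff) auto
      moreover have "\<mu> \<le> 1 / y" using y \<mu>_pos by (simp add: \<beta>_def field_simps)
      hence "s * (1 / y) \<le> s * \<mu>" using False by (intro mult_left_mono_neg) auto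
      ultimately have "s * (1 / y) - ln (Lam s) \<le> 0" by simp
      also have "0 \<le> rate y / y" using rn y by simp
      finally show ?thesis .
    qed
    thus ?thesis using True by (simp only: exponent_value if_True ereal_less_eq)
  next
    case False
    thus ?thesis by (simp only: exponent_value if_False) simp
  qed
  hence le: "R \<le> ereal (rate y / y)" unfolding R by (intro SUP_least)
  have ge: "ereal (s * (1 / y) - ln (Lam s)) \<le> R" if "s \<in> dom" for s
    unfolding R by (rule SUP_upper2[of s]) (simp_all only: exponent_value that if_True order_refl UNIV_I)
  from ge[OF zero_dom] have "0 \<le> R" by (simp add: Lam_0 zero_ereal_def)
  with le obtain r where r: "R = ereal r" by (cases R) auto
  have "rate y \<le> y * r"
  proof (rule rate_least)
    fix s assume "s \<in> dom" "0 \<le> s"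
    from ge[OF this(1)] have "s * (1 / y) - ln (Lam s) \<le> r" by (simp add: r)
    hence "y * (s * (1 / y) - ln (Lam s)) \<le> y * r" using y by (intro mult_left_mono) auto
    thus "s - y * ln (Lam s) \<le> y * r" using y by (simp add: right_diff_distrib)
  qed
  hence "rate y / y \<le> r" using y by (simp add: divide_le_eq mult.commute)
  with le r show ?thesis by (simp add: R_def)
qed

lemma rate_integral_eq: "rate_integral M \<xi> \<alpha> \<beta> = J"
  unfolding rate_integral_def J_def
proof (intro nn_integral_cong)
  fix y
  show "ennreal y * e2ennreal (rate_fun M \<xi> (1 / y)) * indicator {\<alpha>..\<beta>} y = ennreal (rate y) * indicator {\<alpha>..\<beta>} y"
  proof (cases "y \<in> {\<alpha>..\<beta>}")
    case True
    hence y: "0 < y" "y \<le> \<beta>" using \<alpha>\<beta> by auto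
    have "ennreal y * ennreal (rate y / y) = ennreal (y * (rate y / y))"
      using y rate_nn[of y] True by (intro ennreal_mult[symmetric]) auto
    thus ?thesis using y by (simp add: rate_fun_eq)
  qed simp
qed

text \<open>Monotonicity identifies the limit at \<open>B\<close> with the supremum of
  \<open>mean\<close> over the exponents between 0 and \<open>B\<close>. A point of this open
  interval with mean above \<open>x\<close> lies strictly inside \<open>dom\<close>, so it admits a
  tilt.\<close>

lemma exists_large_tilt:
  assumes "ereal x < tilted_mean_sup M \<xi>"
  shows "\<exists>\<sigma> a a' D. tilt_rv M \<xi> \<sigma> a a' D \<and> x \<le> mean \<sigma>"
proof -
  define B where "B = mgf_bound M \<xi>"
  \<comment> \<open>\<open>B\<close> may be infinite; pulling left neighbourhoods back from
    \<open>ereal\<close> treats both cases alike.\<close>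
  define F where "F = filtercomap ereal (at_left B)"
  define I where "I = {s. 0 < s \<and> ereal s < B}"
  have above: "\<exists>u\<in>dom. s < u" if "ereal s < B" for s
    using that unfolding B_def mgf_bound_def mgf_domain_eq by (auto simp: less_SUP_iff)
  have tilt: "\<exists>u a D. s < u \<and> ereal u < B \<and> tilt_rv M \<xi> u a (a + 1) D" if s: "s \<in> I" for s
  proof -
    obtain u where u: "u \<in> dom" "s < u" using above s by (auto simp: I_def)
    define v where "v = (s + u) / 2"
    have v: "s < v" "v < u" using u by (auto simp: v_def)
    have "u \<in> mgf_domain M \<xi>" using u s by (simp add: mgf_domain_eq I_def)
    hence "ereal u \<le> B" unfolding B_def mgf_bound_def by (rule SUP_upper)
    hence "ereal v < B" using v by (meson less_ereal.simps(1) less_le_trans)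
    moreover obtain a D where "tilt_rv M \<xi> v a (a + 1) D"
      using tilt_rv_exists[OF u(1), of v] v s by (auto simp: I_def)
    ultimately show ?thesis using v by blast
  qed
  have tm: "tilted_mean M \<xi> s = mean s" if s: "s \<in> I" for s
  proof -
    obtain u a D where u: "s < u" "tilt_rv M \<xi> u a (a + 1) D" using tilt[OF s] by auto
    interpret t: tilt_rv M \<xi> u a "a + 1" D by (rule u)
    show ?thesis using t.tilted_mean_eq[of s] s u by (simp add: I_def)
  qed
  have mm: "mean s \<le> mean s'" if s: "s \<in> I" "s' \<in> I" "s \<le> s'" for s s'
  proof -
    obtain u a D where u: "s' < u" "tilt_rv M \<xi> u a (a + 1) D" using tilt[OF s(2)] by auto
    interpret t: tilt_rv M \<xi> u a "a + 1" D by (rule u)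
    show ?thesis using t.mean_mono[of s s'] s u by simp
  qed
  have "ereal (s0 / 2) < ereal s0" using s0 by simp
  also have "ereal s0 \<le> B" unfolding B_def mgf_bound_def using s0 by (intro SUP_upper) (simp add: mgf_domain_eq)
  finally have I0: "s0 / 2 \<in> I" using s0 by (simp add: I_def)
  have ev: "eventually P F" if "s1 \<in> I" "\<And>s. s1 < s \<Longrightarrow> s \<in> I \<Longrightarrow> P s" for P s1
  proof -
    have "eventually (\<lambda>z. ereal s1 < z \<and> z < B) (at_left B)"
      using that(1) by (subst eventually_at_left[of "ereal s1"]) (auto simp: I_def)
    thus ?thesis unfolding F_def eventually_filtercomap
      using that by (intro exI[of _ "\<lambda>z. ereal s1 < z \<and> z < B"]) (auto simp: I_def)
  qed
  \<comment> \<open>\<open>Lim\<close> is determined by convergence only along a nontrivial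
    filter.\<close>
  have nb: "F \<noteq> bot" unfolding F_def
  proof (rule filtercomap_neq_bot)
    fix P assume "eventually P (at_left B)"
    moreover have "ereal (s0 / 2) < B" using I0 by (simp add: I_def)
    ultimately obtain c where c: "c < B" "\<And>z. c < z \<Longrightarrow> z < B \<Longrightarrow> P z"
      by (subst (asm) eventually_at_left) auto
    obtain z where "c < ereal z" "ereal z < B" using ereal_dense2[OF c(1)] by auto
    thus "\<exists>x. P (ereal x)" using c by auto
  qed
  define S where "S = (SUP s\<in>I. ereal (mean s))"
  have "((\<lambda>s. ereal (tilted_mean M \<xi> s)) \<longlongrightarrow> S) F"
  proof (rule order_tendstoI)
    fix a assume "a < S"
    then obtain s1 where s1: "s1 \<in> I" "a < ereal (mean s1)" by (auto simp: S_def less_SUP_iff)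
    show "eventually (\<lambda>s. a < ereal (tilted_mean M \<xi> s)) F"
    proof (rule ev[OF s1(1)])
      fix s assume s: "s1 < s" "s \<in> I"
      have "ereal (mean s1) \<le> ereal (mean s)" using mm[OF s1(1) s(2)] s by simp
      thus "a < ereal (tilted_mean M \<xi> s)" using s1 tm[OF s(2)] by (simp add: less_le_trans)
    qed
  next
    fix a assume a: "S < a"
    show "eventually (\<lambda>s. ereal (tilted_mean M \<xi> s) < a) F"
    proof (rule ev[OF I0])
      fix s assume s: "s0 / 2 < s" "s \<in> I"
      have "ereal (mean s) \<le> S" unfolding S_def by (rule SUP_upper[OF s(2)])
      thus "ereal (tilted_mean M \<xi> s) < a" using a tm[OF s(2)] by (simp add: le_less_trans)
    qed
  qed
  hence "tilted_mean_sup M \<xi> = S"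
    unfolding tilted_mean_sup_def F_def[symmetric] B_def[symmetric] by (intro tendsto_Lim nb)
  then obtain s where s: "s \<in> I" "x < mean s" using assms by (auto simp: S_def less_SUP_iff)
  obtain u where u: "u \<in> dom" "s < u" using above s by (auto simp: I_def)
  obtain a D where "tilt_rv M \<xi> s a (a + 1) D"
    using tilt_rv_exists[OF u(1), of s] u s by (auto simp: I_def)
  thus ?thesis using s by (intro exI[of _ s] exI conjI) auto
qed

end

theorem theorem4:
  fixes M :: "'a measure" and \<xi> :: "'a \<Rightarrow> real" and X Sh :: "nat \<Rightarrow> 'a \<Rightarrow> real"
    and b \<mu> :: real and p :: "real \<Rightarrow> real" and J :: ennreal
  assumes "prob_space M"
    and "\<xi> \<in> borel_measurable M"
    and "AE \<omega> in M. 0 \<le> \<xi> \<omega>"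
    and "\<not> (\<exists>c. AE \<omega> in M. \<xi> \<omega> = c)"
    and "decoupled_walk M \<xi> X Sh"
    and "0 < b" and "b < 1"
    and "\<forall>x\<ge>0. measure M {\<omega> \<in> space M. \<xi> \<omega> \<le> x} < 1"
    and "\<exists>s>0. mgf M \<xi> s < \<infinity>"
    and "\<mu> = (\<integral>\<omega>. \<xi> \<omega> \<partial>M)"
    and "p = (\<lambda>t. measure M
               {\<omega> \<in> space M. counting_process Sh t \<omega> = of_nat (nat \<lfloor>b * t / \<mu>\<rfloor>)})"
    and "J = rate_integral M \<xi> (b / \<mu>) (1 / \<mu>)"
  shows "integrable M \<xi> \<and> J < \<infinity>
    \<and> ((\<lambda>t. - extended_ln (ennreal (p t)) / ereal (t\<^sup>2)) \<longlongrightarrow> enn2ereal J) at_top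
    \<and> (nonlattice M \<xi> \<and> ereal (\<mu> / b) < tilted_mean_sup M \<xi> \<longrightarrow>
        (\<lambda>t. - ln (p t) - (t\<^sup>2 * enn2real J + (1 - b) / (2 * \<mu>) * t * ln t)) \<in> O(\<lambda>t. t))"
proof -
  interpret prob_space M by fact
  note [measurable] = assms(2)
  interpret R: nonneg_rv M \<xi> by unfold_locales (use assms in auto)
  have unb0: "prob {\<omega> \<in> space M. x < \<xi> \<omega>} > 0" if "x \<ge> 0" for x
  proof -
    have "{\<omega> \<in> space M. x < \<xi> \<omega>} = space M - {\<omega> \<in> space M. \<xi> \<omega> \<le> x}" by auto
    hence "prob {\<omega> \<in> space M. x < \<xi> \<omega>} = 1 - prob {\<omega> \<in> space M. \<xi> \<omega> \<le> x}"
      by (simp add: prob_compl)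
    thus ?thesis using assms(8) that by simp
  qed
  \<comment> \<open>The hypothesis concerns levels \<open>x \<ge> 0\<close>; negative levels follow
    by monotonicity.\<close>
  have unb: "prob {\<omega> \<in> space M. x < \<xi> \<omega>} > 0" for x
  proof (cases "x \<ge> 0")
    case False
    have "prob {\<omega> \<in> space M. 0 < \<xi> \<omega>} \<le> prob {\<omega> \<in> space M. x < \<xi> \<omega>}"
      using False by (intro finite_measure_mono) auto
    thus ?thesis using unb0[of 0] by simp
  qed (rule unb0)
  obtain s0 where s0: "s0 > 0" "mgf M \<xi> s0 < \<infinity>" using assms(9) by auto
  have dom: "s0 \<in> R.dom" unfolding R.dom_def mem_Collect_eq
    using s0 by (intro integrableI_nonneg) (auto simp: mgf_def)
  have walk: "indep_vars (\<lambda>_. borel) X {1..}" "\<And>i. i \<ge> 1 \<Longrightarrow> distr M borel (X i) = distr M borel \<xi>"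
    "indep_vars (\<lambda>_. borel) Sh {1..}" "\<And>n. n \<ge> 1 \<Longrightarrow> distr M borel (Sh n) = distr M borel (\<lambda>\<omega>. \<Sum>i=1..n. X i \<omega>)"
    using assms(5) by (auto simp: decoupled_walk_def)
  have Sh_tail: "prob {\<omega> \<in> space M. t < Sh n \<omega>} = R.q n t" if "n \<ge> 1" for n t
  proof (rule R.partial_sum_tail[OF walk(1,2)])
    show "Sh n \<in> borel_measurable M" using walk(3) that by (auto simp: indep_vars_def2)
  qed (use walk(4) that in auto)
  interpret decoupled_rv M \<xi> Sh s0 b
    by unfold_locales (use unb walk Sh_tail dom s0 assms in auto)
  have \<mu>: "local.\<mu> = \<mu>" by (simp add: \<mu>_def assms(10))
  have J: "local.J = J" using rate_integral_eq by (simp add: assms(12) \<alpha>_def \<beta>_def \<mu>)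
  have p: "local.p = p" by (simp add: fun_eq_iff p_def assms(11) kk_def \<alpha>_def \<mu>)
  obtain C t0 where pos: "t0 \<ge> 1" "\<And>t. t \<ge> t0 \<Longrightarrow> p t > 0"
    using p_bounds unfolding p by metis
  have "((\<lambda>t. ereal (- ln (p t) / t\<^sup>2)) \<longlongrightarrow> ereal j) at_top"
    using first_order unfolding p by (rule tendsto_ereal)
  \<comment> \<open>For large \<open>t\<close> the probability is positive, so
    \<open>extended_ln\<close> is the real logarithm.\<close>
  moreover have "eventually (\<lambda>t. ereal (- ln (p t) / t\<^sup>2) = - extended_ln (ennreal (p t)) / ereal (t\<^sup>2)) at_top"
    using eventually_ge_at_top[of t0]
  proof eventually_elim
    case (elim t)
    have "p t > 0" "t > 0" using pos elim by auto
    thus ?case by (simp add: extended_ln_def)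
  qed
  ultimately have "((\<lambda>t. - extended_ln (ennreal (p t)) / ereal (t\<^sup>2)) \<longlongrightarrow> ereal j) at_top"
    by (rule Lim_transform_eventually)
  moreover have "enn2ereal J = ereal j" using J_j by (simp add: J enn2ereal_ennreal)
  moreover have "(\<lambda>t. - ln (p t) - (t\<^sup>2 * enn2real J + (1 - b) / (2 * \<mu>) * t * ln t)) \<in> O(\<lambda>t. t)"
    if large: "ereal (\<mu> / b) < tilted_mean_sup M \<xi>"
  proof -
    obtain \<sigma> a a' D where "tilt_rv M \<xi> \<sigma> a a' D" "\<mu> / b \<le> R.mean \<sigma>"
      using exists_large_tilt[OF large] by blast
    then obtain C t1 where C: "\<And>t. t \<ge> t1 \<Longrightarrow> \<bar>- ln (p t) - (t\<^sup>2 * j + (1 - b) / (2 * \<mu>) * t * ln t)\<bar> \<le> C * t"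
      using second_order[of \<sigma> a a' D] unfolding p \<mu> by blast
    have jJ: "j = enn2real J" by (simp add: j_def J)
    show ?thesis
    proof (rule bigoI[where c = C])
      show "eventually (\<lambda>t. norm (- ln (p t) - (t\<^sup>2 * enn2real J + (1 - b) / (2 * \<mu>) * t * ln t)) \<le> C * norm t) at_top"
        using eventually_ge_at_top[of t1] eventually_ge_at_top[of 0]
        by eventually_elim (use C jJ in auto)
    qed
  qed
  ultimately show ?thesis using int_\<xi> J_finite J by simp
qed

end
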